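(* Let $R$ be an artinian principal ideal ring, $M$ a finitely generated $R$-module, $N$ an $R$-module with $N\cong_R R$, and $\langle\,,\rangle:M\times M\to N$ a symmetric $R$-bilinear form. Assume that $\langle\,,\rangle$ is non-degenerate. Then the following statements are equivalent: (i) the form $\langle\,,\rangle$ is quasi-anisotropic; (ii) the induced symmetric $R/\mathrm{Soc}_R(R)$-bilinear form $\langle\,,\rangle':M/\mathrm{Soc}_R(M)\times M/\mathrm{Soc}_R(M)\to N/\mathrm{Soc}_R(N)$ is anisotropic; (iii) for any submodule $L\subseteq\mathrm{lr}(M)$ we have $\mathrm{lr}(L^{\perp}/L)=\mathrm{lr}(M)/L$.
   Context: Rings are commutative with $1$. For a finitely generated $R$-module $M$ and $r\in R$ put $M[r]=\{m\in M: rm=0\}$, $rM=\{rm:m\in M\}$; $\mathrm{lr}(M)=\sum_{r\in R}(rM\cap M[r])$ and $\mathrm{ur}(M)=\bigcap_{r\in R}(rM+M[r])$; one has $\mathrm{lr}(M)\subseteq\mathrm{ur}(M)$. For an ideal $I$, $M[I]$ is the submodule of elements annihilated by $I$. $\mathrm{Soc}_R(M)$ is the sum of the simple submodules of $M$. The form is non-degenerate if $M\to\mathrm{Hom}_R(M,N)$, $m\mapsto\langle m,\cdot\rangle$, is an isomorphism. For a submodule $L$, $L^{\perp}=\{a\in M:\langle a,L\rangle=0\}$. Anisotropic. For a prime $\mathfrak p$ let $\langle\,,\rangle_{\mathfrak p}:M_{\mathfrak p}\times M_{\mathfrak p}\to N_{\mathfrak p}$ be the localized form, $(x/s,y/t)\mapsto\langle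 x,y\rangle/(st)$. The odd form at $\mathfrak p$ is the form $\mathrm{ur}(M_{\mathfrak p})/\mathrm{lr}(M_{\mathfrak p})\times\mathrm{ur}(M_{\mathfrak p})/\mathrm{lr}(M_{\mathfrak p})\to N_{\mathfrak p}[\mathfrak p]$, $([x],[y])\mapsto\langle x,y\rangle_{\mathfrak p}$, of $R/\mathfrak p$-vector spaces; the even form at $\mathfrak p$ is the odd form of the induced $R_{\mathfrak p}/R_{\mathfrak p}[\mathfrak p]$-bilinear form $M_{\mathfrak p}/M_{\mathfrak p}[\mathfrak p]\times M_{\mathfrak p}/M_{\mathfrak p}[\mathfrak p]\to N_{\mathfrak p}/N_{\mathfrak p}[\mathfrak p]$. The form is anisotropic if for all primes $\mathfrak p$ its odd and even forms at $\mathfrak p$ are anisotropic over the field $R/\mathfrak p$ (i.e. $\langle v,v\rangle\ne0$ for every nonzero $v$). The same definition applies over the artinian principal ideal ring $R/\mathrm{Soc}_R(R)$ (possibly the zero ring). Quasi-anisotropic. First let $(R,\mathfrak m)$ be local. For odd $i\ge1$ put $$\rho_i(M)=\mathfrak m^{\lfloor i/2\rfloor}M[\mathfrak m^i]\big/\left(\mathfrak m^{\lfloor i/2\rfloor}M[\mathfrak m^{i-1}]+\mathfrak m^{\lfloor i/2\rfloor+1}M[\mathfrak m^{i+1}]\right),$$ and for even $i\ge2$ put $\rho_i(M)=\rho_{i-1}(M/M[\mathfrak m])$; these are $R/\mathfrak m$-vector spaces. The natural maps $([x_i])_i\mapsto[\sum_i x_i]$ give isomorphisms $\bigoplus_{i\text{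 odd}}\rho_i(M)\cong\mathrm{ur}(M)/\mathrm{lr}(M)$ and $\bigoplus_{i\ge2\text{ even}}\rho_i(M)\cong\mathrm{ur}(M/M[\mathfrak m])/\mathrm{lr}(M/M[\mathfrak m])$, through which the odd and even forms (at $\mathfrak m$) are transported to the left-hand sides; the direct sums are orthogonal. Then $\langle\,,\rangle$ is quasi-anisotropic if it is non-degenerate and the forms on $\bigoplus_{i\text{ even}}\rho_i(M)$ and on $\bigoplus_{i\text{ odd},\,i\neq1}\rho_i(M)$ are anisotropic. For general $R$, $\langle\,,\rangle$ is quasi-anisotropic if for every prime $\mathfrak p$ of $R$ the form $\langle\,,\rangle_{\mathfrak p}$ over the local ring $R_{\mathfrak p}$ is quasi-anisotropic. *)

theory Defs
  imports "HOL-Algebra.Module" "HOL-Algebra.QuotRing" "HOL-Algebra.Ideal_Product"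
begin

text \<open>Rings and modules are the records of HOL-Algebra. The fields \<open>mult\<close> and \<open>one\<close> of a module
  record carry no information and are left undefined in the modules constructed below. Operations
  on cosets and on fractions are unions over all representatives, as in \<^const>\<open>rcoset_mult\<close>: for
  a well-defined operation all members of the union coincide.\<close>

section \<open>Rings and modules\<close>

definition artinian_ring :: "('a, 'r) ring_scheme \<Rightarrow> bool" where
  "artinian_ring R \<longleftrightarrow> ring R \<and>
    (\<forall>I :: nat \<Rightarrow> 'a set. (\<forall>n. ideal (I n) R) \<and> (\<forall>n. I (Suc n) \<subseteq> I n)
       \<longrightarrow> (\<exists>n. \<forall>k\<ge>n. I k = I n))"

text \<open>Zero divisors are allowed, and so is the zero ring.\<close>

definition principal_ideal_ring :: "('a, 'r) ring_scheme \<Rightarrow> bool" where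
  "principal_ideal_ring R \<longleftrightarrow> cring R \<and> (\<forall>I. ideal I R \<longrightarrow> principalideal I R)"

definition submodule_gen :: "('a, 'r) ring_scheme \<Rightarrow> ('a, 'b, 'm) module_scheme \<Rightarrow> 'b set \<Rightarrow> 'b set" where
  "submodule_gen R M S = \<Inter>{H. submodule H R M \<and> S \<subseteq> H}"

definition fin_gen_module :: "('a, 'r) ring_scheme \<Rightarrow> ('a, 'b, 'm) module_scheme \<Rightarrow> bool" where
  "fin_gen_module R M \<longleftrightarrow> (\<exists>S. finite S \<and> S \<subseteq> carrier M \<and> submodule_gen R M S = carrier M)"

definition regular_module :: "('a, 'r) ring_scheme \<Rightarrow> ('a, 'a) module" where
  "regular_module R = \<lparr>carrier = carrier R, monoid.mult = monoid.mult R, one = one R,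
     ring.zero = ring.zero R, ring.add = ring.add R,
     smult = monoid.mult R\<rparr>"

definition module_hom :: "('a, 'r) ring_scheme \<Rightarrow> ('a, 'b, 'm) module_scheme
    \<Rightarrow> ('a, 'c, 'n) module_scheme \<Rightarrow> ('b \<Rightarrow> 'c) set" where
  "module_hom R M N = {f \<in> carrier M \<rightarrow>\<^sub>E carrier N.
     (\<forall>x\<in>carrier M. \<forall>y\<in>carrier M. f (x \<oplus>\<^bsub>M\<^esub> y) = f x \<oplus>\<^bsub>N\<^esub> f y) \<and>
     (\<forall>a\<in>carrier R. \<forall>x\<in>carrier M. f (a \<odot>\<^bsub>M\<^esub> x) = a \<odot>\<^bsub>N\<^esub> f x)}"

definition module_iso :: "('a, 'r) ring_scheme \<Rightarrow> ('a, 'b, 'm) module_scheme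
    \<Rightarrow> ('a, 'c, 'n) module_scheme \<Rightarrow> ('b \<Rightarrow> 'c) set" where
  "module_iso R M N = {f \<in> module_hom R M N. bij_betw f (carrier M) (carrier N)}"

definition is_module_iso :: "('a, 'r) ring_scheme \<Rightarrow> ('a, 'b, 'm) module_scheme
    \<Rightarrow> ('a, 'c, 'n) module_scheme \<Rightarrow> bool" where
  "is_module_iso R M N \<longleftrightarrow> module_iso R M N \<noteq> {}"

definition hom_module :: "('a, 'r) ring_scheme \<Rightarrow> ('a, 'b, 'm) module_scheme
    \<Rightarrow> ('a, 'c, 'n) module_scheme \<Rightarrow> ('a, 'b \<Rightarrow> 'c) module" where
  "hom_module R M N = \<lparr>carrier = module_hom R M N, monoid.mult = undefined, one = undefined,
     ring.zero = (\<lambda>x\<in>carrier M. \<zero>\<^bsub>N\<^esub>),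
     ring.add = (\<lambda>f g. \<lambda>x\<in>carrier M. f x \<oplus>\<^bsub>N\<^esub> g x),
     smult = (\<lambda>a f. \<lambda>x\<in>carrier M. a \<odot>\<^bsub>N\<^esub> f x)\<rparr>"

text \<open>\<open>fact_module M L\<close> is \<open>M/L\<close> as a module over the ring \<open>R\<close> of \<open>M\<close>; \<open>fact_module_over M L\<close> is
  \<open>M/L\<close> as a module over \<open>R Quot J\<close>, for an ideal \<open>J\<close> with \<open>JM \<subseteq> L\<close>.\<close>

definition fact_module :: "('a, 'b, 'm) module_scheme \<Rightarrow> 'b set \<Rightarrow> ('a, 'b set) module" where
  "fact_module M L = \<lparr>carrier = a_rcosets\<^bsub>M\<^esub> L, monoid.mult = undefined, one = undefined,
     ring.zero = L, ring.add = set_add M,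
     smult = (\<lambda>a X. \<Union>x\<in>X. L +>\<^bsub>M\<^esub> (a \<odot>\<^bsub>M\<^esub> x))\<rparr>"

definition fact_module_over :: "('a, 'b, 'm) module_scheme \<Rightarrow> 'b set \<Rightarrow> ('a set, 'b set) module" where
  "fact_module_over M L = \<lparr>carrier = a_rcosets\<^bsub>M\<^esub> L, monoid.mult = undefined, one = undefined,
     ring.zero = L, ring.add = set_add M,
     smult = (\<lambda>A X. \<Union>a\<in>A. \<Union>x\<in>X. L +>\<^bsub>M\<^esub> (a \<odot>\<^bsub>M\<^esub> x))\<rparr>"

text \<open>\<open>M[I]\<close> for a set \<open>I\<close> of scalars; \<open>M[r]\<close> is \<open>tors M {r}\<close>.\<close>

definition tors :: "('a, 'b, 'm) module_scheme \<Rightarrow> 'a set \<Rightarrow> 'b set" where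
  "tors M I = {x \<in> carrier M. \<forall>a\<in>I. a \<odot>\<^bsub>M\<^esub> x = \<zero>\<^bsub>M\<^esub>}"

definition scalar_image :: "('a, 'b, 'm) module_scheme \<Rightarrow> 'a \<Rightarrow> 'b set" where
  "scalar_image M r = (\<lambda>x. r \<odot>\<^bsub>M\<^esub> x) ` carrier M"

definition lr :: "('a, 'r) ring_scheme \<Rightarrow> ('a, 'b, 'm) module_scheme \<Rightarrow> 'b set" where
  "lr R M = submodule_gen R M (\<Union>r\<in>carrier R. scalar_image M r \<inter> tors M {r})"

definition ur :: "('a, 'r) ring_scheme \<Rightarrow> ('a, 'b, 'm) module_scheme \<Rightarrow> 'b set" where
  "ur R M = (\<Inter>r\<in>carrier R. scalar_image M r <+>\<^bsub>M\<^esub> tors M {r})"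

definition simple_submodule :: "'b set \<Rightarrow> ('a, 'r) ring_scheme \<Rightarrow> ('a, 'b, 'm) module_scheme \<Rightarrow> bool" where
  "simple_submodule H R M \<longleftrightarrow> submodule H R M \<and> H \<noteq> {\<zero>\<^bsub>M\<^esub>} \<and>
     (\<forall>K. submodule K R M \<and> K \<subseteq> H \<longrightarrow> K = {\<zero>\<^bsub>M\<^esub>} \<or> K = H)"

definition Soc :: "('a, 'r) ring_scheme \<Rightarrow> ('a, 'b, 'm) module_scheme \<Rightarrow> 'b set" where
  "Soc R M = submodule_gen R M (\<Union>{H. simple_submodule H R M})"

definition ideal_smult :: "('a, 'r) ring_scheme \<Rightarrow> ('a, 'b, 'm) module_scheme
    \<Rightarrow> 'a set \<Rightarrow> 'b set \<Rightarrow> 'b set" where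
  "ideal_smult R M I H = submodule_gen R M {a \<odot>\<^bsub>M\<^esub> x | a x. a \<in> I \<and> x \<in> H}"

definition module_dsum :: "'i set \<Rightarrow> ('i \<Rightarrow> ('a, 'b, 'm) module_scheme) \<Rightarrow> ('a, 'i \<Rightarrow> 'b) module" where
  "module_dsum I V = \<lparr>
     carrier = {v \<in> (\<Pi>\<^sub>E i\<in>I. carrier (V i)). finite {i \<in> I. v i \<noteq> \<zero>\<^bsub>V i\<^esub>}},
     monoid.mult = undefined, one = undefined,
     ring.zero = (\<lambda>i\<in>I. \<zero>\<^bsub>V i\<^esub>),
     ring.add = (\<lambda>v w. \<lambda>i\<in>I. v i \<oplus>\<^bsub>V i\<^esub> w i),
     smult = (\<lambda>a v. \<lambda>i\<in>I. a \<odot>\<^bsub>V i\<^esub> v i)\<rparr>"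


section \<open>Localization at a prime ideal\<close>

text \<open>The fraction \<open>x/s\<close> is the class of \<open>(x, s)\<close>. As \<open>R\<close> may have zero divisors, equality of
  fractions involves a further factor \<open>u\<close>.\<close>

definition loc_frac :: "('a, 'r) ring_scheme \<Rightarrow> 'a set \<Rightarrow> ('a, 'b, 'm) module_scheme
    \<Rightarrow> 'b \<Rightarrow> 'a \<Rightarrow> ('b \<times> 'a) set" where
  "loc_frac R p M x s = {(y, t). y \<in> carrier M \<and> t \<in> carrier R - p \<and>
     (\<exists>u\<in>carrier R - p. u \<odot>\<^bsub>M\<^esub> (t \<odot>\<^bsub>M\<^esub> x) = u \<odot>\<^bsub>M\<^esub> (s \<odot>\<^bsub>M\<^esub> y))}"

definition loc_module :: "('a, 'r) ring_scheme \<Rightarrow> 'a set \<Rightarrow> ('a, 'b, 'm) module_scheme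
    \<Rightarrow> (('a \<times> 'a) set, ('b \<times> 'a) set) module" where
  "loc_module R p M = \<lparr>
     carrier = {loc_frac R p M x s | x s. x \<in> carrier M \<and> s \<in> carrier R - p},
     monoid.mult = undefined, one = undefined,
     ring.zero = loc_frac R p M \<zero>\<^bsub>M\<^esub> \<one>\<^bsub>R\<^esub>,
     ring.add = (\<lambda>X Y. \<Union>(x, s)\<in>X. \<Union>(y, t)\<in>Y.
              loc_frac R p M (t \<odot>\<^bsub>M\<^esub> x \<oplus>\<^bsub>M\<^esub> s \<odot>\<^bsub>M\<^esub> y) (s \<otimes>\<^bsub>R\<^esub> t)),
     smult = (\<lambda>A X. \<Union>(a, s)\<in>A. \<Union>(x, t)\<in>X. loc_frac R p M (a \<odot>\<^bsub>M\<^esub> x) (s \<otimes>\<^bsub>R\<^esub> t))\<rparr>"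

definition loc_ring :: "('a, 'r) ring_scheme \<Rightarrow> 'a set \<Rightarrow> ('a \<times> 'a) set ring" where
  "loc_ring R p = \<lparr>
     carrier = carrier (loc_module R p (regular_module R)),
     monoid.mult = smult (loc_module R p (regular_module R)),
     one = loc_frac R p (regular_module R) \<one>\<^bsub>R\<^esub> \<one>\<^bsub>R\<^esub>,
     ring.zero = ring.zero (loc_module R p (regular_module R)),
     ring.add = ring.add (loc_module R p (regular_module R))\<rparr>"

text \<open>The maximal ideal of the localized ring.\<close>

definition loc_ideal :: "('a, 'r) ring_scheme \<Rightarrow> 'a set \<Rightarrow> ('a \<times> 'a) set set" where
  "loc_ideal R p = {loc_frac R p (regular_module R) a s | a s. a \<in> p \<and> s \<in> carrier R - p}"


section \<open>Forms\<close>

definition symmetric_bilinear_form :: "('a, 'r) ring_scheme \<Rightarrow> ('a, 'b, 'm) module_scheme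
    \<Rightarrow> ('a, 'c, 'n) module_scheme \<Rightarrow> ('b \<Rightarrow> 'b \<Rightarrow> 'c) \<Rightarrow> bool" where
  "symmetric_bilinear_form R M N B \<longleftrightarrow>
     (\<forall>x\<in>carrier M. \<forall>y\<in>carrier M. B x y \<in> carrier N) \<and>
     (\<forall>x\<in>carrier M. \<forall>y\<in>carrier M. \<forall>z\<in>carrier M.
        B (x \<oplus>\<^bsub>M\<^esub> y) z = B x z \<oplus>\<^bsub>N\<^esub> B y z \<and> B x (y \<oplus>\<^bsub>M\<^esub> z) = B x y \<oplus>\<^bsub>N\<^esub> B x z) \<and>
     (\<forall>a\<in>carrier R. \<forall>x\<in>carrier M. \<forall>y\<in>carrier M.
        B (a \<odot>\<^bsub>M\<^esub> x) y = a \<odot>\<^bsub>N\<^esub> B x y \<and> B x (a \<odot>\<^bsub>M\<^esub> y) = a \<odot>\<^bsub>N\<^esub> B x y) \<and>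
     (\<forall>x\<in>carrier M. \<forall>y\<in>carrier M. B x y = B y x)"

definition nondegenerate :: "('a, 'r) ring_scheme \<Rightarrow> ('a, 'b, 'm) module_scheme
    \<Rightarrow> ('a, 'c, 'n) module_scheme \<Rightarrow> ('b \<Rightarrow> 'b \<Rightarrow> 'c) \<Rightarrow> bool" where
  "nondegenerate R M N B \<longleftrightarrow>
     (\<lambda>x\<in>carrier M. \<lambda>y\<in>carrier M. B x y) \<in> module_iso R M (hom_module R M N)"

definition perp :: "('a, 'b, 'm) module_scheme \<Rightarrow> ('a, 'c, 'n) module_scheme
    \<Rightarrow> ('b \<Rightarrow> 'b \<Rightarrow> 'c) \<Rightarrow> 'b set \<Rightarrow> 'b set" where
  "perp M N B L = {x \<in> carrier M. \<forall>y\<in>L. B x y = \<zero>\<^bsub>N\<^esub>}"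

text \<open>The form induced by \<open>B\<close> on quotients of \<open>M\<close>, with values in \<open>N/K\<close>.\<close>

definition quot_form :: "('a, 'c, 'n) module_scheme \<Rightarrow> 'c set \<Rightarrow> ('b \<Rightarrow> 'b \<Rightarrow> 'c)
    \<Rightarrow> 'b set \<Rightarrow> 'b set \<Rightarrow> 'c set" where
  "quot_form N K B X Y = (\<Union>x\<in>X. \<Union>y\<in>Y. K +>\<^bsub>N\<^esub> B x y)"

definition loc_form :: "('a, 'r) ring_scheme \<Rightarrow> 'a set \<Rightarrow> ('a, 'c, 'n) module_scheme
    \<Rightarrow> ('b \<Rightarrow> 'b \<Rightarrow> 'c) \<Rightarrow> ('b \<times> 'a) set \<Rightarrow> ('b \<times> 'a) set \<Rightarrow> ('c \<times> 'a) set" where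
  "loc_form R p N B X Y = (\<Union>(x, s)\<in>X. \<Union>(y, t)\<in>Y. loc_frac R p N (B x y) (s \<otimes>\<^bsub>R\<^esub> t))"

text \<open>A form on \<open>V\<close> with values in (a subgroup of) \<open>N\<close>.\<close>

definition anisotropic_on :: "('s, 'v, 'm) module_scheme \<Rightarrow> ('a, 'c, 'n) module_scheme
    \<Rightarrow> ('v \<Rightarrow> 'v \<Rightarrow> 'c) \<Rightarrow> bool" where
  "anisotropic_on V N b \<longleftrightarrow> (\<forall>v\<in>carrier V. v \<noteq> \<zero>\<^bsub>V\<^esub> \<longrightarrow> b v v \<noteq> \<zero>\<^bsub>N\<^esub>)"


subsection \<open>Odd and even form over a local ring\<close>

text \<open>Here \<open>R\<close> is a local ring with maximal ideal \<open>m\<close>. The spaces \<open>ur(M)/lr(M)\<close> are kept as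
  \<open>R\<close>-modules on which \<open>m\<close> acts as zero.\<close>

definition odd_module :: "('a, 'r) ring_scheme \<Rightarrow> ('a, 'b, 'm) module_scheme \<Rightarrow> ('a, 'b set) module" where
  "odd_module R M = fact_module (M\<lparr>carrier := ur R M\<rparr>) (lr R M)"

text \<open>The values lie in \<open>N\<close> itself and do not depend on representatives, as \<open>lr(M)\<close> and \<open>ur(M)\<close> are
  orthogonal.\<close>

definition odd_form :: "('b \<Rightarrow> 'b \<Rightarrow> 'c) \<Rightarrow> 'b set \<Rightarrow> 'b set \<Rightarrow> 'c" where
  "odd_form B X Y = the_elem ((\<lambda>(x, y). B x y) ` (X \<times> Y))"

text \<open>If \<open>R\<close> is a field, then \<open>even_ring R m\<close> is the zero ring.\<close>

definition even_ring :: "('a, 'r) ring_scheme \<Rightarrow> 'a set \<Rightarrow> 'a set ring" where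
  "even_ring R m = R Quot tors (regular_module R) m"

definition even_quot :: "'a set \<Rightarrow> ('a, 'b, 'm) module_scheme \<Rightarrow> ('a set, 'b set) module" where
  "even_quot m M = fact_module_over M (tors M m)"

definition even_module :: "('a, 'r) ring_scheme \<Rightarrow> 'a set \<Rightarrow> ('a, 'b, 'm) module_scheme
    \<Rightarrow> ('a set, 'b set set) module" where
  "even_module R m M = odd_module (even_ring R m) (even_quot m M)"

definition even_form :: "'a set \<Rightarrow> ('a, 'c, 'n) module_scheme \<Rightarrow> ('b \<Rightarrow> 'b \<Rightarrow> 'c)
    \<Rightarrow> 'b set set \<Rightarrow> 'b set set \<Rightarrow> 'c set" where
  "even_form m N B = odd_form (quot_form N (tors N m) B)"


subsection \<open>Anisotropic forms\<close>

definition anisotropic :: "('a, 'r) ring_scheme \<Rightarrow> ('a, 'b, 'm) module_scheme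
    \<Rightarrow> ('a, 'c, 'n) module_scheme \<Rightarrow> ('b \<Rightarrow> 'b \<Rightarrow> 'c) \<Rightarrow> bool" where
  "anisotropic R M N B \<longleftrightarrow> (\<forall>p. primeideal p R \<longrightarrow>
     anisotropic_on (odd_module (loc_ring R p) (loc_module R p M))
       (loc_module R p N) (odd_form (loc_form R p N B)) \<and>
     anisotropic_on (even_module (loc_ring R p) (loc_ideal R p) (loc_module R p M))
       (even_quot (loc_ideal R p) (loc_module R p N))
       (even_form (loc_ideal R p) (loc_module R p N) (loc_form R p N B)))"


subsection \<open>Quasi-anisotropic forms\<close>

definition rho_odd :: "('a, 'r) ring_scheme \<Rightarrow> 'a set \<Rightarrow> ('a, 'b, 'm) module_scheme
    \<Rightarrow> nat \<Rightarrow> ('a, 'b set) module" where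
  "rho_odd R m M i = (let pow = (\<lambda>k. m [^]\<^bsub>ideals_set R\<^esub> (k::nat)) in
     fact_module
       (M\<lparr>carrier := ideal_smult R M (pow (i div 2)) (tors M (pow i))\<rparr>)
       (ideal_smult R M (pow (i div 2)) (tors M (pow (i - 1))) <+>\<^bsub>M\<^esub>
        ideal_smult R M (pow (i div 2 + 1)) (tors M (pow (i + 1)))))"

definition rho_even :: "('a, 'r) ring_scheme \<Rightarrow> 'a set \<Rightarrow> ('a, 'b, 'm) module_scheme
    \<Rightarrow> nat \<Rightarrow> ('a, 'b set set) module" where
  "rho_even R m M i = rho_odd R m (fact_module M (tors M m)) (i - 1)"

text \<open>The natural map \<open>([x\<^sub>i])\<^sub>i \<mapsto> [\<Sum>\<^sub>i x\<^sub>i]\<close> from the direct sum of the subquotients \<open>V i\<close> of \<open>M\<close>,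
  \<open>i \<in> I\<close>, to cosets of \<open>L\<close> in \<open>M\<close>.\<close>

definition natural_map :: "('a, 'b, 'm) module_scheme \<Rightarrow> 'b set \<Rightarrow> 'i set
    \<Rightarrow> ('i \<Rightarrow> ('s, 'b set, 'n) module_scheme) \<Rightarrow> ('i \<Rightarrow> 'b set) \<Rightarrow> 'b set" where
  "natural_map M L I V v = (let S = {i \<in> I. v i \<noteq> \<zero>\<^bsub>V i\<^esub>} in
     \<Union>x\<in>(\<Pi>\<^sub>E i\<in>S. v i). L +>\<^bsub>M\<^esub> (\<Oplus>\<^bsub>M\<^esub>i\<in>S. x i))"

definition rho_odd_form :: "('a, 'r) ring_scheme \<Rightarrow> 'a set \<Rightarrow> ('a, 'b, 'm) module_scheme
    \<Rightarrow> ('b \<Rightarrow> 'b \<Rightarrow> 'c) \<Rightarrow> nat set \<Rightarrow> (nat \<Rightarrow> 'b set) \<Rightarrow> (nat \<Rightarrow> 'b set) \<Rightarrow> 'c" where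
  "rho_odd_form R m M B I v w =
     odd_form B (natural_map M (lr R M) I (rho_odd R m M) v)
                (natural_map M (lr R M) I (rho_odd R m M) w)"

definition rho_even_form :: "('a, 'r) ring_scheme \<Rightarrow> 'a set \<Rightarrow> ('a, 'b, 'm) module_scheme
    \<Rightarrow> ('a, 'c, 'n) module_scheme \<Rightarrow> ('b \<Rightarrow> 'b \<Rightarrow> 'c) \<Rightarrow> nat set
    \<Rightarrow> (nat \<Rightarrow> 'b set set) \<Rightarrow> (nat \<Rightarrow> 'b set set) \<Rightarrow> 'c set" where
  "rho_even_form R m M N B I v w =
     even_form m N B
       (natural_map (even_quot m M) (lr (even_ring R m) (even_quot m M)) I (rho_even R m M) v)
       (natural_map (even_quot m M) (lr (even_ring R m) (even_quot m M)) I (rho_even R m M) w)"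

definition quasi_anisotropic_local :: "('a, 'r) ring_scheme \<Rightarrow> 'a set \<Rightarrow> ('a, 'b, 'm) module_scheme
    \<Rightarrow> ('a, 'c, 'n) module_scheme \<Rightarrow> ('b \<Rightarrow> 'b \<Rightarrow> 'c) \<Rightarrow> bool" where
  "quasi_anisotropic_local R m M N B \<longleftrightarrow>
     nondegenerate R M N B \<and>
     (let I = {i. even i \<and> 2 \<le> i} in
        anisotropic_on (module_dsum I (rho_even R m M)) (even_quot m N) (rho_even_form R m M N B I)) \<and>
     (let I = {i. odd i \<and> i \<noteq> 1} in
        anisotropic_on (module_dsum I (rho_odd R m M)) N (rho_odd_form R m M B I))"

definition quasi_anisotropic :: "('a, 'r) ring_scheme \<Rightarrow> ('a, 'b, 'm) module_scheme
    \<Rightarrow> ('a, 'c, 'n) module_scheme \<Rightarrow> ('b \<Rightarrow> 'b \<Rightarrow> 'c) \<Rightarrow> bool" where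
  "quasi_anisotropic R M N B \<longleftrightarrow> (\<forall>p. primeideal p R \<longrightarrow>
     quasi_anisotropic_local (loc_ring R p) (loc_ideal R p) (loc_module R p M) (loc_module R p N)
       (loc_form R p N B))"

end

theory Submission
  imports Defs
begin

text \<open>Each prime \<open>p = (q)\<close> comes with an idempotent \<open>e\<close> such that \<open>e R \<cong> R\<^sub>p\<close> and \<open>e q\<close> is nilpotent. Call
  \<open>x \<in> M\<close> \<open>j\<close>-divisible if \<open>e q\<^sup>i x \<in> e q\<^sup>2\<^sup>i\<^sup>+\<^sup>1\<^sup>-\<^sup>j M\<close> for all \<open>i\<close>. The modules \<open>M\<^sub>p\<close>, \<open>M\<^sub>p/M\<^sub>p[p]\<close> and
  \<open>M\<^sub>p/M\<^sub>p[p\<^sup>2]\<close> are isomorphic to \<open>q\<^sup>j e M\<close> for \<open>j = 0, 1, 2\<close>, and \<open>lr\<close> and \<open>ur\<close> of \<open>q\<^sup>j e M\<close> pull back to the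
  \<open>j\<close>-divisible and to the \<open>(j + 1)\<close>-divisible elements of \<open>M\<close>. Let \<open>A(j)\<close> be the condition that, for every
  \<open>p\<close>, a \<open>(j + 1)\<close>-divisible \<open>x\<close> with \<open>e q\<^sup>j \<langle>x, x\<rangle> = 0\<close> is \<open>j\<close>-divisible. Since \<open>q x\<close> is \<open>j\<close>-divisible
  iff \<open>x\<close> is \<open>(j + 2)\<close>-divisible, both (i) and (ii) say that \<open>A(1)\<close> and \<open>A(2)\<close> hold, and then \<open>A(j)\<close> holds for all
  \<open>j \<ge> 1\<close>. As every element is \<open>n\<close>-divisible for large \<open>n\<close>, it follows that \<open>e q\<^sup>j \<langle>x, x\<rangle> = 0\<close> alone forces \<open>x\<close> to be
  \<open>j\<close>-divisible. One inclusion in (iii) follows directly from this, the other one by duality, because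
  \<open>X\<^sup>\<bottom>\<^sup>\<bottom> = X\<close> for all submodules \<open>X\<close>. Conversely, \<open>A(j)\<close> at \<open>x\<close> follows from (iii) for
  \<open>L = R e q\<^sup>j x\<close>.\<close>

section \<open>Submodules\<close>

text \<open>The modules in (i) and (ii) are nested quotients and fractions over different rings,
  with different types. Nothing is computed inside them: each is reached from \<open>M\<close> by a
  surjection, semilinear along a ring surjection, with kernel \<open>M[c]\<close> for one scalar
  \<open>c\<close>, and these scalars multiply under composition. Localizing \<open>M\<close> gives
  \<open>c = e\<close>. The even form contributes a further factor \<open>q\<close>; leaving out
  \<open>\<rho>_1\<close> restricts the odd form to multiples \<open>q w\<close>, which turns
  \<open>A(0)\<close> into \<open>A(2)\<close>. For (ii), \<open>Soc M = M[s]\<close> where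
  \<open>s\<close> generates the intersection of all primes; \<open>s e\<close> and
  \<open>e q\<close> divide each other, so the localized quotient has \<open>c = e q\<close>. The
  artinian condition yields \<open>e\<close>, because the powers of \<open>q\<close> generate a
  stationary chain of ideals. The duality comes from \<open>N \<cong> R\<close>: in \<open>R\<close>
  every principal ideal is the annihilator of its annihilator, and this extends functionals from
  submodules. \<open>A(0)\<close> is never available: isotropic elements outside
  \<open>lr(M)\<close> may exist. Hence in (iii) a factor \<open>q\<close> must be gained before
  anisotropy can be applied.\<close>

lemma (in module) submodule_gen_submodule:
  assumes "S \<subseteq> carrier M"
  shows "submodule (submodule_gen R M S) R M"
  unfolding submodule_gen_def
proof (rule submoduleI)
  show "\<Inter>{H. submodule H R M \<and> S \<subseteq> H} \<subseteq> carrier M"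
    using carrier_is_submodule assms by blast
  show "\<zero>\<^bsub>M\<^esub> \<in> \<Inter>{H. submodule H R M \<and> S \<subseteq> H}"
    using submodule.axioms(1) subgroup.one_closed by fastforce
qed (auto dest: submoduleE)

lemma submodule_gen_incl: "S \<subseteq> submodule_gen R M S"
  unfolding submodule_gen_def by blast

lemma submodule_gen_minimal: "submodule H R M \<Longrightarrow> S \<subseteq> H \<Longrightarrow> submodule_gen R M S \<subseteq> H"
  unfolding submodule_gen_def by blast

lemma (in module) submodule_gen_self:
  "submodule H R M \<Longrightarrow> submodule_gen R M H = H"
  by (intro equalityI submodule_gen_incl submodule_gen_minimal) auto

lemma (in module) submodule_zero_closed: "submodule H R M \<Longrightarrow> \<zero>\<^bsub>M\<^esub> \<in> H"
  using submodule.axioms(1) subgroup.one_closed by fastforce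

text \<open>Closure under negation is omitted because it is multiplication by
  \<open>\<ominus> \<one>\<close>.\<close>

lemma (in module) submodule_iff:
  "submodule H R M \<longleftrightarrow> H \<subseteq> carrier M \<and> \<zero>\<^bsub>M\<^esub> \<in> H \<and> (\<forall>x\<in>H. \<forall>y\<in>H. x \<oplus>\<^bsub>M\<^esub> y \<in> H) \<and>
    (\<forall>a\<in>carrier R. \<forall>x\<in>H. a \<odot>\<^bsub>M\<^esub> x \<in> H)"
proof
  assume "submodule H R M"
  then show "H \<subseteq> carrier M \<and> \<zero>\<^bsub>M\<^esub> \<in> H \<and> (\<forall>x\<in>H. \<forall>y\<in>H. x \<oplus>\<^bsub>M\<^esub> y \<in> H) \<and>
    (\<forall>a\<in>carrier R. \<forall>x\<in>H. a \<odot>\<^bsub>M\<^esub> x \<in> H)" using submoduleE submodule_zero_closed by auto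
next
  assume H: "H \<subseteq> carrier M \<and> \<zero>\<^bsub>M\<^esub> \<in> H \<and> (\<forall>x\<in>H. \<forall>y\<in>H. x \<oplus>\<^bsub>M\<^esub> y \<in> H) \<and>
    (\<forall>a\<in>carrier R. \<forall>x\<in>H. a \<odot>\<^bsub>M\<^esub> x \<in> H)"
  have "\<ominus>\<^bsub>M\<^esub> x \<in> H" if x: "x \<in> H" for x
  proof -
    have "(\<ominus> \<one>) \<odot>\<^bsub>M\<^esub> x \<in> H" using H x by blast
    moreover have "x \<in> carrier M" using H x by blast
    ultimately show ?thesis by (simp add: smult_l_minus)
  qed
  then show "submodule H R M" using H by (intro submoduleI) auto
qed

lemma (in module) cyclic_submodule:
  assumes w: "w \<in> carrier M"
  shows "submodule ((\<lambda>a. a \<odot>\<^bsub>M\<^esub> w) ` carrier R) R M"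
  unfolding submodule_iff
proof (intro conjI ballI)
  show "\<zero>\<^bsub>M\<^esub> \<in> (\<lambda>a. a \<odot>\<^bsub>M\<^esub> w) ` carrier R" using w by (intro image_eqI[of _ _ \<zero>]) auto
  fix x assume "x \<in> (\<lambda>a. a \<odot>\<^bsub>M\<^esub> w) ` carrier R"
  then obtain a where a: "a \<in> carrier R" "x = a \<odot>\<^bsub>M\<^esub> w" by blast
  show "b \<odot>\<^bsub>M\<^esub> x \<in> (\<lambda>a. a \<odot>\<^bsub>M\<^esub> w) ` carrier R" if "b \<in> carrier R" for b
    using that a w by (intro image_eqI[of _ _ "b \<otimes> a"]) (auto simp: smult_assoc1)
  fix y assume "y \<in> (\<lambda>a. a \<odot>\<^bsub>M\<^esub> w) ` carrier R"
  then obtain b where b: "b \<in> carrier R" "y = b \<odot>\<^bsub>M\<^esub> w" by blast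
  show "x \<oplus>\<^bsub>M\<^esub> y \<in> (\<lambda>a. a \<odot>\<^bsub>M\<^esub> w) ` carrier R"
    using a b w by (intro image_eqI[of _ _ "a \<oplus> b"]) (auto simp: smult_l_distr)
qed (use w in auto)

text \<open>The ideal \<open>(H : x)\<close> measures how far \<open>x\<close> is from
  \<open>H\<close>: it contains \<open>\<one>\<close> exactly when \<open>x \<in> H\<close>. In a
  principal ideal ring a single scalar describes it.\<close>

lemma (in module) colon_is_ideal:
  assumes H: "submodule H R M" and x: "x \<in> carrier M"
  shows "ideal {a \<in> carrier R. a \<odot>\<^bsub>M\<^esub> x \<in> H} R" (is "ideal ?J R")
proof (rule idealI[OF R.ring_axioms])
  note HE = submoduleE[OF H] submodule_zero_closed[OF H]
  show "subgroup ?J (add_monoid R)"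
    using x HE by (intro subgroup.intro) (auto simp: smult_l_distr smult_l_minus a_inv_def[symmetric])
  fix a b assume a: "a \<in> ?J" and b: "b \<in> carrier R"
  show "b \<otimes> a \<in> ?J" using a b x HE by (simp add: smult_assoc1)
  then show "a \<otimes> b \<in> ?J" using a b by (simp add: R.m_comm)
qed

lemma (in module) submodule_minus_closed:
  assumes "submodule H R M" "x \<in> H" "y \<in> H"
  shows "x \<ominus>\<^bsub>M\<^esub> y \<in> H"
  unfolding a_minus_def using submoduleE[OF assms(1)] assms by blast

lemma (in module) submodule_add_cancel:
  assumes "submodule H R M" "x \<ominus>\<^bsub>M\<^esub> y \<in> H" "y \<in> H" "x \<in> carrier M"
  shows "x \<in> H"
proof -
  have "(x \<ominus>\<^bsub>M\<^esub> y) \<oplus>\<^bsub>M\<^esub> y \<in> H" using submoduleE(5)[OF assms(1)] assms by blast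
  moreover have "y \<in> carrier M" using submoduleE(1)[OF assms(1)] assms by blast
  ultimately show ?thesis using assms(4) by (simp add: a_minus_def M.a_assoc M.l_neg)
qed

lemma (in module) submodule_add_cancel':
  assumes "submodule H R M" "x \<ominus>\<^bsub>M\<^esub> y \<in> H" "x \<in> H" "y \<in> carrier M"
  shows "y \<in> H"
proof -
  have "\<ominus>\<^bsub>M\<^esub> (x \<ominus>\<^bsub>M\<^esub> y) \<oplus>\<^bsub>M\<^esub> x \<in> H" using submoduleE(3,5)[OF assms(1)] assms by blast
  moreover have x: "x \<in> carrier M" using submoduleE(1)[OF assms(1)] assms by blast
  then have "\<ominus>\<^bsub>M\<^esub> (x \<ominus>\<^bsub>M\<^esub> y) \<oplus>\<^bsub>M\<^esub> x = y \<oplus>\<^bsub>M\<^esub> (\<ominus>\<^bsub>M\<^esub> x \<oplus>\<^bsub>M\<^esub> x)"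
    using assms(4) by (simp add: a_minus_def M.minus_add M.a_ac(2)[of "\<ominus>\<^bsub>M\<^esub> x" y] M.a_assoc)
  then have "\<ominus>\<^bsub>M\<^esub> (x \<ominus>\<^bsub>M\<^esub> y) \<oplus>\<^bsub>M\<^esub> x = y" using x assms(4) by (simp add: M.l_neg)
  ultimately show ?thesis by simp
qed

lemma (in module) smult_minus:
  "a \<in> carrier R \<Longrightarrow> x \<in> carrier M \<Longrightarrow> y \<in> carrier M \<Longrightarrow>
    a \<odot>\<^bsub>M\<^esub> (x \<ominus>\<^bsub>M\<^esub> y) = a \<odot>\<^bsub>M\<^esub> x \<ominus>\<^bsub>M\<^esub> a \<odot>\<^bsub>M\<^esub> y"
  unfolding a_minus_def by (simp add: smult_r_distr smult_r_minus)

lemma (in module) smult_left_comm: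
  "a \<in> carrier R \<Longrightarrow> b \<in> carrier R \<Longrightarrow> x \<in> carrier M \<Longrightarrow>
    a \<odot>\<^bsub>M\<^esub> (b \<odot>\<^bsub>M\<^esub> x) = b \<odot>\<^bsub>M\<^esub> (a \<odot>\<^bsub>M\<^esub> x)"
  by (metis R.m_comm smult_assoc1)

lemma (in abelian_group) minus_eq_zero_iff [simp]:
  assumes "x \<in> carrier G" "y \<in> carrier G"
  shows "x \<ominus> y = \<zero> \<longleftrightarrow> x = y"
proof
  assume "x \<ominus> y = \<zero>"
  then have "x \<oplus> \<ominus> y \<oplus> y = y" using assms by (simp add: a_minus_def)
  then show "x = y" using assms by (simp add: a_assoc l_neg)
qed (use assms in \<open>simp add: a_minus_def r_neg\<close>)

lemma (in module) minus_add_swap: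
  assumes "x \<in> carrier M" "y \<in> carrier M" "z \<in> carrier M" "w \<in> carrier M"
  shows "(x \<oplus>\<^bsub>M\<^esub> y) \<ominus>\<^bsub>M\<^esub> (z \<oplus>\<^bsub>M\<^esub> w) = (x \<ominus>\<^bsub>M\<^esub> z) \<oplus>\<^bsub>M\<^esub> (y \<ominus>\<^bsub>M\<^esub> w)"
  unfolding a_minus_def using assms by (simp add: M.minus_add M.a_ac)

lemma (in module) tors_submodule: 
  assumes "I \<subseteq> carrier R"
  shows "submodule (tors M I) R M"
  unfolding tors_def using assms
  by (intro submoduleI) (auto simp: smult_r_distr smult_r_minus subset_iff smult_left_comm)

lemma (in module) scalar_image_submodule:
  assumes "submodule H R M" "r \<in> carrier R"
  shows "submodule ((\<odot>\<^bsub>M\<^esub>) r ` H) R M"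
proof (rule submoduleI)
  note H = submoduleE[OF assms(1)] submodule_zero_closed[OF assms(1)]
  show "(\<odot>\<^bsub>M\<^esub>) r ` H \<subseteq> carrier M" using H assms(2) by auto
  show "\<zero>\<^bsub>M\<^esub> \<in> (\<odot>\<^bsub>M\<^esub>) r ` H" using H assms(2) by (metis image_eqI smult_r_null)
  show "\<ominus>\<^bsub>M\<^esub> a \<in> (\<odot>\<^bsub>M\<^esub>) r ` H" if "a \<in> (\<odot>\<^bsub>M\<^esub>) r ` H" for a
    using that H assms(2) smult_r_minus by (smt (verit) image_iff subsetD)
  show "a \<oplus>\<^bsub>M\<^esub> b \<in> (\<odot>\<^bsub>M\<^esub>) r ` H" if "a \<in> (\<odot>\<^bsub>M\<^esub>) r ` H" "b \<in> (\<odot>\<^bsub>M\<^esub>) r ` H" for a b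
    using that H assms(2) smult_r_distr by (smt (verit) image_iff subsetD)
  show "a \<odot>\<^bsub>M\<^esub> x \<in> (\<odot>\<^bsub>M\<^esub>) r ` H" if "a \<in> carrier R" "x \<in> (\<odot>\<^bsub>M\<^esub>) r ` H" for a x
    using that H assms(2) smult_left_comm by (smt (verit) image_iff subsetD)
qed

lemma (in module) lr_gen_subset:
  "(\<Union>r\<in>carrier R. scalar_image M r \<inter> tors M {r}) \<subseteq> carrier M"
  unfolding tors_def by auto

lemma (in module) lr_submodule: "submodule (lr R M) R M"
  unfolding lr_def by (intro submodule_gen_submodule lr_gen_subset)

text \<open>The elements of \<open>rM \<inter> M[r]\<close> are the multiples \<open>r z\<close>
  with \<open>r (r z) = 0\<close>. Explicit \<open>r\<close> and \<open>z\<close> are what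
  bilinearity and divisibility arguments need.\<close>

lemma (in module) lr_memI:
  assumes "r \<in> carrier R" "z \<in> carrier M" "r \<odot>\<^bsub>M\<^esub> (r \<odot>\<^bsub>M\<^esub> z) = \<zero>\<^bsub>M\<^esub>"
  shows "r \<odot>\<^bsub>M\<^esub> z \<in> lr R M"
  unfolding lr_def
  by (rule subsetD[OF submodule_gen_incl]) (use assms in \<open>auto simp: scalar_image_def tors_def\<close>)

lemma (in module) lr_minimal:
  assumes "submodule H R M"
    and "\<And>r z. r \<in> carrier R \<Longrightarrow> z \<in> carrier M \<Longrightarrow> r \<odot>\<^bsub>M\<^esub> (r \<odot>\<^bsub>M\<^esub> z) = \<zero>\<^bsub>M\<^esub> \<Longrightarrow> r \<odot>\<^bsub>M\<^esub> z \<in> H"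
  shows "lr R M \<subseteq> H"
  unfolding lr_def
  by (rule submodule_gen_minimal[OF assms(1)]) (use assms(2) in \<open>auto simp: scalar_image_def tors_def\<close>)

text \<open>Subtracting \<open>r z\<close> from \<open>x\<close> leaves an element of
  \<open>M[r]\<close> exactly when \<open>r x = r (r z)\<close>, so the decomposition becomes
  divisibility of \<open>r x\<close> by the square of \<open>r\<close>.\<close>

lemma (in module) ur_iff:
  "x \<in> ur R M \<longleftrightarrow> x \<in> carrier M \<and> (\<forall>r\<in>carrier R. \<exists>z\<in>carrier M. r \<odot>\<^bsub>M\<^esub> x = r \<odot>\<^bsub>M\<^esub> (r \<odot>\<^bsub>M\<^esub> z))"
proof -
  have *: "x \<in> scalar_image M r <+>\<^bsub>M\<^esub> tors M {r} \<longleftrightarrow>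
      x \<in> carrier M \<and> (\<exists>z\<in>carrier M. r \<odot>\<^bsub>M\<^esub> x = r \<odot>\<^bsub>M\<^esub> (r \<odot>\<^bsub>M\<^esub> z))" if r: "r \<in> carrier R" for r
  proof
    assume "x \<in> scalar_image M r <+>\<^bsub>M\<^esub> tors M {r}"
    then obtain z w where "z \<in> carrier M" "w \<in> carrier M" "r \<odot>\<^bsub>M\<^esub> w = \<zero>\<^bsub>M\<^esub>" "x = r \<odot>\<^bsub>M\<^esub> z \<oplus>\<^bsub>M\<^esub> w"
      unfolding set_add_def' scalar_image_def tors_def by auto
    then show "x \<in> carrier M \<and> (\<exists>z\<in>carrier M. r \<odot>\<^bsub>M\<^esub> x = r \<odot>\<^bsub>M\<^esub> (r \<odot>\<^bsub>M\<^esub> z))"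
      using r by (auto simp: smult_r_distr)
  next
    assume "x \<in> carrier M \<and> (\<exists>z\<in>carrier M. r \<odot>\<^bsub>M\<^esub> x = r \<odot>\<^bsub>M\<^esub> (r \<odot>\<^bsub>M\<^esub> z))"
    then obtain z where z: "x \<in> carrier M" "z \<in> carrier M" "r \<odot>\<^bsub>M\<^esub> x = r \<odot>\<^bsub>M\<^esub> (r \<odot>\<^bsub>M\<^esub> z)" by auto
    have "x = r \<odot>\<^bsub>M\<^esub> z \<oplus>\<^bsub>M\<^esub> (x \<ominus>\<^bsub>M\<^esub> r \<odot>\<^bsub>M\<^esub> z)"
      using z r by (simp add: a_minus_def M.a_lcomm M.r_neg)
    moreover have "x \<ominus>\<^bsub>M\<^esub> r \<odot>\<^bsub>M\<^esub> z \<in> tors M {r}"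
      using z r by (auto simp: tors_def smult_minus)
    ultimately show "x \<in> scalar_image M r <+>\<^bsub>M\<^esub> tors M {r}"
      unfolding set_add_def' scalar_image_def using z by blast
  qed
  have "x \<in> ur R M \<Longrightarrow> x \<in> carrier M"
    using *[OF R.zero_closed] unfolding ur_def by auto
  then show ?thesis using * unfolding ur_def by auto
qed

section \<open>Local data at a prime ideal\<close>

text \<open>The idempotent \<open>e\<close> cuts out a local direct factor of \<open>R\<close> whose maximal ideal is generated
  by the nilpotent element \<open>e q\<close>.\<close>

locale local_factor = cring R for R (structure) +
  fixes e q n
  assumes e_closed [simp, intro]: "e \<in> carrier R" and q_closed [simp, intro]: "q \<in> carrier R"
    and e_idem: "e \<otimes> e = e" and e_pow_n: "e \<otimes> q [^] (n::nat) = \<zero>"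
    and factor: "\<And>r. r \<in> carrier R \<Longrightarrow> \<exists>(k::nat) u v. u \<in> carrier R \<and> v \<in> carrier R \<and>
      u \<otimes> v \<otimes> e = e \<and> e \<otimes> r = e \<otimes> (q [^] k \<otimes> u)"

lemma (in local_factor) e_pow_ge:
  assumes "k \<ge> n" shows "e \<otimes> q [^] (k::nat) = \<zero>"
proof -
  have "q [^] k = q [^] n \<otimes> q [^] (k - n)" using assms by (simp add: nat_pow_mult)
  then show ?thesis using e_pow_n by (metis e_closed m_assoc nat_pow_closed q_closed l_null)
qed

text \<open>\<open>half_div R M e q j\<close> describes the preimage of \<open>lr (q\<^sup>j e M)\<close> under \<open>x \<mapsto> q\<^sup>j e x\<close>, and
  \<open>half_div R M e q (j + 1)\<close> that of \<open>ur (q\<^sup>j e M)\<close>. The subtraction on the exponent is truncated: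
  the condition is void when \<open>i < j\<close>.\<close>

definition half_div :: "('a, 'r) ring_scheme \<Rightarrow> ('a, 'b, 'm) module_scheme \<Rightarrow> 'a \<Rightarrow> 'a \<Rightarrow> nat \<Rightarrow> 'b \<Rightarrow> bool" where
  "half_div R M e q j x \<longleftrightarrow> (\<forall>i::nat. \<exists>z\<in>carrier M.
     (e \<otimes>\<^bsub>R\<^esub> q [^]\<^bsub>R\<^esub> i) \<odot>\<^bsub>M\<^esub> x = (e \<otimes>\<^bsub>R\<^esub> q [^]\<^bsub>R\<^esub> (2 * i + 1 - j)) \<odot>\<^bsub>M\<^esub> z)"

locale local_module = local_factor R e q n + module R M for R (structure) and e q n and M (structure)
begin

abbreviation "P \<equiv> half_div R M e q"

lemma pow_split: "i \<le> k \<Longrightarrow> q [^] (k::nat) = q [^] i \<otimes> q [^] (k - i)"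
  by (simp add: nat_pow_mult)

lemma smult_pow_split: 
  assumes "i \<le> k" "x \<in> carrier M"
  shows "(e \<otimes> q [^] (k::nat)) \<odot>\<^bsub>M\<^esub> x = (e \<otimes> q [^] i) \<odot>\<^bsub>M\<^esub> (q [^] (k - i) \<odot>\<^bsub>M\<^esub> x)"
  using assms by (simp add: smult_assoc1[symmetric] m_assoc pow_split[OF assms(1)])

lemma half_div_submodule: "submodule {x \<in> carrier M. P j x} R M"
proof (rule submoduleI)
  show "\<zero>\<^bsub>M\<^esub> \<in> {x \<in> carrier M. P j x}"
    unfolding half_div_def by (auto intro!: bexI[of _ "\<zero>\<^bsub>M\<^esub>"])
  fix x assume x: "x \<in> {x \<in> carrier M. P j x}"
  show "\<ominus>\<^bsub>M\<^esub> x \<in> {x \<in> carrier M. P j x}"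
    using x unfolding half_div_def
    by (auto simp: smult_r_minus) (metis M.a_inv_closed smult_r_minus e_closed m_closed nat_pow_closed q_closed)
  show "a \<odot>\<^bsub>M\<^esub> x \<in> {x \<in> carrier M. P j x}" if "a \<in> carrier R" for a
  proof -
    have "\<exists>z\<in>carrier M. (e \<otimes> q [^] i) \<odot>\<^bsub>M\<^esub> (a \<odot>\<^bsub>M\<^esub> x) = (e \<otimes> q [^] (2 * i + 1 - j)) \<odot>\<^bsub>M\<^esub> z" for i
    proof -
      obtain z where z: "z \<in> carrier M" "(e \<otimes> q [^] i) \<odot>\<^bsub>M\<^esub> x = (e \<otimes> q [^] (2 * i + 1 - j)) \<odot>\<^bsub>M\<^esub> z"
        using x unfolding half_div_def by blast
      then show ?thesis using that x
        by (intro bexI[of _ "a \<odot>\<^bsub>M\<^esub> z"]) (auto simp: smult_left_comm[of _ a])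
    qed
    then show ?thesis using x that unfolding half_div_def by auto
  qed
  fix y assume y: "y \<in> {x \<in> carrier M. P j x}"
  have "\<exists>z\<in>carrier M. (e \<otimes> q [^] i) \<odot>\<^bsub>M\<^esub> (x \<oplus>\<^bsub>M\<^esub> y) = (e \<otimes> q [^] (2 * i + 1 - j)) \<odot>\<^bsub>M\<^esub> z" for i
  proof -
    obtain z where z: "z \<in> carrier M" "(e \<otimes> q [^] i) \<odot>\<^bsub>M\<^esub> x = (e \<otimes> q [^] (2 * i + 1 - j)) \<odot>\<^bsub>M\<^esub> z"
      using x unfolding half_div_def by blast
    obtain w where w: "w \<in> carrier M" "(e \<otimes> q [^] i) \<odot>\<^bsub>M\<^esub> y = (e \<otimes> q [^] (2 * i + 1 - j)) \<odot>\<^bsub>M\<^esub> w"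
      using y unfolding half_div_def by blast
    show ?thesis using x y z w by (intro bexI[of _ "z \<oplus>\<^bsub>M\<^esub> w"]) (auto simp: smult_r_distr)
  qed
  then show "x \<oplus>\<^bsub>M\<^esub> y \<in> {x \<in> carrier M. P j x}" using x y unfolding half_div_def by auto
qed auto

lemma half_div_e_cong:
  assumes "x \<in> carrier M" "y \<in> carrier M" "e \<odot>\<^bsub>M\<^esub> x = e \<odot>\<^bsub>M\<^esub> y"
  shows "P j x \<longleftrightarrow> P j y"
proof -
  have "(e \<otimes> q [^] (i::nat)) \<odot>\<^bsub>M\<^esub> x = (e \<otimes> q [^] i) \<odot>\<^bsub>M\<^esub> y" for i
    using assms by (metis e_closed m_comm nat_pow_closed q_closed smult_assoc1)
  then show ?thesis unfolding half_div_def by simp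
qed

lemma half_div_e: 
  assumes "x \<in> carrier M"
  shows "P j (e \<odot>\<^bsub>M\<^esub> x) \<longleftrightarrow> P j x"
  by (rule half_div_e_cong) (use assms in \<open>auto simp: smult_assoc1[symmetric] e_idem\<close>)

text \<open>The exponents match after replacing \<open>i\<close> by \<open>i + 1\<close>:
  \<open>2 (i + 1) + 1 - (j + 2) = 2 i + 1 - j\<close>. Only the index \<open>0\<close> of the
  condition for \<open>j + 2\<close> is left over, and there the truncated exponent is
  \<open>0\<close>, so that it is void.\<close>

lemma half_div_shift:
  assumes x: "x \<in> carrier M"
  shows "P j (q \<odot>\<^bsub>M\<^esub> x) \<longleftrightarrow> P (j + 2) x"
proof -
  have eq: "(e \<otimes> q [^] i) \<odot>\<^bsub>M\<^esub> (q \<odot>\<^bsub>M\<^esub> x) = (e \<otimes> q [^] Suc i) \<odot>\<^bsub>M\<^esub> x" for i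
    using x by (simp add: smult_assoc1[symmetric] m_assoc)
  have "P (j + 2) x \<longleftrightarrow> (\<forall>i. \<exists>z\<in>carrier M.
     (e \<otimes> q [^] Suc i) \<odot>\<^bsub>M\<^esub> x = (e \<otimes> q [^] (2 * i + 1 - j)) \<odot>\<^bsub>M\<^esub> z)"
  proof
    assume "P (j + 2) x"
    show "\<forall>i. \<exists>z\<in>carrier M.
       (e \<otimes> q [^] Suc i) \<odot>\<^bsub>M\<^esub> x = (e \<otimes> q [^] (2 * i + 1 - j)) \<odot>\<^bsub>M\<^esub> z"
    proof
      fix i :: nat
      show "\<exists>z\<in>carrier M. (e \<otimes> q [^] Suc i) \<odot>\<^bsub>M\<^esub> x = (e \<otimes> q [^] (2 * i + 1 - j)) \<odot>\<^bsub>M\<^esub> z"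
        using \<open>P (j + 2) x\<close>[unfolded half_div_def, rule_format, of "Suc i"] by simp
    qed
  next
    assume *: "\<forall>i. \<exists>z\<in>carrier M.
       (e \<otimes> q [^] Suc i) \<odot>\<^bsub>M\<^esub> x = (e \<otimes> q [^] (2 * i + 1 - j)) \<odot>\<^bsub>M\<^esub> z"
    show "P (j + 2) x" unfolding half_div_def
    proof
      fix i :: nat
      show "\<exists>z\<in>carrier M. (e \<otimes> q [^] i) \<odot>\<^bsub>M\<^esub> x = (e \<otimes> q [^] (2 * i + 1 - (j + 2))) \<odot>\<^bsub>M\<^esub> z"
      proof (cases i)
        case 0 then show ?thesis using x by auto
      next
        case (Suc k) then show ?thesis using *[rule_format, of k] by simp
      qed
    qed
  qed
  then show ?thesis unfolding half_div_def eq by simp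
qed

lemma half_div_mono_div:
  assumes "\<And>i. 2 * i + 1 - j' \<le> 2 * i + 1 - j" "P j x" 
  shows "P j' x"
  unfolding half_div_def
proof
  fix i :: nat
  obtain z where z: "z \<in> carrier M" "(e \<otimes> q [^] i) \<odot>\<^bsub>M\<^esub> x = (e \<otimes> q [^] (2 * i + 1 - j)) \<odot>\<^bsub>M\<^esub> z"
    using assms(2) unfolding half_div_def by blast
  then show "\<exists>z\<in>carrier M. (e \<otimes> q [^] i) \<odot>\<^bsub>M\<^esub> x = (e \<otimes> q [^] (2 * i + 1 - j')) \<odot>\<^bsub>M\<^esub> z"
    using smult_pow_split[OF assms(1)[of i] z(1)] by auto
qed

lemma half_div_mono: "P j x \<Longrightarrow> j \<le> j' \<Longrightarrow> P j' x"
  by (rule half_div_mono_div) auto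

text \<open>For \<open>i \<ge> n\<close> the left side vanishes. For \<open>i < n \<le> j\<close>
  the exponent \<open>2 * i + 1 - j\<close> is at most \<open>i\<close>, so a multiple of
  \<open>x\<close> itself is a witness.\<close>

lemma half_div_large:
  assumes "x \<in> carrier M" "j \<ge> n"
  shows "P j x"
  unfolding half_div_def
proof
  fix i :: nat
  show "\<exists>z\<in>carrier M. (e \<otimes> q [^] i) \<odot>\<^bsub>M\<^esub> x = (e \<otimes> q [^] (2 * i + 1 - j)) \<odot>\<^bsub>M\<^esub> z"
  proof (cases "i \<ge> n")
    case True then show ?thesis using assms by (intro bexI[of _ "\<zero>\<^bsub>M\<^esub>"]) (auto simp: e_pow_ge)
  next
    case False
    then show ?thesis using assms smult_pow_split[of "2 * i + 1 - j" i x]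
      by (intro bexI[of _ "q [^] (i - (2 * i + 1 - j)) \<odot>\<^bsub>M\<^esub> x"]) auto
  qed
qed

section \<open>\<open>lr\<close> and \<open>ur\<close> at one prime as divisibility
  conditions\<close>

lemma lr_imp_half_div: "x \<in> lr R M \<Longrightarrow> P 0 x"
proof -
  have "lr R M \<subseteq> {x \<in> carrier M. P 0 x}"
  proof (rule lr_minimal[OF half_div_submodule])
    fix r z assume r: "r \<in> carrier R" and z: "z \<in> carrier M" and 0: "r \<odot>\<^bsub>M\<^esub> (r \<odot>\<^bsub>M\<^esub> z) = \<zero>\<^bsub>M\<^esub>"
    obtain k :: nat and u v where u: "u \<in> carrier R" "v \<in> carrier R" "u \<otimes> v \<otimes> e = e"
      and er: "e \<otimes> r = e \<otimes> (q [^] k \<otimes> u)" using factor[OF r] by blast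
    \<comment> \<open>On \<open>e R\<close> the scalar \<open>r\<close> is \<open>q^k\<close> times
      the unit \<open>u\<close>. Thus \<open>r z\<close> is \<open>q^k z\<close> up to a unit, and
      \<open>r (r z) = 0\<close> means \<open>e q^{2k} z = 0\<close>.\<close>
    have e1: "(e \<otimes> q [^] i) \<odot>\<^bsub>M\<^esub> (r \<odot>\<^bsub>M\<^esub> z) = (e \<otimes> q [^] (i + k)) \<odot>\<^bsub>M\<^esub> (u \<odot>\<^bsub>M\<^esub> z)" for i :: nat
    proof -
      have "e \<otimes> q [^] i \<otimes> r = q [^] i \<otimes> (e \<otimes> r)" using r by (simp add: m_ac)
      also have "\<dots> = e \<otimes> q [^] (i + k) \<otimes> u" using u by (simp add: er m_ac nat_pow_mult[symmetric])
      finally show ?thesis using r u z by (simp add: smult_assoc1[symmetric])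
    qed
    have e2: "(e \<otimes> q [^] (k + k)) \<odot>\<^bsub>M\<^esub> z = \<zero>\<^bsub>M\<^esub>"
    proof -
      have "(v \<otimes> v) \<otimes> e \<otimes> (r \<otimes> r) = v \<otimes> v \<otimes> ((e \<otimes> r) \<otimes> (e \<otimes> r))"
        using u r e_idem by (simp add: m_ac) (metis e_closed e_idem m_assoc m_closed r)
      also have "\<dots> = (u \<otimes> v \<otimes> e) \<otimes> (u \<otimes> v \<otimes> e) \<otimes> (q [^] k \<otimes> q [^] k)"
        using u(1,2) by (simp add: er m_ac)
      also have "\<dots> = e \<otimes> q [^] (k + k)" using u(3) e_idem by (simp add: nat_pow_mult)
      finally have "(e \<otimes> q [^] (k + k)) \<odot>\<^bsub>M\<^esub> z = (v \<otimes> v \<otimes> e) \<odot>\<^bsub>M\<^esub> (r \<odot>\<^bsub>M\<^esub> (r \<odot>\<^bsub>M\<^esub> z))"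
        using u r z by (simp add: smult_assoc1[symmetric])
      then show ?thesis using 0 u by simp
    qed
    have "P 0 (r \<odot>\<^bsub>M\<^esub> z)" unfolding half_div_def
    proof
      fix i :: nat
      show "\<exists>y\<in>carrier M. (e \<otimes> q [^] i) \<odot>\<^bsub>M\<^esub> (r \<odot>\<^bsub>M\<^esub> z) = (e \<otimes> q [^] (2 * i + 1 - 0)) \<odot>\<^bsub>M\<^esub> y"
      \<comment> \<open>For \<open>i < k\<close> the exponent \<open>i + k\<close> is at least
        \<open>2 * i + 1\<close>; otherwise it is at least \<open>2 k\<close> and the element is
        zero.\<close>
      proof (cases "i < k")
        case True
        then have "2 * i + 1 \<le> i + k" by simp
        then show ?thesis using e1 smult_pow_split[of "2 * i + 1" "i + k" "u \<odot>\<^bsub>M\<^esub> z"] u z by auto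
      next
        case False
        then have kk: "k + k \<le> i + k" by simp
        have "(e \<otimes> q [^] (i + k)) \<odot>\<^bsub>M\<^esub> (u \<odot>\<^bsub>M\<^esub> z) = (q [^] (i + k - (k + k)) \<otimes> u) \<odot>\<^bsub>M\<^esub> ((e \<otimes> q [^] (k + k)) \<odot>\<^bsub>M\<^esub> z)"
          using u z unfolding pow_split[OF kk] by (simp add: smult_assoc1[symmetric] m_ac)
        then show ?thesis using e1 e2 u by (intro bexI[of _ "\<zero>\<^bsub>M\<^esub>"]) auto
      qed
    qed
    then show "r \<odot>\<^bsub>M\<^esub> z \<in> {x \<in> carrier M. P 0 x}" using r z by auto
  qed
  then show "x \<in> lr R M \<Longrightarrow> P 0 x" by auto
qed

text \<open>The condition of index \<open>k\<close> reads \<open>e q^{2k} y = e q^{2k+1} z\<close>,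
  so with \<open>r = e q^k\<close> the element \<open>r (y - q z)\<close> is killed by
  \<open>r\<close> and is a generator of \<open>lr\<close>. What remains carries one more factor
  \<open>q\<close>.\<close>

lemma half_div_0_step:
  assumes y: "y \<in> carrier M" and H: "P 0 ((e \<otimes> q [^] (k::nat)) \<odot>\<^bsub>M\<^esub> y)" and k: "k \<ge> 1"
  shows "\<exists>z\<in>carrier M. (e \<otimes> q [^] k) \<odot>\<^bsub>M\<^esub> y \<ominus>\<^bsub>M\<^esub> (e \<otimes> q [^] Suc k) \<odot>\<^bsub>M\<^esub> z \<in> lr R M"
proof -
  let ?r = "e \<otimes> q [^] k"
  obtain z where z: "z \<in> carrier M" "?r \<odot>\<^bsub>M\<^esub> (?r \<odot>\<^bsub>M\<^esub> y) = (e \<otimes> q [^] (2 * k + 1)) \<odot>\<^bsub>M\<^esub> z"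
    using H unfolding half_div_def by (metis diff_zero)
  have "e \<otimes> q [^] (2 * k + 1) = ?r \<otimes> (e \<otimes> q [^] Suc k)"
  proof -
    have "?r \<otimes> (e \<otimes> q [^] Suc k) = (e \<otimes> e) \<otimes> (q [^] k \<otimes> q [^] Suc k)"
      by (simp only: m_ac e_closed q_closed nat_pow_closed m_closed)
    then show ?thesis by (simp only: e_idem nat_pow_mult q_closed) (simp add: mult_2)
  qed
  moreover have eS: "e \<otimes> q [^] Suc k = ?r \<otimes> q" by (simp add: m_ac)
  ultimately have "?r \<odot>\<^bsub>M\<^esub> (?r \<odot>\<^bsub>M\<^esub> (y \<ominus>\<^bsub>M\<^esub> q \<odot>\<^bsub>M\<^esub> z)) = \<zero>\<^bsub>M\<^esub>"
    using z y by (simp add: smult_minus smult_assoc1)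
  then have "?r \<odot>\<^bsub>M\<^esub> (y \<ominus>\<^bsub>M\<^esub> q \<odot>\<^bsub>M\<^esub> z) \<in> lr R M" using z y by (intro lr_memI) auto
  moreover have "?r \<odot>\<^bsub>M\<^esub> (y \<ominus>\<^bsub>M\<^esub> q \<odot>\<^bsub>M\<^esub> z) = ?r \<odot>\<^bsub>M\<^esub> y \<ominus>\<^bsub>M\<^esub> (e \<otimes> q [^] Suc k) \<odot>\<^bsub>M\<^esub> z"
    unfolding eS using z y by (simp add: smult_minus smult_assoc1)
  ultimately show ?thesis using z by auto
qed

text \<open>Generators of \<open>lr\<close> are split off one power of \<open>q\<close> at a time.
  The remainder keeps satisfying \<open>P 0\<close>, because the generators do, and it is zero once
  the power reaches \<open>n\<close>.\<close>

lemma half_div_imp_lr: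
  assumes x: "x \<in> carrier M" and P: "P 0 x"
  shows "e \<odot>\<^bsub>M\<^esub> x \<in> lr R M"
proof -
  have *: "(e \<otimes> q [^] k) \<odot>\<^bsub>M\<^esub> y \<in> lr R M"
    if "y \<in> carrier M" "P 0 ((e \<otimes> q [^] k) \<odot>\<^bsub>M\<^esub> y)" "k \<ge> 1" for y and k :: nat
    using that
  proof (induction "n - k" arbitrary: k y)
    case 0
    then show ?case using submodule_zero_closed[OF lr_submodule] by (simp add: e_pow_ge)
  next
    case (Suc d)
    obtain z where z: "z \<in> carrier M" 
      and l: "(e \<otimes> q [^] k) \<odot>\<^bsub>M\<^esub> y \<ominus>\<^bsub>M\<^esub> (e \<otimes> q [^] Suc k) \<odot>\<^bsub>M\<^esub> z \<in> lr R M"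
      using half_div_0_step[OF Suc.prems] by auto
    have "P 0 ((e \<otimes> q [^] Suc k) \<odot>\<^bsub>M\<^esub> z)"
    proof -
      have "(e \<otimes> q [^] k) \<odot>\<^bsub>M\<^esub> y \<ominus>\<^bsub>M\<^esub> (e \<otimes> q [^] Suc k) \<odot>\<^bsub>M\<^esub> z \<in> {x \<in> carrier M. P 0 x}"
        using lr_imp_half_div[OF l] submoduleE(1)[OF lr_submodule] l by blast
      moreover have "(e \<otimes> q [^] k) \<odot>\<^bsub>M\<^esub> y \<in> {x \<in> carrier M. P 0 x}" using Suc.prems(1,2) by simp
      moreover have "(e \<otimes> q [^] Suc k) \<odot>\<^bsub>M\<^esub> z \<in> carrier M"
        using z by (intro smult_closed m_closed nat_pow_closed e_closed q_closed)
      ultimately have "(e \<otimes> q [^] Suc k) \<odot>\<^bsub>M\<^esub> z \<in> {x \<in> carrier M. P 0 x}"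
        by (rule submodule_add_cancel'[OF half_div_submodule])
      then show ?thesis by auto
    qed
    then have "(e \<otimes> q [^] Suc k) \<odot>\<^bsub>M\<^esub> z \<in> lr R M" using Suc.hyps(1)[of "Suc k" z, OF _ z] Suc.hyps(2) \<open>P 0 ((e \<otimes> q [^] Suc k) \<odot>\<^bsub>M\<^esub> z)\<close> by linarith
    then show ?case using submodule_add_cancel[OF lr_submodule l] Suc.prems(1) by blast
  qed
  \<comment> \<open>The condition of index \<open>0\<close> supplies the first factor
    \<open>q\<close>, so the splitting can start at \<open>k = 1\<close>.\<close>
  obtain z where z: "z \<in> carrier M" "(e \<otimes> q [^] (0::nat)) \<odot>\<^bsub>M\<^esub> x = (e \<otimes> q [^] (1::nat)) \<odot>\<^bsub>M\<^esub> z"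
    using P[unfolded half_div_def, rule_format, of 0] by auto
  then have ex: "e \<odot>\<^bsub>M\<^esub> x = (e \<otimes> q [^] (1::nat)) \<odot>\<^bsub>M\<^esub> z" by simp
  show ?thesis using *[of z 1] z(1) P half_div_e[OF x] unfolding ex by simp
qed

lemma ur_imp_half_div:
  assumes "x \<in> ur R M" shows "P 1 x"
  unfolding half_div_def
proof
  fix i :: nat
  have x: "x \<in> carrier M" using assms ur_iff by auto
  obtain z where z: "z \<in> carrier M" "q [^] i \<odot>\<^bsub>M\<^esub> x = q [^] i \<odot>\<^bsub>M\<^esub> (q [^] i \<odot>\<^bsub>M\<^esub> z)"
    using assms unfolding ur_iff by blast
  have "(e \<otimes> q [^] i) \<odot>\<^bsub>M\<^esub> x = (e \<otimes> q [^] (2 * i)) \<odot>\<^bsub>M\<^esub> z"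
    using z x by (simp add: smult_assoc1 mult_2 nat_pow_mult[symmetric])
  then show "\<exists>z\<in>carrier M. (e \<otimes> q [^] i) \<odot>\<^bsub>M\<^esub> x = (e \<otimes> q [^] (2 * i + 1 - 1)) \<odot>\<^bsub>M\<^esub> z"
    using z by auto
qed

text \<open>With \<open>r = q^k u\<close> on \<open>e R\<close>, the condition of index
  \<open>k\<close> yields \<open>e r x = e u q^{2k} z\<close>, and \<open>u q^{2k}\<close> equals
  \<open>r r v\<close> there. The factor \<open>e\<close> stays on both sides so that the equation
  also serves to establish membership in the global \<open>ur\<close> prime by prime.\<close>

lemma half_div_imp_ur_eq:
  assumes x: "x \<in> carrier M" and P: "P 1 x" and r: "r \<in> carrier R"
  shows "\<exists>z\<in>carrier M. (e \<otimes> r) \<odot>\<^bsub>M\<^esub> x = (e \<otimes> (r \<otimes> r)) \<odot>\<^bsub>M\<^esub> z"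
proof -
  obtain k :: nat and u v where u: "u \<in> carrier R" "v \<in> carrier R" "u \<otimes> v \<otimes> e = e"
    and er: "e \<otimes> r = e \<otimes> (q [^] k \<otimes> u)" using factor[OF r] by blast
  obtain z where z: "z \<in> carrier M" "(e \<otimes> q [^] k) \<odot>\<^bsub>M\<^esub> x = (e \<otimes> q [^] (2 * k + 1 - 1)) \<odot>\<^bsub>M\<^esub> z"
    using P unfolding half_div_def by blast
  have "(e \<otimes> r) \<odot>\<^bsub>M\<^esub> x = u \<odot>\<^bsub>M\<^esub> ((e \<otimes> q [^] k) \<odot>\<^bsub>M\<^esub> x)"
    using x u by (simp add: smult_assoc1[symmetric] er m_ac)
  also have "\<dots> = (u \<otimes> (e \<otimes> q [^] (2 * k))) \<odot>\<^bsub>M\<^esub> z" using z u by (simp add: smult_assoc1)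
  also have "u \<otimes> (e \<otimes> q [^] (2 * k)) = e \<otimes> (r \<otimes> r) \<otimes> v"
  proof -
    have "e \<otimes> (r \<otimes> r) \<otimes> v = (e \<otimes> e) \<otimes> (r \<otimes> r) \<otimes> v" by (simp add: e_idem)
    also have "\<dots> = (e \<otimes> r) \<otimes> (e \<otimes> r) \<otimes> v" using u r by (simp only: m_ac m_closed e_closed)
    also have "\<dots> = (u \<otimes> v \<otimes> e) \<otimes> (e \<otimes> (q [^] k \<otimes> q [^] k)) \<otimes> u"
      unfolding er using u(1,2) by (simp only: m_ac m_closed e_closed q_closed nat_pow_closed)
    also have "\<dots> = (e \<otimes> e) \<otimes> (q [^] (2 * k)) \<otimes> u"
      unfolding u(3) using u(1) by (simp only: m_assoc m_closed e_closed q_closed nat_pow_closed nat_pow_mult mult_2)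
    finally show ?thesis using u by (simp add: e_idem m_ac)
  qed
  finally have "(e \<otimes> r) \<odot>\<^bsub>M\<^esub> x = (e \<otimes> (r \<otimes> r)) \<odot>\<^bsub>M\<^esub> (v \<odot>\<^bsub>M\<^esub> z)" 
    using u r z by (simp add: smult_assoc1)
  then show ?thesis using u z by blast
qed

lemma half_div_imp_ur:
  assumes x: "x \<in> carrier M" and P: "P 1 x"
  shows "e \<odot>\<^bsub>M\<^esub> x \<in> ur R M"
  unfolding ur_iff
proof (intro conjI ballI)
  fix r assume r: "r \<in> carrier R"
  obtain z where z: "z \<in> carrier M" "(e \<otimes> r) \<odot>\<^bsub>M\<^esub> x = (e \<otimes> (r \<otimes> r)) \<odot>\<^bsub>M\<^esub> z"
    using half_div_imp_ur_eq[OF x P r] by blast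
  have "r \<odot>\<^bsub>M\<^esub> (e \<odot>\<^bsub>M\<^esub> x) = (e \<otimes> r) \<odot>\<^bsub>M\<^esub> x" 
    using r x by (simp add: smult_assoc1[symmetric] m_comm)
  also have "\<dots> = r \<odot>\<^bsub>M\<^esub> (r \<odot>\<^bsub>M\<^esub> (e \<odot>\<^bsub>M\<^esub> z))" 
    using z r by (simp add: smult_assoc1[symmetric] m_ac)
  finally show "\<exists>z\<in>carrier M. r \<odot>\<^bsub>M\<^esub> (e \<odot>\<^bsub>M\<^esub> x) = r \<odot>\<^bsub>M\<^esub> (r \<odot>\<^bsub>M\<^esub> z)" using z by blast
qed (use x in auto)

end


section \<open>Presentations of modules over different rings\<close>

text \<open>\<open>R2\<close> is a bare record: its ring laws are transported along
  \<open>\<phi>\<close>, as later the module laws along \<open>h\<close>. For cosets and fractions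
  only the operations on representatives then need checking. \<open>phi_zero\<close> does not follow
  from \<open>ring_hom\<close> as long as \<open>R2\<close> is not known to be a ring.\<close>

locale ring_surj = R?: cring R for R (structure) and R2 and \<phi> +
  assumes hom: "\<phi> \<in> ring_hom R R2" and surj: "\<phi> ` carrier R = carrier R2"
    and phi_zero [simp]: "\<phi> \<zero> = \<zero>\<^bsub>R2\<^esub>"
begin

lemma phi_closed [simp]: "a \<in> carrier R \<Longrightarrow> \<phi> a \<in> carrier R2"
  using surj by blast

lemma phi_simps [simp]:
  "a \<in> carrier R \<Longrightarrow> b \<in> carrier R \<Longrightarrow> \<phi> (a \<otimes> b) = \<phi> a \<otimes>\<^bsub>R2\<^esub> \<phi> b"
  "a \<in> carrier R \<Longrightarrow> b \<in> carrier R \<Longrightarrow> \<phi> (a \<oplus> b) = \<phi> a \<oplus>\<^bsub>R2\<^esub> \<phi> b"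
  "\<phi> \<one> = \<one>\<^bsub>R2\<^esub>"
  using hom unfolding ring_hom_def by auto

lemma phi_obtain: "b \<in> carrier R2 \<Longrightarrow> (\<And>a. a \<in> carrier R \<Longrightarrow> b = \<phi> a \<Longrightarrow> thesis) \<Longrightarrow> thesis"
  using surj by blast

lemma cring_codomain: "cring R2"
proof (rule cringI)
  show "abelian_group R2"
  proof (rule abelian_groupI)
    show "\<zero>\<^bsub>R2\<^esub> \<in> carrier R2" by (metis R.zero_closed phi_closed phi_zero)
    fix x assume "x \<in> carrier R2"
    then obtain a where a: "a \<in> carrier R" "x = \<phi> a" by (rule phi_obtain)
    show "\<zero>\<^bsub>R2\<^esub> \<oplus>\<^bsub>R2\<^esub> x = x" using a by (metis R.l_zero R.zero_closed phi_simps(2) phi_zero)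
    have "\<phi> (\<ominus> a) \<oplus>\<^bsub>R2\<^esub> x = \<zero>\<^bsub>R2\<^esub>" using a by (metis R.l_neg R.a_inv_closed phi_simps(2) phi_zero)
    then show "\<exists>y\<in>carrier R2. y \<oplus>\<^bsub>R2\<^esub> x = \<zero>\<^bsub>R2\<^esub>" using a by (auto intro!: bexI[of _ "\<phi> (\<ominus> a)"])
    fix y assume "y \<in> carrier R2"
    then obtain b where b: "b \<in> carrier R" "y = \<phi> b" by (rule phi_obtain)
    show "x \<oplus>\<^bsub>R2\<^esub> y \<in> carrier R2" using a b by (metis R.add.m_closed phi_closed phi_simps(2))
    show "x \<oplus>\<^bsub>R2\<^esub> y = y \<oplus>\<^bsub>R2\<^esub> x" using a b by (metis R.a_comm phi_simps(2))
    fix z assume "z \<in> carrier R2"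
    then obtain c where c: "c \<in> carrier R" "z = \<phi> c" by (rule phi_obtain)
    have "\<phi> (a \<oplus> b \<oplus> c) = \<phi> (a \<oplus> (b \<oplus> c))" using a b c by (simp only: R.a_assoc)
    then show "x \<oplus>\<^bsub>R2\<^esub> y \<oplus>\<^bsub>R2\<^esub> z = x \<oplus>\<^bsub>R2\<^esub> (y \<oplus>\<^bsub>R2\<^esub> z)" using a b c by simp
  qed
  show "comm_monoid R2"
  proof (rule comm_monoidI)
    show "\<one>\<^bsub>R2\<^esub> \<in> carrier R2" by (metis R.one_closed phi_closed phi_simps(3))
    fix x assume "x \<in> carrier R2"
    then obtain a where a: "a \<in> carrier R" "x = \<phi> a" by (rule phi_obtain)
    show "\<one>\<^bsub>R2\<^esub> \<otimes>\<^bsub>R2\<^esub> x = x" using a by (metis R.l_one R.one_closed phi_simps(1,3))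
    fix y assume "y \<in> carrier R2"
    then obtain b where b: "b \<in> carrier R" "y = \<phi> b" by (rule phi_obtain)
    show "x \<otimes>\<^bsub>R2\<^esub> y \<in> carrier R2" using a b by (metis R.m_closed phi_closed phi_simps(1))
    show "x \<otimes>\<^bsub>R2\<^esub> y = y \<otimes>\<^bsub>R2\<^esub> x" using a b by (metis R.m_comm phi_simps(1))
    fix z assume "z \<in> carrier R2"
    then obtain c where c: "c \<in> carrier R" "z = \<phi> c" by (rule phi_obtain)
    have "\<phi> (a \<otimes> b \<otimes> c) = \<phi> (a \<otimes> (b \<otimes> c))" using a b c by (simp only: R.m_assoc)
    then show "x \<otimes>\<^bsub>R2\<^esub> y \<otimes>\<^bsub>R2\<^esub> z = x \<otimes>\<^bsub>R2\<^esub> (y \<otimes>\<^bsub>R2\<^esub> z)" using a b c by simp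
  qed
  fix x y z assume "x \<in> carrier R2" "y \<in> carrier R2" "z \<in> carrier R2"
  then obtain a b c where a: "a \<in> carrier R" "x = \<phi> a" "b \<in> carrier R" "y = \<phi> b" "c \<in> carrier R" "z = \<phi> c"
    by (metis phi_obtain)
  have "\<phi> ((a \<oplus> b) \<otimes> c) = \<phi> (a \<otimes> c \<oplus> b \<otimes> c)" using a by (simp only: R.l_distr)
  then show "(x \<oplus>\<^bsub>R2\<^esub> y) \<otimes>\<^bsub>R2\<^esub> z = x \<otimes>\<^bsub>R2\<^esub> z \<oplus>\<^bsub>R2\<^esub> y \<otimes>\<^bsub>R2\<^esub> z" using a by simp
qed

lemma phi_pow [simp]: "a \<in> carrier R \<Longrightarrow> \<phi> (a [^] (k::nat)) = \<phi> a [^]\<^bsub>R2\<^esub> k"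
  by (induction k) auto

lemma phi_PIdl: "a \<in> carrier R \<Longrightarrow> \<phi> ` (PIdl a) = PIdl\<^bsub>R2\<^esub> (\<phi> a)"
proof -
  assume a: "a \<in> carrier R"
  have "\<phi> ` (PIdl a) = (\<lambda>x. \<phi> x \<otimes>\<^bsub>R2\<^esub> \<phi> a) ` carrier R"
    unfolding cgenideal_def using a by (auto simp: image_def)
  also have "\<dots> = (\<lambda>y. y \<otimes>\<^bsub>R2\<^esub> \<phi> a) ` carrier R2" unfolding surj[symmetric] image_image ..
  finally show ?thesis unfolding cgenideal_def by (auto simp: image_def)
qed

end

locale semilinear_surj = ring_surj R R2 \<phi> + module R M for R (structure) and M (structure) and R2 and M2 and \<phi> h +
  assumes h_surj: "h ` carrier M = carrier M2"
    and h_add [simp]: "x \<in> carrier M \<Longrightarrow> y \<in> carrier M \<Longrightarrow> h (x \<oplus>\<^bsub>M\<^esub> y) = h x \<oplus>\<^bsub>M2\<^esub> h y"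
    and h_smult [simp]: "a \<in> carrier R \<Longrightarrow> x \<in> carrier M \<Longrightarrow> h (a \<odot>\<^bsub>M\<^esub> x) = \<phi> a \<odot>\<^bsub>M2\<^esub> h x"
    and h_zero [simp]: "h \<zero>\<^bsub>M\<^esub> = \<zero>\<^bsub>M2\<^esub>"
begin

lemma h_closed [simp]: "x \<in> carrier M \<Longrightarrow> h x \<in> carrier M2"
  using h_surj by blast

lemma h_obtain: "y \<in> carrier M2 \<Longrightarrow> (\<And>x. x \<in> carrier M \<Longrightarrow> y = h x \<Longrightarrow> thesis) \<Longrightarrow> thesis"
  using h_surj by blast

lemma module_codomain: "module R2 M2"
proof (rule moduleI)
  show "cring R2" by (rule cring_codomain)
  show "abelian_group M2"
  proof (rule abelian_groupI)
    show "\<zero>\<^bsub>M2\<^esub> \<in> carrier M2" by (metis M.zero_closed h_closed h_zero)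
    fix x assume "x \<in> carrier M2"
    then obtain a where a: "a \<in> carrier M" "x = h a" by (rule h_obtain)
    show "\<zero>\<^bsub>M2\<^esub> \<oplus>\<^bsub>M2\<^esub> x = x" using a by (metis M.l_zero M.zero_closed h_add h_zero)
    have "h (\<ominus>\<^bsub>M\<^esub> a) \<oplus>\<^bsub>M2\<^esub> x = \<zero>\<^bsub>M2\<^esub>" using a by (metis M.l_neg M.a_inv_closed h_add h_zero)
    then show "\<exists>y\<in>carrier M2. y \<oplus>\<^bsub>M2\<^esub> x = \<zero>\<^bsub>M2\<^esub>" using a by (auto intro!: bexI[of _ "h (\<ominus>\<^bsub>M\<^esub> a)"])
    fix y assume "y \<in> carrier M2"
    then obtain b where b: "b \<in> carrier M" "y = h b" by (rule h_obtain)
    show "x \<oplus>\<^bsub>M2\<^esub> y \<in> carrier M2" using a b by (metis M.add.m_closed h_closed h_add)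
    show "x \<oplus>\<^bsub>M2\<^esub> y = y \<oplus>\<^bsub>M2\<^esub> x" using a b by (metis M.a_comm h_add)
    fix z assume "z \<in> carrier M2"
    then obtain c where c: "c \<in> carrier M" "z = h c" by (rule h_obtain)
    have "h (a \<oplus>\<^bsub>M\<^esub> b \<oplus>\<^bsub>M\<^esub> c) = h (a \<oplus>\<^bsub>M\<^esub> (b \<oplus>\<^bsub>M\<^esub> c))" using a b c by (simp only: M.a_assoc)
    then show "x \<oplus>\<^bsub>M2\<^esub> y \<oplus>\<^bsub>M2\<^esub> z = x \<oplus>\<^bsub>M2\<^esub> (y \<oplus>\<^bsub>M2\<^esub> z)" using a b c by simp
  qed
  fix x assume "x \<in> carrier M2"
  then obtain x' where x: "x' \<in> carrier M" "x = h x'" by (rule h_obtain)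
  show "\<one>\<^bsub>R2\<^esub> \<odot>\<^bsub>M2\<^esub> x = x" using x by (metis R.one_closed h_smult phi_simps(3) smult_one)
  fix a assume "a \<in> carrier R2"
  then obtain a' where a: "a' \<in> carrier R" "a = \<phi> a'" by (rule phi_obtain)
  show "a \<odot>\<^bsub>M2\<^esub> x \<in> carrier M2" using x a by (metis h_closed h_smult smult_closed)
  {
    fix y assume "y \<in> carrier M2"
    then obtain y' where y: "y' \<in> carrier M" "y = h y'" by (rule h_obtain)
    have "h (a' \<odot>\<^bsub>M\<^esub> (x' \<oplus>\<^bsub>M\<^esub> y')) = h (a' \<odot>\<^bsub>M\<^esub> x' \<oplus>\<^bsub>M\<^esub> a' \<odot>\<^bsub>M\<^esub> y')" using x y a by (simp only: smult_r_distr)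
    then show "a \<odot>\<^bsub>M2\<^esub> (x \<oplus>\<^bsub>M2\<^esub> y) = a \<odot>\<^bsub>M2\<^esub> x \<oplus>\<^bsub>M2\<^esub> a \<odot>\<^bsub>M2\<^esub> y" using x y a by simp
  }
  fix b assume "b \<in> carrier R2"
  then obtain b' where b: "b' \<in> carrier R" "b = \<phi> b'" by (rule phi_obtain)
  have "h ((a' \<oplus> b') \<odot>\<^bsub>M\<^esub> x') = h (a' \<odot>\<^bsub>M\<^esub> x' \<oplus>\<^bsub>M\<^esub> b' \<odot>\<^bsub>M\<^esub> x')" using x a b by (simp only: smult_l_distr)
  then show "(a \<oplus>\<^bsub>R2\<^esub> b) \<odot>\<^bsub>M2\<^esub> x = a \<odot>\<^bsub>M2\<^esub> x \<oplus>\<^bsub>M2\<^esub> b \<odot>\<^bsub>M2\<^esub> x" using x a b by simp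
  have "h ((a' \<otimes> b') \<odot>\<^bsub>M\<^esub> x') = h (a' \<odot>\<^bsub>M\<^esub> (b' \<odot>\<^bsub>M\<^esub> x'))" using x a b by (simp only: smult_assoc1)
  then show "(a \<otimes>\<^bsub>R2\<^esub> b) \<odot>\<^bsub>M2\<^esub> x = a \<odot>\<^bsub>M2\<^esub> (b \<odot>\<^bsub>M2\<^esub> x)" using x a b by simp
qed

lemma h_minus: 
  assumes "x \<in> carrier M" "y \<in> carrier M"
  shows "h (x \<ominus>\<^bsub>M\<^esub> y) = h x \<ominus>\<^bsub>M2\<^esub> h y"
proof -
  interpret M2: module R2 M2 by (rule module_codomain)
  have "h (x \<ominus>\<^bsub>M\<^esub> y) \<oplus>\<^bsub>M2\<^esub> h y = h x"
    using assms by (simp add: h_add[symmetric] a_minus_def M.a_assoc M.l_neg del: h_add)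
  then have "h x \<ominus>\<^bsub>M2\<^esub> h y = h (x \<ominus>\<^bsub>M\<^esub> y) \<oplus>\<^bsub>M2\<^esub> h y \<ominus>\<^bsub>M2\<^esub> h y" by simp
  then show ?thesis using assms by (simp add: a_minus_def M2.M.a_assoc M2.M.r_neg)
qed

lemma submodule_image:
  assumes "submodule H R M"
  shows "submodule (h ` H) R2 M2"
proof -
  interpret M2: module R2 M2 by (rule module_codomain)
  note H = submoduleE[OF assms] submodule_zero_closed[OF assms]
  have HM: "x \<in> carrier M" if "x \<in> H" for x using that H(1) by blast
  show ?thesis
  proof (rule M2.submoduleI)
    show "h ` H \<subseteq> carrier M2" using HM by auto
    show "\<zero>\<^bsub>M2\<^esub> \<in> h ` H" using H(7) h_zero by (metis image_eqI)
    fix y assume "y \<in> h ` H"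
    then obtain x where x: "x \<in> H" "y = h x" by blast
    show "a \<odot>\<^bsub>M2\<^esub> y \<in> h ` H" if a: "a \<in> carrier R2" for a
    proof -
      obtain b where b: "b \<in> carrier R" "a = \<phi> b" using phi_obtain[OF a] by blast
      have "a \<odot>\<^bsub>M2\<^esub> y = h (b \<odot>\<^bsub>M\<^esub> x)" using b x HM by simp
      then show ?thesis using H(4)[OF b(1) x(1)] by simp
    qed
    then have "(\<ominus>\<^bsub>R2\<^esub> \<one>\<^bsub>R2\<^esub>) \<odot>\<^bsub>M2\<^esub> y \<in> h ` H" by simp
    then show "\<ominus>\<^bsub>M2\<^esub> y \<in> h ` H" using x HM by (simp add: M2.smult_l_minus)
    fix y' assume "y' \<in> h ` H"
    then obtain x' where x': "x' \<in> H" "y' = h x'" by blast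
    have "y \<oplus>\<^bsub>M2\<^esub> y' = h (x \<oplus>\<^bsub>M\<^esub> x')" using x x' HM by simp
    then show "y \<oplus>\<^bsub>M2\<^esub> y' \<in> h ` H" using H(5)[OF x(1) x'(1)] by simp
  qed
qed

lemma submodule_vimage:
  assumes "submodule H R2 M2"
  shows "submodule {x \<in> carrier M. h x \<in> H} R M"
proof -
  interpret M2: module R2 M2 by (rule module_codomain)
  note H = M2.submoduleE[OF assms] M2.submodule_zero_closed[OF assms]
  show ?thesis
  proof (rule submoduleI)
    fix x assume x: "x \<in> {x \<in> carrier M. h x \<in> H}"
    show "a \<odot>\<^bsub>M\<^esub> x \<in> {x \<in> carrier M. h x \<in> H}" if "a \<in> carrier R" for a
      using that x H(4) by simp
    then have "(\<ominus> \<one>) \<odot>\<^bsub>M\<^esub> x \<in> {x \<in> carrier M. h x \<in> H}" by blast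
    then show "\<ominus>\<^bsub>M\<^esub> x \<in> {x \<in> carrier M. h x \<in> H}" using x by (simp add: smult_l_minus)
  qed (use H in auto)
qed

text \<open>Lifting \<open>r\<close> and \<open>z\<close> turns a generator \<open>r z\<close> of
  \<open>lr R2 M2\<close> into one upstairs whose multiple \<open>r (r z)\<close> lies in the
  kernel. The kernel is arbitrary here, as is needed for quotients by a submodule \<open>L\<close>
  that is not of the form \<open>M[c]\<close>.\<close>

lemma lr_image:
  "lr R2 M2 = h ` submodule_gen R M {r \<odot>\<^bsub>M\<^esub> z | r z. r \<in> carrier R \<and> z \<in> carrier M \<and>
     h (r \<odot>\<^bsub>M\<^esub> (r \<odot>\<^bsub>M\<^esub> z)) = \<zero>\<^bsub>M2\<^esub>}" (is "_ = h ` submodule_gen R M ?S")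
proof
  interpret M2: module R2 M2 by (rule module_codomain)
  have S: "?S \<subseteq> carrier M" by auto
  show "lr R2 M2 \<subseteq> h ` submodule_gen R M ?S"
  proof (rule M2.lr_minimal)
    show "submodule (h ` submodule_gen R M ?S) R2 M2" by (intro submodule_image submodule_gen_submodule S)
    fix r z assume "r \<in> carrier R2" "z \<in> carrier M2" and 0: "r \<odot>\<^bsub>M2\<^esub> (r \<odot>\<^bsub>M2\<^esub> z) = \<zero>\<^bsub>M2\<^esub>"
    then obtain r' z' where r: "r' \<in> carrier R" "r = \<phi> r'" and z: "z' \<in> carrier M" "z = h z'"
      using phi_obtain[OF \<open>r \<in> carrier R2\<close>] h_obtain[OF \<open>z \<in> carrier M2\<close>] by metis
    then have "h (r' \<odot>\<^bsub>M\<^esub> (r' \<odot>\<^bsub>M\<^esub> z')) = \<zero>\<^bsub>M2\<^esub>" using 0 by simp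
    then have "r' \<odot>\<^bsub>M\<^esub> z' \<in> ?S" using r(1) z(1) by blast
    then have "r' \<odot>\<^bsub>M\<^esub> z' \<in> submodule_gen R M ?S" by (rule subsetD[OF submodule_gen_incl])
    moreover have "r \<odot>\<^bsub>M2\<^esub> z = h (r' \<odot>\<^bsub>M\<^esub> z')" using r z by simp
    ultimately show "r \<odot>\<^bsub>M2\<^esub> z \<in> h ` submodule_gen R M ?S" by blast
  qed
  have "submodule_gen R M ?S \<subseteq> {x \<in> carrier M. h x \<in> lr R2 M2}"
    by (rule submodule_gen_minimal[OF submodule_vimage[OF M2.lr_submodule]]) (auto intro!: M2.lr_memI)
  then show "h ` submodule_gen R M ?S \<subseteq> lr R2 M2" by blast
qed

end

text \<open>A way of saying \<open>M2 \<cong> c M\<close> without forming \<open>c M\<close>: an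
  equation in \<open>M2\<close> becomes the corresponding equation in \<open>M\<close> multiplied by
  \<open>c\<close>.\<close>

locale presentation = semilinear_surj R M R2 M2 \<phi> h for R (structure) and M (structure) and c R2 and M2 and \<phi> h +
  assumes c_closed [simp]: "c \<in> carrier R"
    and h_ker: "x \<in> carrier M \<Longrightarrow> h x = \<zero>\<^bsub>M2\<^esub> \<longleftrightarrow> c \<odot>\<^bsub>M\<^esub> x = \<zero>\<^bsub>M\<^esub>"
begin

lemma h_eq_iff:
  assumes "x \<in> carrier M" "y \<in> carrier M"
  shows "h x = h y \<longleftrightarrow> c \<odot>\<^bsub>M\<^esub> x = c \<odot>\<^bsub>M\<^esub> y"
proof -
  interpret M2: module R2 M2 by (rule module_codomain)
  show ?thesis using h_ker[of "x \<ominus>\<^bsub>M\<^esub> y"] assms by (simp add: h_minus smult_minus)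
qed

text \<open>The second kernel scalar is taken as \<open>\<phi> d\<close>, so that
  \<open>\<phi> d\<close> times \<open>h x\<close> is \<open>h (d x)\<close>; this is zero exactly
  when \<open>c d x = 0\<close>.\<close>

lemma presentation_comp:
  assumes "presentation R2 M2 (\<phi> d) R3 M3 \<phi>' h'" and d: "d \<in> carrier R"
  shows "presentation R M (c \<otimes> d) R3 M3 (\<phi>' \<circ> \<phi>) (h' \<circ> h)"
proof -
  interpret p: presentation R2 M2 "\<phi> d" R3 M3 \<phi>' h' by fact
  show ?thesis
  proof
    show "\<phi>' \<circ> \<phi> \<in> ring_hom R R3" by (rule ring_hom_trans[OF hom p.hom])
    show "(\<phi>' \<circ> \<phi>) ` carrier R = carrier R3" by (metis image_comp surj p.surj)
    show "(h' \<circ> h) ` carrier M = carrier M3" by (metis image_comp h_surj p.h_surj)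
    fix x assume x: "x \<in> carrier M"
    have "(h' \<circ> h) x = \<zero>\<^bsub>M3\<^esub> \<longleftrightarrow> h (d \<odot>\<^bsub>M\<^esub> x) = \<zero>\<^bsub>M2\<^esub>" using x d p.h_ker by simp
    also have "\<dots> \<longleftrightarrow> (c \<otimes> d) \<odot>\<^bsub>M\<^esub> x = \<zero>\<^bsub>M\<^esub>" using x d h_ker[of "d \<odot>\<^bsub>M\<^esub> x"] by (simp add: smult_assoc1)
    finally show "(h' \<circ> h) x = \<zero>\<^bsub>M3\<^esub> \<longleftrightarrow> (c \<otimes> d) \<odot>\<^bsub>M\<^esub> x = \<zero>\<^bsub>M\<^esub>" .
  qed (use d in auto)
qed

lemma presentation_change:
  assumes "c' \<in> carrier R" "\<And>x. x \<in> carrier M \<Longrightarrow> c \<odot>\<^bsub>M\<^esub> x = \<zero>\<^bsub>M\<^esub> \<longleftrightarrow> c' \<odot>\<^bsub>M\<^esub> x = \<zero>\<^bsub>M\<^esub>"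
  shows "presentation R M c' R2 M2 \<phi> h"
  by unfold_locales (use assms h_surj h_ker in auto)

end

text \<open>Once \<open>e\<close> maps to \<open>1\<close>, the idempotent disappears from the local
  data of the image, while \<open>n\<close> stays a valid bound for the nilpotency of
  \<open>\<phi> q\<close>.\<close>

lemma (in local_factor) local_factor_image:
  assumes "ring_surj R R2 \<phi>" "\<phi> e = \<one>\<^bsub>R2\<^esub>"
  shows "local_factor R2 \<one>\<^bsub>R2\<^esub> (\<phi> q) n"
proof -
  interpret s: ring_surj R R2 \<phi> by fact
  interpret R2: cring R2 by (rule s.cring_codomain)
  show ?thesis
  proof
    show "\<one>\<^bsub>R2\<^esub> \<otimes>\<^bsub>R2\<^esub> \<phi> q [^]\<^bsub>R2\<^esub> n = \<zero>\<^bsub>R2\<^esub>"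
      using arg_cong[OF e_pow_n, of \<phi>] assms(2) by simp
    fix r assume "r \<in> carrier R2"
    then obtain r' where r': "r' \<in> carrier R" "r = \<phi> r'" by (rule s.phi_obtain)
    then obtain k :: nat and u v where u: "u \<in> carrier R" "v \<in> carrier R" "u \<otimes> v \<otimes> e = e"
      and er: "e \<otimes> r' = e \<otimes> (q [^] k \<otimes> u)" using factor by blast
    show "\<exists>(k::nat) u v. u \<in> carrier R2 \<and> v \<in> carrier R2 \<and>
      u \<otimes>\<^bsub>R2\<^esub> v \<otimes>\<^bsub>R2\<^esub> \<one>\<^bsub>R2\<^esub> = \<one>\<^bsub>R2\<^esub> \<and>
      \<one>\<^bsub>R2\<^esub> \<otimes>\<^bsub>R2\<^esub> r = \<one>\<^bsub>R2\<^esub> \<otimes>\<^bsub>R2\<^esub> (\<phi> q [^]\<^bsub>R2\<^esub> k \<otimes>\<^bsub>R2\<^esub> u)"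
      using arg_cong[OF u(3), of \<phi>] arg_cong[OF er, of \<phi>] u(1,2) r' assms(2)
      by (intro exI[of _ k] exI[of _ "\<phi> u"] exI[of _ "\<phi> v"]) simp
  qed auto
qed

section \<open>Divisibility in \<open>M / M[e q^j]\<close>\<close>

locale local_presentation = local_module R e q n M + presentation R M "e \<otimes> q [^] (j::nat)" R2 M2 \<phi> h
  for R (structure) and e q n and M (structure) and j R2 M2 \<phi> h +
  assumes phi_e: "\<phi> e = \<one>\<^bsub>R2\<^esub>"

sublocale local_presentation \<subseteq> img: local_module R2 "\<one>\<^bsub>R2\<^esub>" "\<phi> q" n M2
  by (intro local_module.intro local_factor_image module_codomain ring_surj_axioms phi_e)

context local_presentation
begin

text \<open>Under \<open>h x \<mapsto> e q^j x\<close> the condition of index \<open>l\<close> on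
  \<open>h x\<close> asks for \<open>e q^{l+j} x\<close> to be divisible by
  \<open>e q^{2l+1-i+j}\<close>. As \<open>2 l + 1 - i + j = 2 (l + j) + 1 - (i + j)\<close>, this
  is the condition of index \<open>l + j\<close> on \<open>x\<close>. What this misses is void: the
  indices below \<open>j\<close> on the side of \<open>x\<close>, and those for which
  \<open>2 l + 1 - i\<close> is truncated.\<close>

lemma half_div_presentation:
  assumes x: "x \<in> carrier M"
  shows "img.P i (h x) \<longleftrightarrow> P (i + j) x"
proof -
  have 1: "img.P i (h x) \<longleftrightarrow> (\<forall>l. \<exists>z\<in>carrier M.
      (e \<otimes> q [^] (l + j)) \<odot>\<^bsub>M\<^esub> x = (e \<otimes> q [^] (2 * l + 1 - i + j)) \<odot>\<^bsub>M\<^esub> z)" (is "_ \<longleftrightarrow> (\<forall>l. ?Q l)")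
  proof -
    have "(\<exists>z\<in>carrier M2. (\<one>\<^bsub>R2\<^esub> \<otimes>\<^bsub>R2\<^esub> \<phi> q [^]\<^bsub>R2\<^esub> l) \<odot>\<^bsub>M2\<^esub> h x = (\<one>\<^bsub>R2\<^esub> \<otimes>\<^bsub>R2\<^esub> \<phi> q [^]\<^bsub>R2\<^esub> k) \<odot>\<^bsub>M2\<^esub> z)
      \<longleftrightarrow> (\<exists>z\<in>carrier M. (e \<otimes> q [^] (l + j)) \<odot>\<^bsub>M\<^esub> x = (e \<otimes> q [^] (k + j)) \<odot>\<^bsub>M\<^esub> z)" for l k :: nat
    proof -
      have "(\<exists>z\<in>carrier M2. (\<one>\<^bsub>R2\<^esub> \<otimes>\<^bsub>R2\<^esub> \<phi> q [^]\<^bsub>R2\<^esub> l) \<odot>\<^bsub>M2\<^esub> h x = (\<one>\<^bsub>R2\<^esub> \<otimes>\<^bsub>R2\<^esub> \<phi> q [^]\<^bsub>R2\<^esub> k) \<odot>\<^bsub>M2\<^esub> z)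
        \<longleftrightarrow> (\<exists>z\<in>carrier M. h (q [^] l \<odot>\<^bsub>M\<^esub> x) = h (q [^] k \<odot>\<^bsub>M\<^esub> z))"
        using x unfolding h_surj[symmetric] by auto
      also have "\<dots> \<longleftrightarrow> (\<exists>z\<in>carrier M. (e \<otimes> q [^] (l + j)) \<odot>\<^bsub>M\<^esub> x = (e \<otimes> q [^] (k + j)) \<odot>\<^bsub>M\<^esub> z)"
      proof (intro bex_cong refl)
        fix z assume z: "z \<in> carrier M"
        have "(e \<otimes> q [^] j) \<odot>\<^bsub>M\<^esub> (q [^] l \<odot>\<^bsub>M\<^esub> y) = (e \<otimes> q [^] (l + j)) \<odot>\<^bsub>M\<^esub> y" if "y \<in> carrier M" for y and l :: nat
          using that by (simp add: smult_assoc1[symmetric] m_assoc nat_pow_mult add.commute)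
        then show "h (q [^] l \<odot>\<^bsub>M\<^esub> x) = h (q [^] k \<odot>\<^bsub>M\<^esub> z) \<longleftrightarrow> 
          (e \<otimes> q [^] (l + j)) \<odot>\<^bsub>M\<^esub> x = (e \<otimes> q [^] (k + j)) \<odot>\<^bsub>M\<^esub> z"
          using h_eq_iff[of "q [^] l \<odot>\<^bsub>M\<^esub> x" "q [^] k \<odot>\<^bsub>M\<^esub> z"] x z by simp
      qed
      finally show ?thesis .
    qed
    then show ?thesis unfolding half_div_def by simp
  qed
  show ?thesis
  proof
    assume L: "img.P i (h x)"
    show "P (i + j) x" unfolding half_div_def
    proof
      fix l
      show "\<exists>z\<in>carrier M. (e \<otimes> q [^] l) \<odot>\<^bsub>M\<^esub> x = (e \<otimes> q [^] (2 * l + 1 - (i + j))) \<odot>\<^bsub>M\<^esub> z"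
      proof (cases "l < j")
        case True
        then have "2 * l + 1 - (i + j) \<le> l" by simp
        then show ?thesis using smult_pow_split[OF _ x] x by fastforce
      next
        case False
        have "?Q (l - j)" using L 1 by blast
        then obtain z where z: "z \<in> carrier M" 
          "(e \<otimes> q [^] l) \<odot>\<^bsub>M\<^esub> x = (e \<otimes> q [^] (2 * (l - j) + 1 - i + j)) \<odot>\<^bsub>M\<^esub> z" using False by auto
        have "2 * l + 1 - (i + j) \<le> 2 * (l - j) + 1 - i + j" using False by simp
        from smult_pow_split[OF this z(1)] z show ?thesis by auto
      qed
    qed
  next
    assume R: "P (i + j) x"
    have "?Q l" for l
    proof (cases "2 * l + 1 < i")
      case True
      then have "2 * l + 1 - i + j \<le> l + j" by simp
      from smult_pow_split[OF this x] x show ?thesis by auto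
    next
      case False
      obtain z where "z \<in> carrier M" 
        "(e \<otimes> q [^] (l + j)) \<odot>\<^bsub>M\<^esub> x = (e \<otimes> q [^] (2 * (l + j) + 1 - (i + j))) \<odot>\<^bsub>M\<^esub> z"
        using R unfolding half_div_def by blast
      moreover have "2 * (l + j) + 1 - (i + j) = 2 * l + 1 - i + j" using False by simp
      ultimately show ?thesis by metis
    qed
    then show "img.P i (h x)" using 1 by blast
  qed
qed

lemma img_lr_iff: "x \<in> carrier M \<Longrightarrow> h x \<in> lr R2 M2 \<longleftrightarrow> P j x"
  using img.half_div_imp_lr[of "h x"] img.lr_imp_half_div[of "h x"] half_div_presentation[of x 0]
  by auto

lemma img_ur_iff: "x \<in> carrier M \<Longrightarrow> h x \<in> ur R2 M2 \<longleftrightarrow> P (j + 1) x"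
  using img.half_div_imp_ur[of "h x"] img.ur_imp_half_div[of "h x"] half_div_presentation[of x 1]
  by auto

end

section \<open>Cosets of submodules\<close>

lemma a_r_coset_carrier [simp]: "a_r_coset (M\<lparr>carrier := U\<rparr>) = a_r_coset M"
  by (simp add: fun_eq_iff a_r_coset_def')

lemma carrier_fact_module: 
  "carrier (fact_module M L) = a_r_coset M L ` carrier M"
  "carrier (fact_module_over M L) = a_r_coset M L ` carrier M"
  unfolding fact_module_def fact_module_over_def A_RCOSETS_def' by auto

lemma carrier_fact_submodule: "carrier (fact_module (M\<lparr>carrier := U\<rparr>) L) = a_r_coset M L ` U"
  by (simp add: carrier_fact_module)

context module
begin

lemma coset_self: "submodule H R M \<Longrightarrow> x \<in> carrier M \<Longrightarrow> x \<in> H +>\<^bsub>M\<^esub> x"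
  using submodule_zero_closed unfolding a_r_coset_def' by force

lemma mem_coset_iff:
  assumes H: "submodule H R M" and x: "x \<in> carrier M"
  shows "y \<in> H +>\<^bsub>M\<^esub> x \<longleftrightarrow> y \<in> carrier M \<and> y \<ominus>\<^bsub>M\<^esub> x \<in> H"
proof
  assume "y \<in> H +>\<^bsub>M\<^esub> x"
  then obtain h where h: "h \<in> H" "y = h \<oplus>\<^bsub>M\<^esub> x" unfolding a_r_coset_def' by auto
  then have "h \<in> carrier M" using submoduleE(1)[OF H] by blast
  then show "y \<in> carrier M \<and> y \<ominus>\<^bsub>M\<^esub> x \<in> H"
    using h x by (simp add: a_minus_def M.a_assoc M.r_neg)
next
  assume y: "y \<in> carrier M \<and> y \<ominus>\<^bsub>M\<^esub> x \<in> H"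
  then have "y = (y \<ominus>\<^bsub>M\<^esub> x) \<oplus>\<^bsub>M\<^esub> x" using x by (simp add: a_minus_def M.a_assoc M.l_neg)
  then show "y \<in> H +>\<^bsub>M\<^esub> x" using y unfolding a_r_coset_def' by blast
qed

lemma coset_eq_iff:
  assumes H: "submodule H R M" and x: "x \<in> carrier M" and y: "y \<in> carrier M"
  shows "H +>\<^bsub>M\<^esub> x = H +>\<^bsub>M\<^esub> y \<longleftrightarrow> x \<ominus>\<^bsub>M\<^esub> y \<in> H"
proof
  assume "H +>\<^bsub>M\<^esub> x = H +>\<^bsub>M\<^esub> y"
  then show "x \<ominus>\<^bsub>M\<^esub> y \<in> H" using mem_coset_iff[OF H y] coset_self[OF H x] by blast
next
  assume "x \<ominus>\<^bsub>M\<^esub> y \<in> H"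
  then have "x \<in> H +>\<^bsub>M\<^esub> y" using mem_coset_iff[OF H y] x by blast
  then show "H +>\<^bsub>M\<^esub> x = H +>\<^bsub>M\<^esub> y"
    using M.a_repr_independence[OF _ y submodule.axioms(1)[OF H]] by blast
qed

lemma coset_eq_self_iff:
  assumes H: "submodule H R M" and x: "x \<in> carrier M"
  shows "H +>\<^bsub>M\<^esub> x = H \<longleftrightarrow> x \<in> H"
proof -
  have "\<ominus>\<^bsub>M\<^esub> \<zero>\<^bsub>M\<^esub> = \<zero>\<^bsub>M\<^esub>" by (metis M.l_neg M.r_zero M.zero_closed M.a_inv_closed)
  then have "x \<ominus>\<^bsub>M\<^esub> \<zero>\<^bsub>M\<^esub> = x" using x by (metis a_minus_def M.r_zero)
  then show ?thesis
    using coset_eq_iff[OF H x M.zero_closed] M.a_coset_add_zero[OF submoduleE(1)[OF H]] by metis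
qed

lemma coset_add:
  assumes H: "submodule H R M" and x: "x \<in> carrier M" and y: "y \<in> carrier M"
  shows "(H +>\<^bsub>M\<^esub> x) <+>\<^bsub>M\<^esub> (H +>\<^bsub>M\<^esub> y) = H +>\<^bsub>M\<^esub> (x \<oplus>\<^bsub>M\<^esub> y)"
proof -
  interpret a: abelian_subgroup H M
    by (intro abelian_subgroupI2 M.a_comm_group submodule.axioms(1)[OF H])
  show ?thesis using a.a_rcos_sum[OF x y] .
qed

lemma coset_smult:
  assumes H: "submodule H R M" and a: "a \<in> carrier R" and x: "x \<in> carrier M"
  shows "(\<Union>y\<in>H +>\<^bsub>M\<^esub> x. H +>\<^bsub>M\<^esub> (a \<odot>\<^bsub>M\<^esub> y)) = H +>\<^bsub>M\<^esub> (a \<odot>\<^bsub>M\<^esub> x)"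
proof -
  have "H +>\<^bsub>M\<^esub> (a \<odot>\<^bsub>M\<^esub> y) = H +>\<^bsub>M\<^esub> (a \<odot>\<^bsub>M\<^esub> x)" if "y \<in> H +>\<^bsub>M\<^esub> x" for y
    using that a x submoduleE(4)[OF H a] by (simp add: mem_coset_iff[OF H] coset_eq_iff[OF H] smult_minus[symmetric])
  then show ?thesis using coset_self[OF H x] by blast
qed

end

section \<open>The odd form\<close>

locale form_module = module R M + N: module R N for R (structure) and M (structure) and N (structure) and B +
  assumes form: "symmetric_bilinear_form R M N B"
begin

lemma B_simps [simp]:
  "x \<in> carrier M \<Longrightarrow> y \<in> carrier M \<Longrightarrow> B x y \<in> carrier N"
  "x \<in> carrier M \<Longrightarrow> y \<in> carrier M \<Longrightarrow> z \<in> carrier M \<Longrightarrow> B (x \<oplus>\<^bsub>M\<^esub> y) z = B x z \<oplus>\<^bsub>N\<^esub> B y z"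
  "x \<in> carrier M \<Longrightarrow> y \<in> carrier M \<Longrightarrow> z \<in> carrier M \<Longrightarrow> B x (y \<oplus>\<^bsub>M\<^esub> z) = B x y \<oplus>\<^bsub>N\<^esub> B x z"
  "a \<in> carrier R \<Longrightarrow> x \<in> carrier M \<Longrightarrow> y \<in> carrier M \<Longrightarrow> B (a \<odot>\<^bsub>M\<^esub> x) y = a \<odot>\<^bsub>N\<^esub> B x y"
  "a \<in> carrier R \<Longrightarrow> x \<in> carrier M \<Longrightarrow> y \<in> carrier M \<Longrightarrow> B x (a \<odot>\<^bsub>M\<^esub> y) = a \<odot>\<^bsub>N\<^esub> B x y"
  using form unfolding symmetric_bilinear_form_def by blast+

lemma B_sym: "x \<in> carrier M \<Longrightarrow> y \<in> carrier M \<Longrightarrow> B x y = B y x"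
  using form unfolding symmetric_bilinear_form_def by blast

lemma B_zero [simp]:
  "x \<in> carrier M \<Longrightarrow> B \<zero>\<^bsub>M\<^esub> x = \<zero>\<^bsub>N\<^esub>" "x \<in> carrier M \<Longrightarrow> B x \<zero>\<^bsub>M\<^esub> = \<zero>\<^bsub>N\<^esub>"
  using B_simps(4)[of \<zero> "\<zero>\<^bsub>M\<^esub>" x] B_simps(5)[of \<zero> x "\<zero>\<^bsub>M\<^esub>"] by simp_all

lemma B_neg [simp]:
  "x \<in> carrier M \<Longrightarrow> y \<in> carrier M \<Longrightarrow> B (\<ominus>\<^bsub>M\<^esub> x) y = \<ominus>\<^bsub>N\<^esub> B x y"
  "x \<in> carrier M \<Longrightarrow> y \<in> carrier M \<Longrightarrow> B x (\<ominus>\<^bsub>M\<^esub> y) = \<ominus>\<^bsub>N\<^esub> B x y"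
  using B_simps(4)[of "\<ominus> \<one>" x y] B_simps(5)[of "\<ominus> \<one>" x y] 
  by (simp_all add: smult_l_minus N.smult_l_minus)

lemma B_minus [simp]:
  "x \<in> carrier M \<Longrightarrow> y \<in> carrier M \<Longrightarrow> z \<in> carrier M \<Longrightarrow> B (x \<ominus>\<^bsub>M\<^esub> y) z = B x z \<ominus>\<^bsub>N\<^esub> B y z"
  "x \<in> carrier M \<Longrightarrow> y \<in> carrier M \<Longrightarrow> z \<in> carrier M \<Longrightarrow> B x (y \<ominus>\<^bsub>M\<^esub> z) = B x y \<ominus>\<^bsub>N\<^esub> B x z"
  by (simp_all add: a_minus_def)

lemma perp_submodule:
  assumes "L \<subseteq> carrier M" shows "submodule (perp M N B L) R M"
  using assms unfolding perp_def by (intro submoduleI) (auto simp: subset_iff)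

text \<open>For a generator \<open>r z\<close> of \<open>lr\<close> and
  \<open>r x = r (r w)\<close>, moving \<open>r\<close> across the form gives
  \<open>B (r z) x = B z (r (r w)) = B (r (r z)) w = 0\<close>.\<close>

lemma ur_perp_lr:
  assumes x: "x \<in> ur R M" and y: "y \<in> lr R M"
  shows "B x y = \<zero>\<^bsub>N\<^esub>"
proof -
  have xM: "x \<in> carrier M" using x ur_iff by blast
  have "lr R M \<subseteq> perp M N B {x}"
  proof (rule lr_minimal)
    fix r z assume r: "r \<in> carrier R" and z: "z \<in> carrier M" and 0: "r \<odot>\<^bsub>M\<^esub> (r \<odot>\<^bsub>M\<^esub> z) = \<zero>\<^bsub>M\<^esub>"
    obtain w where w: "w \<in> carrier M" "r \<odot>\<^bsub>M\<^esub> x = r \<odot>\<^bsub>M\<^esub> (r \<odot>\<^bsub>M\<^esub> w)" using x r ur_iff by blast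
    have "B (r \<odot>\<^bsub>M\<^esub> z) x = B z (r \<odot>\<^bsub>M\<^esub> x)" using r z xM by simp
    also have "\<dots> = B (r \<odot>\<^bsub>M\<^esub> (r \<odot>\<^bsub>M\<^esub> z)) w" unfolding w(2) using r z w(1) by simp
    finally show "r \<odot>\<^bsub>M\<^esub> z \<in> perp M N B {x}" using 0 w r z unfolding perp_def by simp
  qed (use perp_submodule xM in auto)
  then show ?thesis using y xM B_sym[of x y] unfolding perp_def by auto
qed

text \<open>In the expansion of \<open>B (l + x) (l' + y)\<close> every term except
  \<open>B x y\<close> pairs an element of \<open>ur\<close> with one of \<open>lr\<close>, so the
  set inside \<open>the_elem\<close> is a singleton. The inclusion \<open>lu\<close> is a hypothesis
  because it is read off from divisibility in each instance.\<close>

lemma odd_form_cosets: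
  assumes lu: "lr R M \<subseteq> ur R M" and x: "x \<in> ur R M" and y: "y \<in> ur R M"
  shows "odd_form B (lr R M +>\<^bsub>M\<^esub> x) (lr R M +>\<^bsub>M\<^esub> y) = B x y"
proof -
  have xM: "x \<in> carrier M" and yM: "y \<in> carrier M" using x y ur_iff by blast+
  note L = submoduleE(1)[OF lr_submodule]
  have *: "B (l \<oplus>\<^bsub>M\<^esub> x) (l' \<oplus>\<^bsub>M\<^esub> y) = B x y" if l: "l \<in> lr R M" "l' \<in> lr R M" for l l'
  proof -
    have "B l l' = \<zero>\<^bsub>N\<^esub>" using ur_perp_lr l lu by blast
    moreover have "B l y = \<zero>\<^bsub>N\<^esub>" using ur_perp_lr[OF y l(1)] B_sym[of l y] yM l L by auto
    moreover have "B x l' = \<zero>\<^bsub>N\<^esub>" using ur_perp_lr[OF x l(2)] .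
    ultimately show ?thesis using l L xM yM by (simp add: subset_iff)
  qed
  have "(\<lambda>(x, y). B x y) ` ((lr R M +>\<^bsub>M\<^esub> x) \<times> (lr R M +>\<^bsub>M\<^esub> y)) = {B x y}"
  proof (rule equalityI; rule subsetI)
    fix b assume "b \<in> (\<lambda>(x, y). B x y) ` ((lr R M +>\<^bsub>M\<^esub> x) \<times> (lr R M +>\<^bsub>M\<^esub> y))"
    then obtain l l' where "l \<in> lr R M" "l' \<in> lr R M" "b = B (l \<oplus>\<^bsub>M\<^esub> x) (l' \<oplus>\<^bsub>M\<^esub> y)"
      unfolding a_r_coset_def' by auto
    then show "b \<in> {B x y}" using * by simp
  next
    fix b assume "b \<in> {B x y}"
    moreover have "z \<in> lr R M +>\<^bsub>M\<^esub> z" if "z \<in> carrier M" for z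
      using that submodule_zero_closed[OF lr_submodule] unfolding a_r_coset_def' by force
    ultimately show "b \<in> (\<lambda>(x, y). B x y) ` ((lr R M +>\<^bsub>M\<^esub> x) \<times> (lr R M +>\<^bsub>M\<^esub> y))"
      using xM yM by (auto intro!: image_eqI[of _ _ "(x, y)"])
  qed
  then show ?thesis unfolding odd_form_def by simp
qed

lemma anisotropic_odd_iff:
  assumes lu: "lr R M \<subseteq> ur R M"
  shows "anisotropic_on (odd_module R M) N (odd_form B) \<longleftrightarrow>
    (\<forall>x\<in>ur R M. B x x = \<zero>\<^bsub>N\<^esub> \<longrightarrow> x \<in> lr R M)"
proof -
  have "(lr R M +>\<^bsub>M\<^esub> x = lr R M) \<longleftrightarrow> x \<in> lr R M" if "x \<in> ur R M" for x
    using that coset_eq_self_iff[OF lr_submodule] ur_iff by simp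
  then show ?thesis
    using odd_form_cosets[OF lu]
    unfolding anisotropic_on_def odd_module_def carrier_fact_submodule
    by (auto simp: fact_module_def)
qed

end


section \<open>Quotients by torsion submodules\<close>

lemma regular_module_simps [simp]:
  "carrier (regular_module R) = carrier R" "smult (regular_module R) = monoid.mult R"
  "ring.zero (regular_module R) = ring.zero R" "ring.add (regular_module R) = ring.add R"
  unfolding regular_module_def by simp_all

lemma (in cring) module_regular: "module R (regular_module R)"
proof (rule moduleI)
  show "abelian_group (regular_module R)"
    by (rule abelian_groupI) (auto simp: a_ac intro: bexI[of _ "\<ominus> x" for x] l_neg)
qed (auto simp: is_cring l_distr r_distr m_assoc)

lemma (in module) tors_ideal:
  assumes "d \<in> carrier R"
  shows "ideal (tors (regular_module R) {d}) R"
proof -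
  interpret reg: module R "regular_module R" by (rule R.module_regular)
  show ?thesis
  proof (rule idealI)
    have "subgroup (tors (regular_module R) {d}) (add_monoid (regular_module R))"
      using reg.tors_submodule[of "{d}"] assms by (auto dest: submodule.axioms(1))
    then show "subgroup (tors (regular_module R) {d}) (add_monoid R)"
      by (auto simp: subgroup_def m_inv_def)
    fix a x assume a: "a \<in> tors (regular_module R) {d}" and x: "x \<in> carrier R"
    have "d \<otimes> (a \<otimes> x) = (d \<otimes> a) \<otimes> x" using a x assms by (simp add: tors_def R.m_assoc[symmetric])
    then show "a \<otimes> x \<in> tors (regular_module R) {d}" using a x by (simp add: tors_def)
    then show "x \<otimes> a \<in> tors (regular_module R) {d}" using a x by (simp add: tors_def R.m_comm)
  qed (rule R.ring_axioms)
qed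

lemma (in module) fact_module_surj:
  assumes L: "submodule L R M"
  shows "semilinear_surj R M R (fact_module M L) id (a_r_coset M L)"
proof
  fix x assume x: "x \<in> carrier M"
  show "L +>\<^bsub>M\<^esub> (a \<odot>\<^bsub>M\<^esub> x) = id a \<odot>\<^bsub>fact_module M L\<^esub> (L +>\<^bsub>M\<^esub> x)" if "a \<in> carrier R" for a
    using coset_smult[OF L that x] by (simp add: fact_module_def)
  show "L +>\<^bsub>M\<^esub> (x \<oplus>\<^bsub>M\<^esub> y) = (L +>\<^bsub>M\<^esub> x) \<oplus>\<^bsub>fact_module M L\<^esub> (L +>\<^bsub>M\<^esub> y)" if "y \<in> carrier M" for y
    using coset_add[OF L x that] by (simp add: fact_module_def)
next
  show "L +>\<^bsub>M\<^esub> \<zero>\<^bsub>M\<^esub> = \<zero>\<^bsub>fact_module M L\<^esub>"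
    using coset_eq_self_iff[OF L M.zero_closed] submodule_zero_closed[OF L] by (simp add: fact_module_def)
qed (auto simp: ring_hom_def carrier_fact_module)

lemma (in module) fact_module_presentation:
  assumes d: "d \<in> carrier R"
  shows "presentation R M d R (fact_module M (tors M {d})) id (a_r_coset M (tors M {d}))"
proof (intro presentation.intro presentation_axioms.intro d)
  have L: "submodule (tors M {d}) R M" using d by (intro tors_submodule) auto
  then show "semilinear_surj R M R (fact_module M (tors M {d})) id (a_r_coset M (tors M {d}))"
    by (rule fact_module_surj)
  fix x assume x: "x \<in> carrier M"
  show "tors M {d} +>\<^bsub>M\<^esub> x = \<zero>\<^bsub>fact_module M (tors M {d})\<^esub> \<longleftrightarrow> d \<odot>\<^bsub>M\<^esub> x = \<zero>\<^bsub>M\<^esub>"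
    using coset_eq_self_iff[OF L x] x by (simp add: fact_module_def tors_def)
qed

text \<open>A scalar \<open>c\<close> with \<open>d c = 0\<close> sends every \<open>x\<close> into
  \<open>M[d]\<close>, so cosets modulo the annihilator of \<open>d\<close> act unambiguously on
  \<open>M/M[d]\<close>.\<close>

lemma (in module) fact_module_over_presentation:
  assumes d: "d \<in> carrier R"
  defines "J \<equiv> tors (regular_module R) {d}"
  shows "presentation R M d (R Quot J) (fact_module_over M (tors M {d}))
    (a_r_coset R J) (a_r_coset M (tors M {d}))"
proof -
  have L: "submodule (tors M {d}) R M" using d by (intro tors_submodule) auto
  interpret J: ideal J R unfolding J_def by (rule tors_ideal[OF d])
  show ?thesis
  proof
    show "(+>\<^bsub>R\<^esub>) J \<in> ring_hom R (R Quot J)" by (rule J.rcos_ring_hom)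
    show "(+>\<^bsub>R\<^esub>) J ` carrier R = carrier (R Quot J)" by (auto simp: FactRing_def A_RCOSETS_def')
    show "J +> \<zero> = \<zero>\<^bsub>R Quot J\<^esub>" by (simp add: FactRing_def J.a_subset)
    fix x assume x: "x \<in> carrier M"
    show "tors M {d} +>\<^bsub>M\<^esub> x = \<zero>\<^bsub>fact_module_over M (tors M {d})\<^esub> \<longleftrightarrow> d \<odot>\<^bsub>M\<^esub> x = \<zero>\<^bsub>M\<^esub>"
      using coset_eq_self_iff[OF L x] x by (simp add: fact_module_over_def tors_def)
    {
      fix a assume a: "a \<in> carrier R"
      have "(\<Union>y\<in>tors M {d} +>\<^bsub>M\<^esub> x. tors M {d} +>\<^bsub>M\<^esub> (b \<odot>\<^bsub>M\<^esub> y)) = tors M {d} +>\<^bsub>M\<^esub> (a \<odot>\<^bsub>M\<^esub> x)" if b: "b \<in> J +> a" for b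
      proof -
        obtain c where "c \<in> J" "b = c \<oplus> a" using b unfolding a_r_coset_def' by blast
        then have c: "c \<in> carrier R" "d \<otimes> c = \<zero>" "b = c \<oplus> a" unfolding J_def tors_def by auto
        have "d \<odot>\<^bsub>M\<^esub> (c \<odot>\<^bsub>M\<^esub> x) = \<zero>\<^bsub>M\<^esub>" using c d x by (simp add: smult_assoc1[symmetric])
        moreover have "b \<odot>\<^bsub>M\<^esub> x \<ominus>\<^bsub>M\<^esub> a \<odot>\<^bsub>M\<^esub> x = c \<odot>\<^bsub>M\<^esub> x"
          using c a x by (simp add: smult_l_distr a_minus_def M.a_assoc M.r_neg)
        ultimately have "tors M {d} +>\<^bsub>M\<^esub> (b \<odot>\<^bsub>M\<^esub> x) = tors M {d} +>\<^bsub>M\<^esub> (a \<odot>\<^bsub>M\<^esub> x)"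
          using c a x by (simp add: coset_eq_iff[OF L]) (simp add: tors_def)
        then show ?thesis using coset_smult[OF L _ x, of b] c a by simp
      qed
      then show "tors M {d} +>\<^bsub>M\<^esub> (a \<odot>\<^bsub>M\<^esub> x) = (J +> a) \<odot>\<^bsub>fact_module_over M (tors M {d})\<^esub> (tors M {d} +>\<^bsub>M\<^esub> x)"
        using J.a_rcos_self[OF a] by (auto simp: fact_module_over_def)
    }
    fix y assume y: "y \<in> carrier M"
    show "tors M {d} +>\<^bsub>M\<^esub> (x \<oplus>\<^bsub>M\<^esub> y) = (tors M {d} +>\<^bsub>M\<^esub> x) \<oplus>\<^bsub>fact_module_over M (tors M {d})\<^esub> (tors M {d} +>\<^bsub>M\<^esub> y)"
      using coset_add[OF L x y] by (simp add: fact_module_over_def)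
  next
    show "tors M {d} +>\<^bsub>M\<^esub> \<zero>\<^bsub>M\<^esub> = \<zero>\<^bsub>fact_module_over M (tors M {d})\<^esub>"
      using coset_eq_self_iff[OF L M.zero_closed] submodule_zero_closed[OF L] by (simp add: fact_module_over_def)
  qed (use d in \<open>auto simp: carrier_fact_module\<close>)
qed

lemma (in module) tors_PIdl:
  assumes d: "d \<in> carrier R"
  shows "tors M (PIdl d) = tors M {d}"
proof
  show "tors M (PIdl d) \<subseteq> tors M {d}"
    using R.cgenideal_self[OF d] unfolding tors_def by blast
  show "tors M {d} \<subseteq> tors M (PIdl d)"
    using d unfolding tors_def cgenideal_def by (auto simp: smult_assoc1)
qed

text \<open>Modulo \<open>N[d]\<close> only \<open>d B(x', y')\<close> matters, and \<open>d\<close>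
  can be attached to either argument in turn, where it removes the choice of the
  representative.\<close>

lemma (in form_module) quot_form_cosets:
  assumes d: "d \<in> carrier R" and x: "x \<in> carrier M" and y: "y \<in> carrier M"
  shows "quot_form N (tors N {d}) B (tors M {d} +>\<^bsub>M\<^esub> x) (tors M {d} +>\<^bsub>M\<^esub> y) = tors N {d} +>\<^bsub>N\<^esub> B x y"
proof -
  have L: "submodule (tors M {d}) R M" using d by (intro tors_submodule) auto
  have K: "submodule (tors N {d}) R N" using d by (intro N.tors_submodule) auto
  have "tors N {d} +>\<^bsub>N\<^esub> B x' y' = tors N {d} +>\<^bsub>N\<^esub> B x y"
    if "x' \<in> tors M {d} +>\<^bsub>M\<^esub> x" "y' \<in> tors M {d} +>\<^bsub>M\<^esub> y" for x' y'
  proof -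
    have xy: "x' \<in> carrier M" "y' \<in> carrier M" "d \<odot>\<^bsub>M\<^esub> x' = d \<odot>\<^bsub>M\<^esub> x" "d \<odot>\<^bsub>M\<^esub> y' = d \<odot>\<^bsub>M\<^esub> y"
      using that mem_coset_iff[OF L x] mem_coset_iff[OF L y] x y d by (auto simp: tors_def smult_minus)
    have "d \<odot>\<^bsub>N\<^esub> B x' y' = B x' (d \<odot>\<^bsub>M\<^esub> y)" using xy d y by (simp flip: B_simps(5))
    also have "\<dots> = B (d \<odot>\<^bsub>M\<^esub> x') y" using xy(1) d y by simp
    also have "\<dots> = d \<odot>\<^bsub>N\<^esub> B x y" unfolding xy(3) using d x y by simp
    finally show ?thesis using xy x y d by (simp add: N.coset_eq_iff[OF K]) (simp add: tors_def N.smult_minus)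
  qed
  then show ?thesis unfolding quot_form_def using coset_self[OF L] x y by blast
qed

section \<open>Localization\<close>

text \<open>\<open>unit\<close> makes every element outside \<open>p\<close> invertible on
  \<open>e R\<close>, and \<open>e_notin\<close> makes \<open>e\<close> itself a denominator, which
  kills \<open>1 - e\<close>. Together they identify \<open>R_p\<close> with \<open>e R\<close> and
  \<open>M_p\<close> with \<open>e M\<close>.\<close>

locale prime_factor = cring R for R (structure) +
  fixes p e q n
  assumes prime: "primeideal p R" and e_closed [simp, intro]: "e \<in> carrier R"
    and q_closed [simp, intro]: "q \<in> carrier R"
    and p_eq: "p = PIdl q"
    and e_idem: "e \<otimes> e = e" and e_pow_n: "e \<otimes> q [^] (n::nat) = \<zero>"
    and e_notin: "e \<notin> p"
    and unit: "\<And>u. u \<in> carrier R - p \<Longrightarrow> \<exists>v\<in>carrier R. u \<otimes> v \<otimes> e = e"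

text \<open>Divide \<open>r\<close> by \<open>q\<close> as long as the cofactor lies in
  \<open>p\<close>. Either a cofactor outside \<open>p\<close> appears, which is a unit on
  \<open>e R\<close>, or \<open>q^n\<close> divides \<open>r\<close> and \<open>e r = 0\<close>;
  zero is then written as \<open>e q^n\<close> with \<open>u = \<one>\<close>.\<close>

sublocale prime_factor \<subseteq> local_factor R e q n
proof
  fix r assume r: "r \<in> carrier R"
  have "(\<exists>(k::nat) u. u \<in> carrier R - p \<and> r = q [^] k \<otimes> u) \<or> (\<exists>c\<in>carrier R. r = q [^] m \<otimes> c)" for m :: nat
  proof (induction m)
    case 0 then show ?case using r by auto
  next
    case (Suc m)
    show ?case
    proof (cases "\<exists>(k::nat) u. u \<in> carrier R - p \<and> r = q [^] k \<otimes> u")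
      case False
      then obtain c where c: "c \<in> carrier R" "r = q [^] m \<otimes> c" using Suc.IH by blast
      then have "c \<in> p" using False by blast
      then obtain b where "b \<in> carrier R" "c = b \<otimes> q" unfolding p_eq cgenideal_def by blast
      then show ?thesis using c by (intro disjI2 bexI[of _ b]) (auto simp: m_ac)
    qed blast
  qed
  then consider (1) k :: nat and u where "u \<in> carrier R - p" "r = q [^] k \<otimes> u" | (2) c where "c \<in> carrier R" "r = q [^] n \<otimes> c"
    by blast
  then show "\<exists>(k::nat) u v. u \<in> carrier R \<and> v \<in> carrier R \<and> u \<otimes> v \<otimes> e = e \<and> e \<otimes> r = e \<otimes> (q [^] k \<otimes> u)"
  proof cases
    case 1 then show ?thesis using unit[of u] by blast
  next
    case 2
    then have "e \<otimes> r = (e \<otimes> q [^] n) \<otimes> c" by (simp add: m_assoc)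
    then have "e \<otimes> r = e \<otimes> (q [^] n \<otimes> \<one>)" using e_pow_n 2 by simp
    then show ?thesis by (intro exI[of _ n] exI[of _ \<one>]) auto
  qed
qed (rule e_idem e_pow_n e_closed q_closed)+

locale prime_module = prime_factor R p e q n + module R M for R (structure) and p e q n and M (structure)
begin

abbreviation "S \<equiv> carrier R - p"

lemma one_in_S: "\<one> \<in> S" 
  using primeideal.I_notcarr[OF prime] ideal.one_imp_carrier[OF primeideal.axioms(1)[OF prime]] by auto

lemma e_in_S: "e \<in> S" using e_notin by simp

lemma S_mult: "s \<in> S \<Longrightarrow> t \<in> S \<Longrightarrow> s \<otimes> t \<in> S"
  using primeideal.I_prime[OF prime] by auto

text \<open>The auxiliary factor \<open>u\<close> in the equality of fractions can always be taken
  to be \<open>e\<close>: it lies outside \<open>p\<close>, and every other \<open>u\<close> outside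
  \<open>p\<close> is invertible on \<open>e R\<close>.\<close>

lemma mem_loc_frac:
  assumes x: "x \<in> carrier M" and s: "s \<in> S"
  shows "(y, t) \<in> loc_frac R p M x s \<longleftrightarrow>
    y \<in> carrier M \<and> t \<in> S \<and> (e \<otimes> t) \<odot>\<^bsub>M\<^esub> x = (e \<otimes> s) \<odot>\<^bsub>M\<^esub> y"
proof -
  have "(\<exists>u\<in>S. u \<odot>\<^bsub>M\<^esub> (t \<odot>\<^bsub>M\<^esub> x) = u \<odot>\<^bsub>M\<^esub> (s \<odot>\<^bsub>M\<^esub> y)) \<longleftrightarrow> (e \<otimes> t) \<odot>\<^bsub>M\<^esub> x = (e \<otimes> s) \<odot>\<^bsub>M\<^esub> y"
    if y: "y \<in> carrier M" and t: "t \<in> S"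
  proof
    assume "\<exists>u\<in>S. u \<odot>\<^bsub>M\<^esub> (t \<odot>\<^bsub>M\<^esub> x) = u \<odot>\<^bsub>M\<^esub> (s \<odot>\<^bsub>M\<^esub> y)"
    then obtain u where u: "u \<in> S" "u \<odot>\<^bsub>M\<^esub> (t \<odot>\<^bsub>M\<^esub> x) = u \<odot>\<^bsub>M\<^esub> (s \<odot>\<^bsub>M\<^esub> y)" by blast
    obtain v where v: "v \<in> carrier R" "u \<otimes> v \<otimes> e = e" using unit[OF u(1)] by blast
    have "e \<odot>\<^bsub>M\<^esub> z = (v \<otimes> e) \<odot>\<^bsub>M\<^esub> (u \<odot>\<^bsub>M\<^esub> z)" if "z \<in> carrier M" for z
    proof -
      have "(v \<otimes> e) \<otimes> u = e" using v u(1) by (metis DiffD1 e_closed m_assoc m_closed m_comm)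
      then show ?thesis using that v u(1) by (metis DiffD1 e_closed m_closed smult_assoc1)
    qed
    then have "e \<odot>\<^bsub>M\<^esub> (t \<odot>\<^bsub>M\<^esub> x) = e \<odot>\<^bsub>M\<^esub> (s \<odot>\<^bsub>M\<^esub> y)" using u(2) x y s t by simp
    then show "(e \<otimes> t) \<odot>\<^bsub>M\<^esub> x = (e \<otimes> s) \<odot>\<^bsub>M\<^esub> y" using x y s t by (simp add: smult_assoc1)
  next
    assume "(e \<otimes> t) \<odot>\<^bsub>M\<^esub> x = (e \<otimes> s) \<odot>\<^bsub>M\<^esub> y"
    then show "\<exists>u\<in>S. u \<odot>\<^bsub>M\<^esub> (t \<odot>\<^bsub>M\<^esub> x) = u \<odot>\<^bsub>M\<^esub> (s \<odot>\<^bsub>M\<^esub> y)"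
      using x y s t by (intro bexI[OF _ e_in_S]) (simp add: smult_assoc1)
  qed
  then show ?thesis unfolding loc_frac_def by auto
qed

lemma unit_cancel:
  assumes s: "s \<in> S" and x: "x \<in> carrier M" and y: "y \<in> carrier M"
    and eq: "(e \<otimes> s) \<odot>\<^bsub>M\<^esub> x = (e \<otimes> s) \<odot>\<^bsub>M\<^esub> y"
  shows "e \<odot>\<^bsub>M\<^esub> x = e \<odot>\<^bsub>M\<^esub> y"
proof -
  obtain v where v: "v \<in> carrier R" "s \<otimes> v \<otimes> e = e" using unit[OF s] by blast
  have "v \<otimes> (e \<otimes> s) = e" using v s by (metis DiffD1 e_closed m_assoc m_closed m_comm)
  then show ?thesis using v s x y eq by (metis DiffD1 e_closed m_closed smult_assoc1)
qed

lemma loc_frac_eq: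
  assumes x: "x \<in> carrier M" and s: "s \<in> S" and y: "y \<in> carrier M" and t: "t \<in> S"
  shows "loc_frac R p M x s = loc_frac R p M y t \<longleftrightarrow> (e \<otimes> t) \<odot>\<^bsub>M\<^esub> x = (e \<otimes> s) \<odot>\<^bsub>M\<^esub> y"
proof
  assume "loc_frac R p M x s = loc_frac R p M y t"
  moreover have "(y, t) \<in> loc_frac R p M y t" using mem_loc_frac[OF y t] y t by simp
  ultimately show "(e \<otimes> t) \<odot>\<^bsub>M\<^esub> x = (e \<otimes> s) \<odot>\<^bsub>M\<^esub> y" using mem_loc_frac[OF x s] by blast
next
  assume eq: "(e \<otimes> t) \<odot>\<^bsub>M\<^esub> x = (e \<otimes> s) \<odot>\<^bsub>M\<^esub> y"
  have "(e \<otimes> w) \<odot>\<^bsub>M\<^esub> x = (e \<otimes> s) \<odot>\<^bsub>M\<^esub> z \<longleftrightarrow> (e \<otimes> w) \<odot>\<^bsub>M\<^esub> y = (e \<otimes> t) \<odot>\<^bsub>M\<^esub> z"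
    if z: "z \<in> carrier M" and w: "w \<in> S" for z w
  proof
    assume 1: "(e \<otimes> w) \<odot>\<^bsub>M\<^esub> x = (e \<otimes> s) \<odot>\<^bsub>M\<^esub> z"
    have "(e \<otimes> s) \<odot>\<^bsub>M\<^esub> (w \<odot>\<^bsub>M\<^esub> y) = w \<odot>\<^bsub>M\<^esub> ((e \<otimes> s) \<odot>\<^bsub>M\<^esub> y)"
      using w s y by (intro smult_left_comm) auto
    also have "\<dots> = t \<odot>\<^bsub>M\<^esub> ((e \<otimes> w) \<odot>\<^bsub>M\<^esub> x)"
      using w t x unfolding eq[symmetric] by (simp add: smult_assoc1[symmetric] m_ac)
    also have "\<dots> = (e \<otimes> s) \<odot>\<^bsub>M\<^esub> (t \<odot>\<^bsub>M\<^esub> z)"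
      unfolding 1 using t s z by (intro smult_left_comm) auto
    finally have "e \<odot>\<^bsub>M\<^esub> (w \<odot>\<^bsub>M\<^esub> y) = e \<odot>\<^bsub>M\<^esub> (t \<odot>\<^bsub>M\<^esub> z)"
      using unit_cancel[OF s] w t y z by simp
    then show "(e \<otimes> w) \<odot>\<^bsub>M\<^esub> y = (e \<otimes> t) \<odot>\<^bsub>M\<^esub> z" using w t y z by (simp add: smult_assoc1)
  next
    assume 1: "(e \<otimes> w) \<odot>\<^bsub>M\<^esub> y = (e \<otimes> t) \<odot>\<^bsub>M\<^esub> z"
    have "(e \<otimes> t) \<odot>\<^bsub>M\<^esub> (w \<odot>\<^bsub>M\<^esub> x) = w \<odot>\<^bsub>M\<^esub> ((e \<otimes> t) \<odot>\<^bsub>M\<^esub> x)"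
      using w t x by (intro smult_left_comm) auto
    also have "\<dots> = s \<odot>\<^bsub>M\<^esub> ((e \<otimes> w) \<odot>\<^bsub>M\<^esub> y)"
      using w s y unfolding eq by (simp add: smult_assoc1[symmetric] m_ac)
    also have "\<dots> = (e \<otimes> t) \<odot>\<^bsub>M\<^esub> (s \<odot>\<^bsub>M\<^esub> z)"
      unfolding 1 using t s z by (intro smult_left_comm) auto
    finally have "e \<odot>\<^bsub>M\<^esub> (w \<odot>\<^bsub>M\<^esub> x) = e \<odot>\<^bsub>M\<^esub> (s \<odot>\<^bsub>M\<^esub> z)"
      using unit_cancel[OF t] w s x z by simp
    then show "(e \<otimes> w) \<odot>\<^bsub>M\<^esub> x = (e \<otimes> s) \<odot>\<^bsub>M\<^esub> z" using w s x z by (simp add: smult_assoc1)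
  qed
  then show "loc_frac R p M x s = loc_frac R p M y t"
    using mem_loc_frac[OF x s] mem_loc_frac[OF y t] by auto
qed

text \<open>The inverse \<open>v\<close> of \<open>s\<close> on \<open>e R\<close> turns
  \<open>x/s\<close> into \<open>(v x)/1\<close>. Hence the localization is a quotient of
  \<open>M\<close>, and its operations need to be known only for denominator
  \<open>\<one>\<close>.\<close>

lemma loc_frac_denom_one:
  assumes x: "x \<in> carrier M" and s: "s \<in> S"
  obtains z where "z \<in> carrier M" "loc_frac R p M x s = loc_frac R p M z \<one>" "e \<odot>\<^bsub>M\<^esub> x = (e \<otimes> s) \<odot>\<^bsub>M\<^esub> z"
proof -
  obtain v where v: "v \<in> carrier R" "s \<otimes> v \<otimes> e = e" using unit[OF s] by blast
  have "(e \<otimes> s) \<otimes> v = e" using v s by (metis DiffD1 e_closed m_assoc m_closed m_comm)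
  then have eq: "e \<odot>\<^bsub>M\<^esub> x = (e \<otimes> s) \<odot>\<^bsub>M\<^esub> (v \<odot>\<^bsub>M\<^esub> x)" using v s x by (metis DiffD1 e_closed m_closed smult_assoc1)
  then have "loc_frac R p M x s = loc_frac R p M (v \<odot>\<^bsub>M\<^esub> x) \<one>"
    using x v s one_in_S by (subst loc_frac_eq) auto
  then show ?thesis using that[of "v \<odot>\<^bsub>M\<^esub> x"] v x eq by simp
qed

lemma mem_loc_frac_one:
  assumes x: "x \<in> carrier M" and "(y, t) \<in> loc_frac R p M x \<one>"
  shows "y \<in> carrier M" "t \<in> S" "e \<odot>\<^bsub>M\<^esub> y = (e \<otimes> t) \<odot>\<^bsub>M\<^esub> x"
  using assms mem_loc_frac[OF x one_in_S, of y t] by auto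

lemma self_loc_frac_one: "x \<in> carrier M \<Longrightarrow> (x, \<one>) \<in> loc_frac R p M x \<one>"
  using mem_loc_frac[OF _ one_in_S] one_in_S by simp

lemma carrier_loc_module: "carrier (loc_module R p M) = (\<lambda>x. loc_frac R p M x \<one>) ` carrier M"
proof
  show "carrier (loc_module R p M) \<subseteq> (\<lambda>x. loc_frac R p M x \<one>) ` carrier M"
    unfolding loc_module_def using loc_frac_denom_one by auto (metis image_eqI)
  show "(\<lambda>x. loc_frac R p M x \<one>) ` carrier M \<subseteq> carrier (loc_module R p M)"
    unfolding loc_module_def using one_in_S by auto
qed

lemma loc_module_add:
  assumes x: "x \<in> carrier M" and y: "y \<in> carrier M"
  shows "loc_frac R p M x \<one> \<oplus>\<^bsub>loc_module R p M\<^esub> loc_frac R p M y \<one> = loc_frac R p M (x \<oplus>\<^bsub>M\<^esub> y) \<one>"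
proof -
  have "loc_frac R p M (t \<odot>\<^bsub>M\<^esub> x' \<oplus>\<^bsub>M\<^esub> s \<odot>\<^bsub>M\<^esub> y') (s \<otimes> t) = loc_frac R p M (x \<oplus>\<^bsub>M\<^esub> y) \<one>"
    if 1: "(x', s) \<in> loc_frac R p M x \<one>" and 2: "(y', t) \<in> loc_frac R p M y \<one>" for x' s y' t
  proof -
    note a = mem_loc_frac_one[OF x 1] and b = mem_loc_frac_one[OF y 2]
    have "e \<odot>\<^bsub>M\<^esub> (t \<odot>\<^bsub>M\<^esub> x' \<oplus>\<^bsub>M\<^esub> s \<odot>\<^bsub>M\<^esub> y') = t \<odot>\<^bsub>M\<^esub> (e \<odot>\<^bsub>M\<^esub> x') \<oplus>\<^bsub>M\<^esub> s \<odot>\<^bsub>M\<^esub> (e \<odot>\<^bsub>M\<^esub> y')"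
      using a(1,2) b(1,2) by (simp add: smult_r_distr smult_left_comm[of e])
    also have "\<dots> = (e \<otimes> (s \<otimes> t)) \<odot>\<^bsub>M\<^esub> (x \<oplus>\<^bsub>M\<^esub> y)"
      unfolding a(3) b(3) using a(2) b(2) x y by (simp add: smult_r_distr smult_assoc1[symmetric] m_ac)
    finally show ?thesis using a(1,2) b(1,2) x y S_mult one_in_S by (subst loc_frac_eq) auto
  qed
  then show ?thesis unfolding loc_module_def using self_loc_frac_one[OF x] self_loc_frac_one[OF y] by force
qed

end

lemma (in prime_factor) regular_prime_module: "prime_module R p e q n (regular_module R)"
  by (intro prime_module.intro prime_factor_axioms module_regular)

context prime_module
begin

interpretation reg: prime_module R p e q n "regular_module R" by (rule regular_prime_module)

lemma loc_module_smult:
  assumes a: "a \<in> carrier R" and x: "x \<in> carrier M"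
  shows "loc_frac R p (regular_module R) a \<one> \<odot>\<^bsub>loc_module R p M\<^esub> loc_frac R p M x \<one> = loc_frac R p M (a \<odot>\<^bsub>M\<^esub> x) \<one>"
proof -
  have "loc_frac R p M (a' \<odot>\<^bsub>M\<^esub> x') (s \<otimes> t) = loc_frac R p M (a \<odot>\<^bsub>M\<^esub> x) \<one>"
    if 1: "(a', s) \<in> loc_frac R p (regular_module R) a \<one>" and 2: "(x', t) \<in> loc_frac R p M x \<one>" for a' s x' t
  proof -
    have a': "a' \<in> carrier R" "s \<in> S" "e \<otimes> a' = e \<otimes> s \<otimes> a" using reg.mem_loc_frac_one[OF _ 1] a by auto
    note b = mem_loc_frac_one[OF x 2]
    have "e \<odot>\<^bsub>M\<^esub> (a' \<odot>\<^bsub>M\<^esub> x') = a' \<odot>\<^bsub>M\<^esub> (e \<odot>\<^bsub>M\<^esub> x')"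
      using a'(1,2) b(1,2) by (simp add: smult_left_comm[of e])
    also have "\<dots> = ((e \<otimes> a') \<otimes> t) \<odot>\<^bsub>M\<^esub> x" 
      unfolding b(3) using a'(1) b(2) x by (simp add: smult_assoc1[symmetric] m_ac)
    also have "\<dots> = (e \<otimes> (s \<otimes> t)) \<odot>\<^bsub>M\<^esub> (a \<odot>\<^bsub>M\<^esub> x)" 
      unfolding a'(3) using a'(2) a b(2) x by (simp add: smult_assoc1[symmetric] m_ac)
    finally show ?thesis using a'(1,2) b(1,2) x a S_mult one_in_S by (subst loc_frac_eq) auto
  qed
  then show ?thesis unfolding loc_module_def 
    using reg.self_loc_frac_one[of a] self_loc_frac_one[OF x] a by force
qed

end

context prime_factor
begin

abbreviation loc_map where "loc_map \<equiv> \<lambda>r. loc_frac R p (regular_module R) r \<one>"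

interpretation reg: prime_module R p e q n "regular_module R" by (rule regular_prime_module)

lemma loc_ring_surj: "ring_surj R (loc_ring R p) loc_map"
proof
  show "loc_map \<in> ring_hom R (loc_ring R p)"
    using reg.loc_module_add reg.loc_module_smult reg.carrier_loc_module
    by (auto simp: ring_hom_def loc_ring_def)
  show "loc_map ` carrier R = carrier (loc_ring R p)"
    using reg.carrier_loc_module by (simp add: loc_ring_def)
  show "loc_map \<zero> = \<zero>\<^bsub>loc_ring R p\<^esub>" by (simp add: loc_ring_def loc_module_def)
qed

lemma loc_map_e: "loc_map e = \<one>\<^bsub>loc_ring R p\<^esub>"
  using reg.loc_frac_eq[of e \<one> \<one> \<one>] reg.one_in_S e_idem by (simp add: loc_ring_def)

lemma loc_ideal_eq: "loc_ideal R p = loc_map ` p"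
proof
  have pc: "p \<subseteq> carrier R" unfolding p_eq cgenideal_def by auto
  show "loc_map ` p \<subseteq> loc_ideal R p" unfolding loc_ideal_def using reg.one_in_S by blast
  show "loc_ideal R p \<subseteq> loc_map ` p"
  proof
    fix X assume "X \<in> loc_ideal R p"
    then obtain a s where a: "a \<in> p" "s \<in> carrier R - p" "X = loc_frac R p (regular_module R) a s"
      unfolding loc_ideal_def by blast
    then obtain v where v: "v \<in> carrier R" "s \<otimes> v \<otimes> e = e" using unit by blast
    have "e \<otimes> a = e \<otimes> s \<otimes> (v \<otimes> a)"
    proof -
      have "e \<otimes> s \<otimes> (v \<otimes> a) = (s \<otimes> v \<otimes> e) \<otimes> a" using a pc v(1) by (simp add: m_ac subset_iff)
      then show ?thesis using v(2) by simp
    qed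
    then have "X = loc_map (v \<otimes> a)"
      using a v pc reg.one_in_S unfolding a(3) by (subst reg.loc_frac_eq) (auto simp: subset_iff)
    moreover have "v \<otimes> a \<in> p" using ideal.I_l_closed[OF primeideal.axioms(1)[OF prime]] a v by blast
    ultimately show "X \<in> loc_map ` p" by blast
  qed
qed

lemma loc_ideal_PIdl: "loc_ideal R p = PIdl\<^bsub>loc_ring R p\<^esub> (loc_map q)"
  using loc_ideal_eq ring_surj.phi_PIdl[OF loc_ring_surj] p_eq by simp

end

context prime_module
begin

lemma loc_presentation:
  "presentation R M e (loc_ring R p) (loc_module R p M) loc_map (\<lambda>x. loc_frac R p M x \<one>)"
proof (intro presentation.intro semilinear_surj.intro loc_ring_surj module_axioms presentation_axioms.intro semilinear_surj_axioms.intro)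
  fix x assume x: "x \<in> carrier M"
  show "loc_frac R p M x \<one> = \<zero>\<^bsub>loc_module R p M\<^esub> \<longleftrightarrow> e \<odot>\<^bsub>M\<^esub> x = \<zero>\<^bsub>M\<^esub>"
    using loc_frac_eq[of x \<one> "\<zero>\<^bsub>M\<^esub>" \<one>] x one_in_S by (simp add: loc_module_def)
qed (use loc_module_add loc_module_smult carrier_loc_module in \<open>simp_all add: loc_module_def\<close>)

end

lemma (in form_module) loc_form_frac:
  assumes "prime_factor R p e q n" and x: "x \<in> carrier M" and y: "y \<in> carrier M"
  shows "loc_form R p N B (loc_frac R p M x \<one>) (loc_frac R p M y \<one>) = loc_frac R p N (B x y) \<one>"
proof -
  interpret prime_factor R p e q n by fact
  interpret m: prime_module R p e q n M by (intro prime_module.intro prime_factor_axioms module_axioms)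
  interpret n: prime_module R p e q n N by (intro prime_module.intro prime_factor_axioms N.module_axioms)
  have "loc_frac R p N (B x' y') (s \<otimes> t) = loc_frac R p N (B x y) \<one>"
    if 1: "(x', s) \<in> loc_frac R p M x \<one>" and 2: "(y', t) \<in> loc_frac R p M y \<one>" for x' s y' t
  proof -
    note a = m.mem_loc_frac_one[OF x 1] and b = m.mem_loc_frac_one[OF y 2]
    \<comment> \<open>Each argument needs its own copy of \<open>e\<close> before its representative
      can be exchanged; idempotency provides the second copy.\<close>
    have "e \<odot>\<^bsub>N\<^esub> B x' y' = B x' (e \<odot>\<^bsub>M\<^esub> (e \<odot>\<^bsub>M\<^esub> y'))" 
      using a(1) b(1) e_idem by (simp add: N.smult_assoc1[symmetric])
    also have "\<dots> = B (e \<odot>\<^bsub>M\<^esub> x') (e \<odot>\<^bsub>M\<^esub> y')" using a(1) b(1) by simp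
    also have "\<dots> = (e \<otimes> s \<otimes> (e \<otimes> t)) \<odot>\<^bsub>N\<^esub> B x y"
      unfolding a(3) b(3) using a(2) b(2) x y by (simp add: N.smult_assoc1[symmetric] R.m_ac)
    also have "e \<otimes> s \<otimes> (e \<otimes> t) = (e \<otimes> e) \<otimes> (s \<otimes> t)" using a(2) b(2) by (simp add: R.m_ac)
    finally show ?thesis using a(1,2) b(1,2) x y m.S_mult m.one_in_S e_idem by (subst n.loc_frac_eq) auto
  qed
  then show ?thesis unfolding loc_form_def using m.self_loc_frac_one[OF x] m.self_loc_frac_one[OF y] by force
qed


section \<open>Presentations of forms\<close>

text \<open>The scalar \<open>c\<close> is the same for \<open>M\<close> and \<open>N\<close>; hence
  the induced form vanishes at \<open>h x\<close>, \<open>h y\<close> exactly when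
  \<open>c B(x, y) = 0\<close>.\<close>

definition form_presentation where
  "form_presentation R M N B c R2 M2 N2 B2 \<phi> h g \<longleftrightarrow>
     form_module R M N B \<and> presentation R M c R2 M2 \<phi> h \<and> presentation R N c R2 N2 \<phi> g \<and>
     (\<forall>x\<in>carrier M. \<forall>y\<in>carrier M. B2 (h x) (h y) = g (B x y))"

lemma form_presentationD:
  assumes "form_presentation R M N B c R2 M2 N2 B2 \<phi> h g"
  shows "form_module R M N B" "presentation R M c R2 M2 \<phi> h" "presentation R N c R2 N2 \<phi> g"
    "\<And>x y. x \<in> carrier M \<Longrightarrow> y \<in> carrier M \<Longrightarrow> B2 (h x) (h y) = g (B x y)"
  using assms unfolding form_presentation_def by auto

lemma form_presentation_image:
  assumes "form_presentation R M N B c R2 M2 N2 B2 \<phi> h g"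
  shows "form_module R2 M2 N2 B2"
proof -
  note p = form_presentationD[OF assms]
  interpret fm: form_module R M N B by (rule p(1))
  interpret pm: presentation R M c R2 M2 \<phi> h by (rule p(2))
  interpret pn: presentation R N c R2 N2 \<phi> g by (rule p(3))
  show ?thesis
  proof (intro form_module.intro form_module_axioms.intro pm.module_codomain pn.module_codomain)
    show "symmetric_bilinear_form R2 M2 N2 B2"
      unfolding symmetric_bilinear_form_def pm.h_surj[symmetric] pm.surj[symmetric]
      using fm.B_sym by (simp add: p(4) flip: pm.h_add pm.h_smult pn.h_add pn.h_smult)
  qed
qed

lemma form_presentation_comp:
  assumes 1: "form_presentation R M N B c R2 M2 N2 B2 \<phi> h g"
    and 2: "form_presentation R2 M2 N2 B2 (\<phi> d) R3 M3 N3 B3 \<phi>' h' g'" and d: "d \<in> carrier R"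
  shows "form_presentation R M N B (c \<otimes>\<^bsub>R\<^esub> d) R3 M3 N3 B3 (\<phi>' \<circ> \<phi>) (h' \<circ> h) (g' \<circ> g)"
proof -
  note p = form_presentationD[OF 1] and p' = form_presentationD[OF 2]
  have "h x \<in> carrier M2" if "x \<in> carrier M" for x 
    using that semilinear_surj.h_closed[OF presentation.axioms(1)[OF p(2)]] by blast
  then show ?thesis unfolding form_presentation_def
    using p(1,4) p'(4) presentation.presentation_comp[OF p(2) p'(2) d] presentation.presentation_comp[OF p(3) p'(3) d]
    by simp
qed

lemma form_presentation_change:
  assumes "form_presentation R M N B c R2 M2 N2 B2 \<phi> h g" and "c' \<in> carrier R"
    and "\<And>x. x \<in> carrier M \<Longrightarrow> c \<odot>\<^bsub>M\<^esub> x = \<zero>\<^bsub>M\<^esub> \<longleftrightarrow> c' \<odot>\<^bsub>M\<^esub> x = \<zero>\<^bsub>M\<^esub>"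
    and "\<And>x. x \<in> carrier N \<Longrightarrow> c \<odot>\<^bsub>N\<^esub> x = \<zero>\<^bsub>N\<^esub> \<longleftrightarrow> c' \<odot>\<^bsub>N\<^esub> x = \<zero>\<^bsub>N\<^esub>"
  shows "form_presentation R M N B c' R2 M2 N2 B2 \<phi> h g"
  using form_presentationD[OF assms(1)] assms(2-) unfolding form_presentation_def
  by (metis presentation.presentation_change)

lemma (in form_module) quot_form_presentation:
  assumes d: "d \<in> carrier R"
  defines "J \<equiv> tors (regular_module R) {d}"
  shows "form_presentation R M N B d (R Quot J) (fact_module_over M (tors M {d}))
    (fact_module_over N (tors N {d})) (quot_form N (tors N {d}) B)
    (a_r_coset R J) (a_r_coset M (tors M {d})) (a_r_coset N (tors N {d}))"
  unfolding form_presentation_def J_def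
  using form_module_axioms fact_module_over_presentation[OF d] N.fact_module_over_presentation[OF d]
    quot_form_cosets[OF d] by blast

lemma (in form_module) loc_form_presentation:
  assumes "prime_factor R p e q n"
  shows "form_presentation R M N B e (loc_ring R p) (loc_module R p M) (loc_module R p N)
    (loc_form R p N B) (\<lambda>r. loc_frac R p (regular_module R) r \<one>)
    (\<lambda>x. loc_frac R p M x \<one>) (\<lambda>x. loc_frac R p N x \<one>)"
proof -
  interpret prime_factor R p e q n by fact
  have "prime_module R p e q n M" "prime_module R p e q n N"
    by (intro prime_module.intro prime_factor_axioms module_axioms N.module_axioms)+
  note pr = this[THEN prime_module.loc_presentation]
  show ?thesis unfolding form_presentation_def
    by (intro conjI ballI form_module_axioms pr loc_form_frac[OF assms])
qed

text \<open>The condition \<open>A(j)\<close> at one prime. The factor in front of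
  \<open>B x x\<close> is the kernel scalar of the target: it expresses that the form with values in
  \<open>N/N[e q^j]\<close> vanishes at the class of \<open>x\<close>.\<close>

definition half_aniso where
  "half_aniso R M N B e q j \<longleftrightarrow> (\<forall>x\<in>carrier M. half_div R M e q (j + 1) x \<longrightarrow>
     (e \<otimes>\<^bsub>R\<^esub> q [^]\<^bsub>R\<^esub> (j::nat)) \<odot>\<^bsub>N\<^esub> B x x = \<zero>\<^bsub>N\<^esub> \<longrightarrow> half_div R M e q j x)"

locale local_form_presentation = local_factor R e q n for R (structure) and e q n +
  fixes M N B j R2 M2 N2 B2 \<phi> h g
  assumes fp: "form_presentation R M N B (e \<otimes> q [^] (j::nat)) R2 M2 N2 B2 \<phi> h g"
    and phi_e: "\<phi> e = \<one>\<^bsub>R2\<^esub>"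
begin

sublocale fm: form_module R M N B using form_presentationD[OF fp] by blast

sublocale lm: local_presentation R e q n M j R2 M2 \<phi> h
proof -
  interpret presentation R M "e \<otimes> q [^] (j::nat)" R2 M2 \<phi> h using form_presentationD[OF fp] by blast
  show "local_presentation R e q n M j R2 M2 \<phi> h" by unfold_locales (rule phi_e)
qed

sublocale ln: local_presentation R e q n N j R2 N2 \<phi> g
proof -
  interpret presentation R N "e \<otimes> q [^] (j::nat)" R2 N2 \<phi> g using form_presentationD[OF fp] by blast
  show "local_presentation R e q n N j R2 N2 \<phi> g" by unfold_locales (rule phi_e)
qed

sublocale fm2: form_module R2 M2 N2 B2 by (rule form_presentation_image[OF fp])

lemma form_eq: "x \<in> carrier M \<Longrightarrow> y \<in> carrier M \<Longrightarrow> B2 (h x) (h y) = g (B x y)"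
  using form_presentationD(4)[OF fp] .

lemma lr_subset_ur_image: "lr R2 M2 \<subseteq> ur R2 M2"
proof
  fix y assume y: "y \<in> lr R2 M2"
  then have "y \<in> carrier M2" using lm.img.lr_submodule lm.img.submoduleE(1) by blast
  then obtain x where "x \<in> carrier M" "y = h x" by (rule lm.h_obtain)
  then show "y \<in> ur R2 M2" using y lm.img_lr_iff[of x] lm.img_ur_iff[of x] lm.half_div_mono[of j x "j + 1"] by simp
qed

lemma anisotropic_odd_iff_half_aniso:
  "anisotropic_on (odd_module R2 M2) N2 (odd_form B2) \<longleftrightarrow> half_aniso R M N B e q j"
proof -
  have "anisotropic_on (odd_module R2 M2) N2 (odd_form B2) \<longleftrightarrow>
    (\<forall>y\<in>carrier M2. y \<in> ur R2 M2 \<longrightarrow> B2 y y = \<zero>\<^bsub>N2\<^esub> \<longrightarrow> y \<in> lr R2 M2)"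
    unfolding fm2.anisotropic_odd_iff[OF lr_subset_ur_image] using lm.img.ur_iff by blast
  also have "\<dots> \<longleftrightarrow> half_aniso R M N B e q j"
    unfolding half_aniso_def lm.h_surj[symmetric] ball_simps
    by (intro ball_cong refl) (simp add: lm.img_ur_iff lm.img_lr_iff form_eq ln.h_ker del: Suc_eq_plus1)
  finally show ?thesis .
qed

text \<open>Dividing by the elements killed by \<open>\<phi> q\<close> multiplies the kernel scalar
  by \<open>q\<close>. This is why the even form for \<open>j\<close> is the odd form for
  \<open>j + 1\<close>.\<close>

lemma local_form_presentation_quot:
  "local_form_presentation R e q n M N B (j + 1) (R2 Quot tors (regular_module R2) {\<phi> q})
     (fact_module_over M2 (tors M2 {\<phi> q})) (fact_module_over N2 (tors N2 {\<phi> q}))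
     (quot_form N2 (tors N2 {\<phi> q}) B2)
     (a_r_coset R2 (tors (regular_module R2) {\<phi> q}) \<circ> \<phi>) (a_r_coset M2 (tors M2 {\<phi> q}) \<circ> h)
     (a_r_coset N2 (tors N2 {\<phi> q}) \<circ> g)"
proof -
  have "e \<otimes> q [^] j \<otimes> q = e \<otimes> q [^] (j + 1)" by (simp add: m_assoc)
  then show ?thesis
    using form_presentation_comp[OF fp fm2.quot_form_presentation[OF lm.phi_closed[OF q_closed]] q_closed]
    by (intro local_form_presentation.intro local_factor_axioms local_form_presentation_axioms.intro)
      (simp_all add: phi_e FactRing_def)
qed

lemma anisotropic_even_iff_half_aniso:
  assumes m: "m = PIdl\<^bsub>R2\<^esub> (\<phi> q)"
  shows "anisotropic_on (even_module R2 m M2) (even_quot m N2) (even_form m N2 B2) \<longleftrightarrow>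
    half_aniso R M N B e q (j + 1)"
proof -
  interpret reg: module R2 "regular_module R2" by (rule lm.img.module_regular)
  have q2: "\<phi> q \<in> carrier R2" by simp
  show ?thesis
    unfolding even_module_def even_ring_def even_quot_def even_form_def m
      lm.img.tors_PIdl[OF q2] ln.img.tors_PIdl[OF q2] reg.tors_PIdl[OF q2]
    by (rule local_form_presentation.anisotropic_odd_iff_half_aniso[OF local_form_presentation_quot])
qed

end

text \<open>The same \<open>e\<close>, \<open>q\<close>, \<open>n\<close> serve a prime of a
  quotient ring and its preimage in \<open>R\<close>, so that conditions over the quotient ring
  speak of the same divisibility in \<open>M\<close>.\<close>

lemma (in prime_factor) prime_factor_image:
  assumes "ring_surj R R2 \<phi>" and p2: "primeideal p2 R2" and p: "p = {a \<in> carrier R. \<phi> a \<in> p2}"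
  shows "prime_factor R2 p2 (\<phi> e) (\<phi> q) n"
proof -
  interpret s: ring_surj R R2 \<phi> by fact
  interpret R2: cring R2 by (rule s.cring_codomain)
  interpret p2: primeideal p2 R2 by (rule p2)
  have im: "p2 = \<phi> ` p"
  proof
    show "p2 \<subseteq> \<phi> ` p"
    proof
      fix x assume x: "x \<in> p2"
      then obtain a where "a \<in> carrier R" "x = \<phi> a" using p2.a_subset s.phi_obtain by blast
      then show "x \<in> \<phi> ` p" unfolding p using x by blast
    qed
  qed (auto simp: p)
  show ?thesis
  proof (intro prime_factor.intro prime_factor_axioms.intro p2 R2.is_cring)
    show "p2 = PIdl\<^bsub>R2\<^esub> (\<phi> q)" unfolding im p_eq by (rule s.phi_PIdl[OF q_closed])
    show "\<phi> e \<otimes>\<^bsub>R2\<^esub> \<phi> e = \<phi> e" using arg_cong[OF e_idem, of \<phi>] by simp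
    show "\<phi> e \<otimes>\<^bsub>R2\<^esub> \<phi> q [^]\<^bsub>R2\<^esub> n = \<zero>\<^bsub>R2\<^esub>" using arg_cong[OF e_pow_n, of \<phi>] by simp
    show "\<phi> e \<notin> p2" using e_notin unfolding p by simp
    fix u assume u: "u \<in> carrier R2 - p2"
    then obtain u' where u': "u' \<in> carrier R" "u = \<phi> u'" using s.phi_obtain by blast
    then obtain v where v: "v \<in> carrier R" "u' \<otimes> v \<otimes> e = e" using unit[of u'] u p by auto
    have "u \<otimes>\<^bsub>R2\<^esub> \<phi> v \<otimes>\<^bsub>R2\<^esub> \<phi> e = \<phi> (u' \<otimes> v \<otimes> e)" using u' v(1) by simp
    then show "\<exists>v\<in>carrier R2. u \<otimes>\<^bsub>R2\<^esub> v \<otimes>\<^bsub>R2\<^esub> \<phi> e = \<phi> e" using v by auto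
  qed auto
qed


section \<open>The spaces \<open>\<rho>\<^sub>i\<close>\<close>

lemma (in cring) ideal_prod_PIdl:
  assumes "a \<in> carrier R" "b \<in> carrier R"
  shows "ideal_prod R (PIdl a) (PIdl b) = PIdl (a \<otimes> b)"
proof -
  have "ideal_prod R (PIdl a) (PIdl b) = Idl (PIdl (a \<otimes> b))"
    using ideal_prod_eq_genideal[of "Idl { a }" "Idl { b }"]
      assms cgenideal_eq_genideal cgenideal_ideal cgenideal_prod by auto
  then show ?thesis
    by (simp add: assms Idl_subset_ideal cgenideal_ideal cgenideal_minimal genideal_self oneideal subset_antisym)
qed

lemma (in cring) ideals_pow_PIdl:
  assumes "a \<in> carrier R"
  shows "PIdl a [^]\<^bsub>ideals_set R\<^esub> (k::nat) = PIdl (a [^] k)"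
proof -
  interpret I: semiring "ideals_set R" by (rule ideals_set_is_semiring)
  show ?thesis
  proof (induction k)
    case 0
    have "carrier R = PIdl \<one>" using cgenideal_self[OF one_closed] cgenideal_ideal[OF one_closed]
      by (metis ideal.one_imp_carrier)
    then show ?case by (simp add: ideals_set_def)
  next
    case (Suc k)
    have "PIdl a [^]\<^bsub>ideals_set R\<^esub> Suc k = ideal_prod R (PIdl a [^]\<^bsub>ideals_set R\<^esub> k) (PIdl a)"
      unfolding nat_pow_def ideals_set_def by simp
    then show ?case using assms Suc by (simp add: ideal_prod_PIdl)
  qed
qed

lemma (in module) ideal_smult_PIdl:
  assumes a: "a \<in> carrier R" and H: "submodule H R M"
  shows "ideal_smult R M (PIdl a) H = (\<odot>\<^bsub>M\<^esub>) a ` H"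
proof -
  note HM = submoduleE(1)[OF H]
  have "ideal_smult R M (PIdl a) H = submodule_gen R M ((\<odot>\<^bsub>M\<^esub>) a ` H)"
  proof -
    have "{b \<odot>\<^bsub>M\<^esub> x |b x. b \<in> PIdl a \<and> x \<in> H} = (\<odot>\<^bsub>M\<^esub>) a ` H"
    proof (rule equalityI; rule subsetI)
      fix y assume "y \<in> {b \<odot>\<^bsub>M\<^esub> x |b x. b \<in> PIdl a \<and> x \<in> H}"
      then obtain c x where c: "c \<in> carrier R" "x \<in> H" "y = (c \<otimes> a) \<odot>\<^bsub>M\<^esub> x"
        unfolding cgenideal_def by blast
      then have "y = a \<odot>\<^bsub>M\<^esub> (c \<odot>\<^bsub>M\<^esub> x)" using a HM by (metis R.m_comm smult_assoc1 subsetD)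
      then show "y \<in> (\<odot>\<^bsub>M\<^esub>) a ` H" using submoduleE(4)[OF H c(1,2)] by blast
    next
      fix y assume "y \<in> (\<odot>\<^bsub>M\<^esub>) a ` H"
      then show "y \<in> {b \<odot>\<^bsub>M\<^esub> x |b x. b \<in> PIdl a \<and> x \<in> H}" using R.cgenideal_self[OF a] by blast
    qed
    then show ?thesis unfolding ideal_smult_def by simp
  qed
  then show ?thesis using submodule_gen_self[OF scalar_image_submodule[OF H a]] by simp
qed

lemma set_addI: "h \<in> H \<Longrightarrow> k \<in> K \<Longrightarrow> h \<oplus>\<^bsub>G\<^esub> k \<in> H <+>\<^bsub>G\<^esub> K"
  unfolding set_add_def' by blast

lemma (in module) set_add_submodule:
  assumes "submodule H R M" "submodule K R M"
  shows "submodule (H <+>\<^bsub>M\<^esub> K) R M"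
proof (rule submoduleI)
  note H = submoduleE[OF assms(1)] submodule_zero_closed[OF assms(1)]
  note K = submoduleE[OF assms(2)] submodule_zero_closed[OF assms(2)]
  show "H <+>\<^bsub>M\<^esub> K \<subseteq> carrier M" using H(1) K(1) M.setadd_subset_G by blast
  show "\<zero>\<^bsub>M\<^esub> \<in> H <+>\<^bsub>M\<^esub> K" using H(7) K(7) unfolding set_add_def' by force
  fix x assume "x \<in> H <+>\<^bsub>M\<^esub> K"
  then obtain h k where hk: "h \<in> H" "k \<in> K" "x = h \<oplus>\<^bsub>M\<^esub> k" unfolding set_add_def' by blast
  have c: "h \<in> carrier M" "k \<in> carrier M" using hk H(1) K(1) by blast+
  have "\<ominus>\<^bsub>M\<^esub> x = \<ominus>\<^bsub>M\<^esub> h \<oplus>\<^bsub>M\<^esub> \<ominus>\<^bsub>M\<^esub> k" using c hk by (simp add: M.minus_add)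
  then show "\<ominus>\<^bsub>M\<^esub> x \<in> H <+>\<^bsub>M\<^esub> K" using set_addI[OF H(3)[OF hk(1)] K(3)[OF hk(2)]] by simp
  show "a \<odot>\<^bsub>M\<^esub> x \<in> H <+>\<^bsub>M\<^esub> K" if a: "a \<in> carrier R" for a
  proof -
    have "a \<odot>\<^bsub>M\<^esub> x = a \<odot>\<^bsub>M\<^esub> h \<oplus>\<^bsub>M\<^esub> a \<odot>\<^bsub>M\<^esub> k" using c hk a by (simp add: smult_r_distr)
    then show ?thesis using set_addI[OF H(4)[OF a hk(1)] K(4)[OF a hk(2)]] by simp
  qed
  fix y assume "y \<in> H <+>\<^bsub>M\<^esub> K"
  then obtain h' k' where hk': "h' \<in> H" "k' \<in> K" "y = h' \<oplus>\<^bsub>M\<^esub> k'" unfolding set_add_def' by blast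
  have c': "h' \<in> carrier M" "k' \<in> carrier M" using hk' H(1) K(1) by blast+
  have "x \<oplus>\<^bsub>M\<^esub> y = (h \<oplus>\<^bsub>M\<^esub> h') \<oplus>\<^bsub>M\<^esub> (k \<oplus>\<^bsub>M\<^esub> k')" using c c' hk hk' by (simp add: M.a_ac)
  then show "x \<oplus>\<^bsub>M\<^esub> y \<in> H <+>\<^bsub>M\<^esub> K"
    using set_addI[OF H(5)[OF hk(1) hk'(1)] K(5)[OF hk(2) hk'(2)]] by simp
qed

lemma (in module) finsum_submodule:
  assumes H: "submodule H R M" and "finite T" "\<And>i. i \<in> T \<Longrightarrow> x i \<in> H"
  shows "(\<Oplus>\<^bsub>M\<^esub>i\<in>T. x i) \<in> H"
  using assms(2,3)
proof (induction T)
  case empty then show ?case using submodule_zero_closed[OF H] by simp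
next
  case (insert i T)
  then have "x i \<in> carrier M" "x \<in> T \<rightarrow> carrier M" using submoduleE(1)[OF H] by auto
  then show ?case using insert submoduleE(5)[OF H] by (simp add: M.finsum_insert)
qed

lemma (in module) finsum_minus_submodule:
  assumes H: "submodule H R M" and "finite T" "x \<in> T \<rightarrow> carrier M" "y \<in> T \<rightarrow> carrier M"
    "\<And>i. i \<in> T \<Longrightarrow> x i \<ominus>\<^bsub>M\<^esub> y i \<in> H"
  shows "(\<Oplus>\<^bsub>M\<^esub>i\<in>T. x i) \<ominus>\<^bsub>M\<^esub> (\<Oplus>\<^bsub>M\<^esub>i\<in>T. y i) \<in> H"
  using assms(2-)
proof (induction T)
  case empty 
  have "\<zero>\<^bsub>M\<^esub> \<ominus>\<^bsub>M\<^esub> \<zero>\<^bsub>M\<^esub> \<in> H" by (intro submodule_minus_closed[OF H] submodule_zero_closed[OF H])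
  then show ?case by simp
next
  case (insert i T)
  then have *: "x i \<in> carrier M" "x \<in> T \<rightarrow> carrier M" "y i \<in> carrier M" "y \<in> T \<rightarrow> carrier M" by auto
  then have "(\<Oplus>\<^bsub>M\<^esub>i\<in>T. x i) \<ominus>\<^bsub>M\<^esub> (\<Oplus>\<^bsub>M\<^esub>i\<in>T. y i) \<in> H" using insert by auto
  then have "(x i \<ominus>\<^bsub>M\<^esub> y i) \<oplus>\<^bsub>M\<^esub> ((\<Oplus>\<^bsub>M\<^esub>i\<in>T. x i) \<ominus>\<^bsub>M\<^esub> (\<Oplus>\<^bsub>M\<^esub>i\<in>T. y i)) \<in> H"
    using insert.prems submoduleE(5)[OF H] by auto
  then show ?case using insert * by (simp add: M.finsum_insert minus_add_swap)
qed

section \<open>Splitting \<open>ur/lr\<close> into the \<open>\<rho>_i\<close> when the maximal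
  ideal is \<open>(q)\<close> with \<open>q\<close> nilpotent\<close>

locale chain_module = local_module R "\<one>\<^bsub>R\<^esub>" q n M for R (structure) and q n and M (structure)
begin

declare nat_pow_Suc [simp del]

definition num where "num k = (\<odot>\<^bsub>M\<^esub>) (q [^] (k::nat)) ` tors M {q [^] (2 * k + 1)}"

definition den where "den k = (\<odot>\<^bsub>M\<^esub>) (q [^] (k::nat)) ` tors M {q [^] (2 * k)} <+>\<^bsub>M\<^esub>
  (\<odot>\<^bsub>M\<^esub>) (q [^] (k + 1)) ` tors M {q [^] (2 * k + 2)}"

lemma rho_odd_eq: "rho_odd R (PIdl q) M (2 * k + 1) = fact_module (M\<lparr>carrier := num k\<rparr>) (den k)"
proof -
  have t: "tors M (PIdl (q [^] (i::nat))) = tors M {q [^] i}" for i by (intro tors_PIdl) simp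
  have i: "ideal_smult R M (PIdl (q [^] (k::nat))) (tors M {q [^] (i::nat)}) = (\<odot>\<^bsub>M\<^esub>) (q [^] k) ` tors M {q [^] i}" for k i
    by (intro ideal_smult_PIdl tors_submodule) auto
  have "(2 * k + 1) div 2 = k" "2 * k + 1 - 1 = 2 * k" "2 * k + 1 + 1 = 2 * k + 2" by simp_all
  then show ?thesis
    unfolding rho_odd_def Let_def ideals_pow_PIdl[OF q_closed] num_def den_def t i by (simp only:)
qed

lemma tors_pow_submodule: "submodule (tors M {q [^] (i::nat)}) R M"
  by (intro tors_submodule) simp

lemma num_submodule: "submodule (num k) R M"
  unfolding num_def by (intro scalar_image_submodule tors_pow_submodule) simp

lemma den_submodule: "submodule (den k) R M"
  unfolding den_def by (intro scalar_image_submodule set_add_submodule tors_pow_submodule nat_pow_closed q_closed)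

lemma pow_smult: "x \<in> carrier M \<Longrightarrow> q [^] (i::nat) \<odot>\<^bsub>M\<^esub> (q [^] (j::nat) \<odot>\<^bsub>M\<^esub> x) = q [^] (i + j) \<odot>\<^bsub>M\<^esub> x"
  by (simp add: smult_assoc1[symmetric] nat_pow_mult)

lemma pow_smult_zero:
  assumes "x \<in> carrier M" "q [^] (i::nat) \<odot>\<^bsub>M\<^esub> x = \<zero>\<^bsub>M\<^esub>" "i \<le> j"
  shows "q [^] (j::nat) \<odot>\<^bsub>M\<^esub> x = \<zero>\<^bsub>M\<^esub>"
  using pow_smult[OF assms(1), of "j - i" i] assms by simp

text \<open>The two summands consist of multiples by \<open>r = q^k\<close> and by
  \<open>r = q^{k+1}\<close> of elements that the square of \<open>r\<close> kills, hence of
  generators of \<open>lr\<close>.\<close>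

lemma den_subset_lr: "den k \<subseteq> lr R M"
proof -
  have "q [^] i \<odot>\<^bsub>M\<^esub> y \<in> lr R M" if "y \<in> carrier M" "q [^] (2 * i) \<odot>\<^bsub>M\<^esub> y = \<zero>\<^bsub>M\<^esub>" for y and i :: nat
    using that pow_smult[of y i i] by (intro lr_memI) (simp_all add: mult_2)
  note * = this
  show ?thesis
  proof
    fix x assume "x \<in> den k"
    then obtain y z where y: "y \<in> carrier M" "q [^] (2 * k) \<odot>\<^bsub>M\<^esub> y = \<zero>\<^bsub>M\<^esub>"
      and z: "z \<in> carrier M" "q [^] (2 * k + 2) \<odot>\<^bsub>M\<^esub> z = \<zero>\<^bsub>M\<^esub>"
      and x: "x = q [^] k \<odot>\<^bsub>M\<^esub> y \<oplus>\<^bsub>M\<^esub> q [^] (k + 1) \<odot>\<^bsub>M\<^esub> z"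
      unfolding den_def set_add_def' tors_def by blast
    have "2 * (k + 1) = 2 * k + 2" by simp
    then have "q [^] (k + 1) \<odot>\<^bsub>M\<^esub> z \<in> lr R M" using *[OF z(1), of "k + 1"] z(2) by metis
    then show "x \<in> lr R M" unfolding x by (rule submoduleE(5)[OF lr_submodule *[OF y]])
  qed
qed

text \<open>For \<open>x = q^k y\<close> with \<open>q^{2k+1} y = 0\<close>: if
  \<open>i \<le> k\<close>, then \<open>q^i x = q^{2i} (q^{k-i} y)\<close>; if \<open>i > k\<close>,
  then \<open>i + k \<ge> 2 k + 1\<close> and \<open>q^i x = 0\<close>.\<close>

lemma num_half_div: "x \<in> num k \<Longrightarrow> P 1 x"
proof -
  assume "x \<in> num k"
  then obtain y where y: "y \<in> carrier M" "q [^] (2 * k + 1) \<odot>\<^bsub>M\<^esub> y = \<zero>\<^bsub>M\<^esub>" and x: "x = q [^] k \<odot>\<^bsub>M\<^esub> y"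
    unfolding num_def tors_def by auto
  have "\<exists>z\<in>carrier M. q [^] i \<odot>\<^bsub>M\<^esub> x = q [^] (2 * i) \<odot>\<^bsub>M\<^esub> z" for i :: nat
  proof (cases "i \<le> k")
    case True
    then show ?thesis unfolding x using y pow_smult[of y "2 * i" "k - i"]
      by (intro bexI[of _ "q [^] (k - i) \<odot>\<^bsub>M\<^esub> y"]) (simp_all add: pow_smult)
  next
    case False
    then show ?thesis unfolding x using y pow_smult_zero[OF y, of "i + k"]
      by (intro bexI[of _ "\<zero>\<^bsub>M\<^esub>"]) (simp_all add: pow_smult)
  qed
  then show "P 1 x" unfolding half_div_def by simp
qed

text \<open>The condition of index \<open>m + 1\<close> on \<open>q^m z\<close> gives
  \<open>q^{2m+1} z = q^{2m+2} y\<close>, so \<open>q^m (z - q y)\<close> lies in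
  \<open>num m\<close> and \<open>q^{m+1} y\<close> is the new remainder. Starting from a multiple
  of \<open>q^c\<close> only components with \<open>k \<ge> c\<close> occur; \<open>c = 1\<close> is
  what avoids \<open>\<rho>_1\<close>.\<close>

lemma half_div_decompose:
  assumes x: "x \<in> carrier M" "P 1 x" and w: "w \<in> carrier M" "x = q [^] (c::nat) \<odot>\<^bsub>M\<^esub> w" and m: "m \<ge> c"
  shows "\<exists>f z. (\<forall>k. f k \<in> num k) \<and> z \<in> carrier M \<and> P 1 (q [^] m \<odot>\<^bsub>M\<^esub> z) \<and>
    x = (\<Oplus>\<^bsub>M\<^esub>k\<in>{c..<m}. f k) \<oplus>\<^bsub>M\<^esub> q [^] m \<odot>\<^bsub>M\<^esub> z"
  using m
proof (induction m rule: dec_induct)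
  case base
  have "\<zero>\<^bsub>M\<^esub> \<in> num k" for k using submodule_zero_closed[OF num_submodule] .
  then show ?case using x w by (intro exI[of _ "\<lambda>_. \<zero>\<^bsub>M\<^esub>"] exI[of _ w]) simp
next
  case (step m)
  then obtain f z where f: "\<And>k. f k \<in> num k" and z: "z \<in> carrier M" "P 1 (q [^] m \<odot>\<^bsub>M\<^esub> z)"
    and x: "x = (\<Oplus>\<^bsub>M\<^esub>k\<in>{c..<m}. f k) \<oplus>\<^bsub>M\<^esub> q [^] m \<odot>\<^bsub>M\<^esub> z" by blast
  have fM: "f k \<in> carrier M" for k using f submoduleE(1)[OF num_submodule] by blast
  obtain y where y: "y \<in> carrier M" "q [^] (m + 1) \<odot>\<^bsub>M\<^esub> (q [^] m \<odot>\<^bsub>M\<^esub> z) = q [^] (2 * (m + 1)) \<odot>\<^bsub>M\<^esub> y"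
    using z(2)[unfolded half_div_def, rule_format, of "m + 1"] by (auto simp del: nat_pow_Suc)
  let ?f = "f(m := q [^] m \<odot>\<^bsub>M\<^esub> (z \<ominus>\<^bsub>M\<^esub> q \<odot>\<^bsub>M\<^esub> y))"
  have q1: "q [^] i \<odot>\<^bsub>M\<^esub> (q \<odot>\<^bsub>M\<^esub> y) = q [^] (i + 1) \<odot>\<^bsub>M\<^esub> y" for i :: nat 
    using pow_smult[OF y(1), of i 1] by simp
  have fm: "?f m = q [^] m \<odot>\<^bsub>M\<^esub> z \<ominus>\<^bsub>M\<^esub> q [^] Suc m \<odot>\<^bsub>M\<^esub> y"
    using y(1) z(1) q1[of m] by (simp add: smult_minus del: nat_pow_Suc)
  have num: "?f m \<in> num m"
  proof -
    have "q [^] (2 * m + 1) \<odot>\<^bsub>M\<^esub> (z \<ominus>\<^bsub>M\<^esub> q \<odot>\<^bsub>M\<^esub> y) = q [^] (2 * m + 1) \<odot>\<^bsub>M\<^esub> z \<ominus>\<^bsub>M\<^esub> q [^] (2 * m + 1 + 1) \<odot>\<^bsub>M\<^esub> y"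
      using y(1) z(1) q1[of "2 * m + 1"] by (simp add: smult_minus del: nat_pow_Suc)
    also have "q [^] (2 * m + 1) \<odot>\<^bsub>M\<^esub> z = q [^] (2 * m + 1 + 1) \<odot>\<^bsub>M\<^esub> y"
      using y(2) z(1) pow_smult[OF z(1), of "m + 1" m] by (simp add: mult_2 del: nat_pow_Suc)
    finally show ?thesis using y z unfolding num_def tors_def by (auto simp del: nat_pow_Suc)
  qed
  have "P 1 (q [^] Suc m \<odot>\<^bsub>M\<^esub> y)"
  proof -
    have "q [^] m \<odot>\<^bsub>M\<^esub> z \<ominus>\<^bsub>M\<^esub> q [^] Suc m \<odot>\<^bsub>M\<^esub> y \<in> {x \<in> carrier M. P 1 x}"
      using num_half_div[OF num] y z unfolding fm by (simp del: nat_pow_Suc)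
    moreover have "q [^] m \<odot>\<^bsub>M\<^esub> z \<in> {x \<in> carrier M. P 1 x}" using z by simp
    ultimately have "q [^] Suc m \<odot>\<^bsub>M\<^esub> y \<in> {x \<in> carrier M. P 1 x}"
      by (rule submodule_add_cancel'[OF half_div_submodule]) (use y in \<open>simp del: nat_pow_Suc\<close>)
    then show ?thesis by simp
  qed
  moreover have "x = (\<Oplus>\<^bsub>M\<^esub>k\<in>{c..<Suc m}. ?f k) \<oplus>\<^bsub>M\<^esub> q [^] Suc m \<odot>\<^bsub>M\<^esub> y"
  proof -
    have "(\<Oplus>\<^bsub>M\<^esub>k\<in>{c..<Suc m}. ?f k) = ?f m \<oplus>\<^bsub>M\<^esub> (\<Oplus>\<^bsub>M\<^esub>k\<in>{c..<m}. ?f k)"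
    proof -
      have i: "{c..<Suc m} = insert m {c..<m}" using step(1) by auto
      have "?f m \<in> carrier M" using num submoduleE(1)[OF num_submodule] by blast
      then show ?thesis unfolding i using fM by (intro M.finsum_insert) auto
    qed
    also have "(\<Oplus>\<^bsub>M\<^esub>k\<in>{c..<m}. ?f k) = (\<Oplus>\<^bsub>M\<^esub>k\<in>{c..<m}. f k)"
      using fM by (intro M.finsum_cong') auto
    finally show ?thesis
      unfolding x fm using y z fM M.finsum_closed[of f "{c..<m}"]
      by (simp add: a_minus_def M.a_ac M.r_neg M.r_neg1 M.r_neg2 M.l_neg del: nat_pow_Suc)
  qed
  moreover have "\<forall>k. ?f k \<in> num k" using f num by auto
  ultimately show ?case using y(1) by blast
qed

lemma half_div_decompose_finsum:
  assumes x: "x \<in> carrier M" "P 1 x" and w: "w \<in> carrier M" "x = q [^] (c::nat) \<odot>\<^bsub>M\<^esub> w"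
  obtains f where "\<And>k. f k \<in> num k" "x = (\<Oplus>\<^bsub>M\<^esub>k\<in>{c..<c + n}. f k)"
proof -
  obtain f z where f: "\<And>k. f k \<in> num k" "z \<in> carrier M"
    "x = (\<Oplus>\<^bsub>M\<^esub>k\<in>{c..<c + n}. f k) \<oplus>\<^bsub>M\<^esub> q [^] (c + n) \<odot>\<^bsub>M\<^esub> z"
    using half_div_decompose[OF x w, of "c + n"] by auto
  have "q [^] (c + n) = \<zero>" using e_pow_ge[of "c + n"] by simp
  moreover have "f k \<in> carrier M" for k using f submoduleE(1)[OF num_submodule] by blast
  ultimately have "x = (\<Oplus>\<^bsub>M\<^esub>k\<in>{c..<c + n}. f k)" using f(2,3) M.finsum_closed[of f "{c..<c + n}"] by simp
  then show ?thesis using that f(1) by blast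
qed

text \<open>To isolate the component of index \<open>k = \<kappa> i\<close>, test with the submodule
  of all \<open>x\<close> such that \<open>q^k x \<in> q^{2k+1} M\<close>. It contains
  \<open>lr\<close> and every other component, hence also \<open>y i\<close>, and an element of
  \<open>num k\<close> that passes the test lies in \<open>den k\<close>. This is the injectivity of
  the natural map.\<close>

lemma sum_in_lr_imp_den:
  assumes T: "finite T" "i \<in> T" and inj: "inj_on \<kappa> T"
    and y: "\<And>i. i \<in> T \<Longrightarrow> y i \<in> num (\<kappa> i)" and lr: "(\<Oplus>\<^bsub>M\<^esub>i\<in>T. y i) \<in> lr R M"
  shows "y i \<in> den (\<kappa> i)"
proof -
  let ?k = "\<kappa> i" and ?s = "\<Oplus>\<^bsub>M\<^esub>j\<in>T - {i}. y j"
  have yM: "y j \<in> carrier M" if "j \<in> T" for j using y[OF that] submoduleE(1)[OF num_submodule] by blast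
  have sM: "?s \<in> carrier M" using yM by (intro M.finsum_closed) auto
  have sum: "(\<Oplus>\<^bsub>M\<^esub>i\<in>T. y i) = y i \<oplus>\<^bsub>M\<^esub> ?s"
  proof -
    have "T = insert i (T - {i})" using T by blast
    then have "(\<Oplus>\<^bsub>M\<^esub>i\<in>T. y i) = (\<Oplus>\<^bsub>M\<^esub>i\<in>insert i (T - {i}). y i)" by simp
    also have "\<dots> = y i \<oplus>\<^bsub>M\<^esub> ?s" using T yM by (intro M.finsum_insert) auto
    finally show ?thesis .
  qed
  have sub: "submodule {x \<in> carrier M. q [^] ?k \<odot>\<^bsub>M\<^esub> x \<in> (\<odot>\<^bsub>M\<^esub>) (q [^] (2 * ?k + 1)) ` carrier M} R M" (is "submodule ?H R M")
  proof (rule submoduleI)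
    note I = scalar_image_submodule[OF carrier_is_submodule, of "q [^] (2 * ?k + 1)"]
    note E = submoduleE[OF I, OF nat_pow_closed[OF q_closed]] submodule_zero_closed[OF I, OF nat_pow_closed[OF q_closed]]
    show "\<zero>\<^bsub>M\<^esub> \<in> ?H" using E(7) by simp
    fix x assume x: "x \<in> ?H"
    show "\<ominus>\<^bsub>M\<^esub> x \<in> ?H" using x E(3) by (simp add: smult_r_minus del: nat_pow_Suc)
    show "a \<odot>\<^bsub>M\<^esub> x \<in> ?H" if "a \<in> carrier R" for a
      using x E(4) that smult_left_comm[of "q [^] ?k" a x] by (simp del: nat_pow_Suc)
    show "x \<oplus>\<^bsub>M\<^esub> x' \<in> ?H" if "x' \<in> ?H" for x'
      using x E(5) that by (simp add: smult_r_distr del: nat_pow_Suc)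
  qed auto
  have "(\<Oplus>\<^bsub>M\<^esub>i\<in>T. y i) \<in> ?H"
  proof -
    have "(\<Oplus>\<^bsub>M\<^esub>i\<in>T. y i) \<in> carrier M" using lr submoduleE(1)[OF lr_submodule] by blast
    then show ?thesis using lr_imp_half_div[OF lr, unfolded half_div_def, rule_format, of ?k] by auto
  qed
  moreover have "?s \<in> ?H"
  proof (rule finsum_submodule[OF sub])
    fix j assume j: "j \<in> T - {i}"
    then have ne: "\<kappa> j \<noteq> ?k" using inj T by (auto dest: inj_onD)
    obtain z where z: "z \<in> carrier M" "q [^] (2 * \<kappa> j + 1) \<odot>\<^bsub>M\<^esub> z = \<zero>\<^bsub>M\<^esub>" "y j = q [^] \<kappa> j \<odot>\<^bsub>M\<^esub> z"
      using y[of j] j unfolding num_def tors_def by auto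
    have "q [^] ?k \<odot>\<^bsub>M\<^esub> y j = q [^] (?k + \<kappa> j) \<odot>\<^bsub>M\<^esub> z" unfolding z(3) using z(1) by (rule pow_smult)
    also have "\<dots> \<in> (\<odot>\<^bsub>M\<^esub>) (q [^] (2 * ?k + 1)) ` carrier M"
    \<comment> \<open>A smaller index \<open>\<kappa> j\<close> makes \<open>?k + \<kappa> j\<close>
      at least \<open>2 * \<kappa> j + 1\<close>, which kills \<open>z\<close>; a larger one makes
      it at least \<open>2 * ?k + 1\<close>.\<close>
    proof (cases "\<kappa> j < ?k")
      case True
      then show ?thesis using pow_smult_zero[OF z(1,2), of "?k + \<kappa> j"]
        by (intro image_eqI[of _ _ "\<zero>\<^bsub>M\<^esub>"]) auto
    next
      case False
      then have "2 * ?k + 1 + (\<kappa> j - ?k - 1) = ?k + \<kappa> j" using ne by linarith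
      then show ?thesis using pow_smult[OF z(1), of "2 * ?k + 1" "\<kappa> j - ?k - 1"] z(1)
        by (intro image_eqI[of _ _ "q [^] (\<kappa> j - ?k - 1) \<odot>\<^bsub>M\<^esub> z"]) auto
    qed
    finally show "y j \<in> ?H" using yM j by simp
  qed (use T in auto)
  ultimately have "y i \<in> ?H"
  proof -
    assume a: "(\<Oplus>\<^bsub>M\<^esub>i\<in>T. y i) \<in> ?H" "?s \<in> ?H"
    have "(\<Oplus>\<^bsub>M\<^esub>i\<in>T. y i) \<ominus>\<^bsub>M\<^esub> ?s \<in> ?H" by (rule submodule_minus_closed[OF sub a])
    moreover have "(\<Oplus>\<^bsub>M\<^esub>i\<in>T. y i) \<ominus>\<^bsub>M\<^esub> ?s = y i"
      unfolding sum using yM[OF T(2)] sM by (simp add: a_minus_def M.a_assoc M.r_neg)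
    ultimately show "y i \<in> ?H" by metis
  qed
  then obtain w where w: "w \<in> carrier M" "q [^] ?k \<odot>\<^bsub>M\<^esub> y i = q [^] (2 * ?k + 1) \<odot>\<^bsub>M\<^esub> w" by blast
  obtain z where z: "z \<in> carrier M" "q [^] (2 * ?k + 1) \<odot>\<^bsub>M\<^esub> z = \<zero>\<^bsub>M\<^esub>" "y i = q [^] ?k \<odot>\<^bsub>M\<^esub> z"
    using y[OF T(2)] unfolding num_def tors_def by auto
  have q1: "q [^] l \<odot>\<^bsub>M\<^esub> (q \<odot>\<^bsub>M\<^esub> w) = q [^] (l + 1) \<odot>\<^bsub>M\<^esub> w" for l :: nat
    using pow_smult[OF w(1), of l 1] by simp
  have kz: "q [^] (2 * ?k) \<odot>\<^bsub>M\<^esub> z = q [^] (2 * ?k + 1) \<odot>\<^bsub>M\<^esub> w"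
    using w(2) unfolding z(3) using pow_smult[OF z(1), of ?k ?k] by (simp add: mult_2)
  have "z \<ominus>\<^bsub>M\<^esub> q \<odot>\<^bsub>M\<^esub> w \<in> tors M {q [^] (2 * ?k)}"
    using z(1) w(1) kz q1[of "2 * ?k"] by (simp add: tors_def smult_minus del: nat_pow_Suc)
  \<comment> \<open>\<open>q^{2k+2} w = q (q^{2k+1} w) = q (q^{2k} z)\<close>, and \<open>z\<close>
    is killed by \<open>q^{2k+1}\<close>.\<close>
  moreover have "w \<in> tors M {q [^] (2 * ?k + 2)}"
  proof -
    have "q [^] (2 * ?k + 2) \<odot>\<^bsub>M\<^esub> w = q [^] (1::nat) \<odot>\<^bsub>M\<^esub> (q [^] (2 * ?k) \<odot>\<^bsub>M\<^esub> z)"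
      unfolding kz using pow_smult[OF w(1), of 1 "2 * ?k + 1"] by (simp add: eval_nat_numeral)
    also have "\<dots> = \<zero>\<^bsub>M\<^esub>" using pow_smult[OF z(1), of 1 "2 * ?k"] z(2) by simp
    finally show ?thesis using w(1) by (simp add: tors_def)
  qed
  moreover have "y i = q [^] ?k \<odot>\<^bsub>M\<^esub> (z \<ominus>\<^bsub>M\<^esub> q \<odot>\<^bsub>M\<^esub> w) \<oplus>\<^bsub>M\<^esub> q [^] (?k + 1) \<odot>\<^bsub>M\<^esub> w"
    unfolding z(3) q1[of ?k, symmetric] using z(1) w(1)
    by (simp add: smult_minus) (simp add: a_minus_def M.a_assoc M.l_neg)
  ultimately show ?thesis unfolding den_def set_add_def' by blast
qed

end

text \<open>Representatives may be summed over any finite \<open>T\<close> that contains the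
  support: outside the support the class is zero, so \<open>y i \<in> D i \<subseteq> L\<close>.
  Another choice of representatives changes the sum by an element of \<open>L\<close>.\<close>

lemma (in module) natural_map_eq:
  assumes L: "submodule L R M" and T: "finite T" "T \<subseteq> I"
    and v: "\<And>i. i \<in> T \<Longrightarrow> submodule (D i) R M \<and> D i \<subseteq> L \<and> y i \<in> carrier M \<and>
      v i = D i +>\<^bsub>M\<^esub> y i \<and> \<zero>\<^bsub>V i\<^esub> = D i"
    and S: "\<And>i. i \<in> I - T \<Longrightarrow> v i = \<zero>\<^bsub>V i\<^esub>"
  shows "natural_map M L I V v = L +>\<^bsub>M\<^esub> (\<Oplus>\<^bsub>M\<^esub>i\<in>T. y i)"
proof -
  define S where "S = {i \<in> I. v i \<noteq> \<zero>\<^bsub>V i\<^esub>}"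
  have ST: "S \<subseteq> T" unfolding S_def using assms(5) by blast
  then have fS: "finite S" using T finite_subset by blast
  have yM: "y i \<in> carrier M" if "i \<in> T" for i using v[OF that] by blast
  have *: "L +>\<^bsub>M\<^esub> (\<Oplus>\<^bsub>M\<^esub>i\<in>S. x i) = L +>\<^bsub>M\<^esub> (\<Oplus>\<^bsub>M\<^esub>i\<in>T. y i)" if x: "x \<in> (\<Pi>\<^sub>E i\<in>S. v i)" for x
  proof -
    have xi: "x i \<in> carrier M \<and> x i \<ominus>\<^bsub>M\<^esub> y i \<in> L" if "i \<in> S" for i
    proof -
      have "x i \<in> v i" using x that by (auto simp: PiE_iff)
      then have "x i \<in> D i +>\<^bsub>M\<^esub> y i" using v[of i] that ST by blast
      then show ?thesis using mem_coset_iff v[of i] that ST by blast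
    qed
    have "(\<Oplus>\<^bsub>M\<^esub>i\<in>S. x i) \<ominus>\<^bsub>M\<^esub> (\<Oplus>\<^bsub>M\<^esub>i\<in>S. y i) \<in> L"
      using xi ST yM by (intro finsum_minus_submodule[OF L fS]) auto
    then have 1: "L +>\<^bsub>M\<^esub> (\<Oplus>\<^bsub>M\<^esub>i\<in>S. x i) = L +>\<^bsub>M\<^esub> (\<Oplus>\<^bsub>M\<^esub>i\<in>S. y i)"
      using xi ST yM by (subst coset_eq_iff[OF L]) (auto intro!: M.finsum_closed)
    have yL: "y i \<in> L" if "i \<in> T - S" for i
    proof -
      have "D i +>\<^bsub>M\<^esub> y i = D i" using v[of i] that T(2) unfolding S_def by auto
      then show ?thesis using coset_eq_self_iff v[of i] that by blast
    qed
    then have r: "(\<Oplus>\<^bsub>M\<^esub>i\<in>T - S. y i) \<in> L" using T by (intro finsum_submodule[OF L]) auto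
    have "T = (T - S) \<union> S" using ST by blast
    then have "(\<Oplus>\<^bsub>M\<^esub>i\<in>T. y i) = (\<Oplus>\<^bsub>M\<^esub>i\<in>T - S. y i) \<oplus>\<^bsub>M\<^esub> (\<Oplus>\<^bsub>M\<^esub>i\<in>S. y i)"
      using M.finsum_Un_disjoint[of "T - S" S y] T fS ST yM by auto
    moreover have c: "(\<Oplus>\<^bsub>M\<^esub>i\<in>T - S. y i) \<in> carrier M" "(\<Oplus>\<^bsub>M\<^esub>i\<in>S. y i) \<in> carrier M" 
      using yM ST by (auto intro!: M.finsum_closed)
    ultimately have "(\<Oplus>\<^bsub>M\<^esub>i\<in>T. y i) \<ominus>\<^bsub>M\<^esub> (\<Oplus>\<^bsub>M\<^esub>i\<in>S. y i) \<in> L"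
      using r by (simp add: a_minus_def M.a_assoc M.r_neg)
    then have "L +>\<^bsub>M\<^esub> (\<Oplus>\<^bsub>M\<^esub>i\<in>T. y i) = L +>\<^bsub>M\<^esub> (\<Oplus>\<^bsub>M\<^esub>i\<in>S. y i)"
      using c yM by (subst coset_eq_iff[OF L]) (auto intro!: M.finsum_closed)
    then show ?thesis using 1 by simp
  qed
  have "(\<lambda>i\<in>S. y i) \<in> (\<Pi>\<^sub>E i\<in>S. v i)"
    using ST v coset_self by (auto simp: PiE_iff subset_iff)
  then show ?thesis unfolding natural_map_def Let_def S_def[symmetric] using * by blast
qed

text \<open>The natural map identifies the direct sum with the classes of those elements of
  \<open>ur\<close> that are multiples of \<open>q^c\<close>: it is onto because components can be
  split off, and injective because a sum in \<open>lr\<close> has all components in the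
  denominators. \<open>\<kappa>\<close> translates the index of \<open>\<rho>\<close> into an
  exponent; \<open>F\<close> is arbitrary, so the odd and the even form are both covered.\<close>

lemma (in chain_module) anisotropic_dsum_iff:
  fixes V :: "'i \<Rightarrow> ('a, 'c set) module"
  assumes \<kappa>: "bij_betw \<kappa> I {c..}" and V: "\<And>i. i \<in> I \<Longrightarrow> V i = rho_odd R (PIdl q) M (2 * \<kappa> i + 1)"
  shows "anisotropic_on (module_dsum I V) N
      (\<lambda>v w. F (natural_map M (lr R M) I V v) (natural_map M (lr R M) I V w)) \<longleftrightarrow>
    (\<forall>w\<in>carrier M. q [^] (c::nat) \<odot>\<^bsub>M\<^esub> w \<in> ur R M \<longrightarrow> q [^] c \<odot>\<^bsub>M\<^esub> w \<notin> lr R M \<longrightarrow>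
      F (lr R M +>\<^bsub>M\<^esub> (q [^] c \<odot>\<^bsub>M\<^esub> w)) (lr R M +>\<^bsub>M\<^esub> (q [^] c \<odot>\<^bsub>M\<^esub> w)) \<noteq> \<zero>\<^bsub>N\<^esub>)" (is "?A \<longleftrightarrow> ?B")
proof -
  have zV: "\<zero>\<^bsub>V i\<^esub> = den (\<kappa> i)" and cV: "carrier (V i) = a_r_coset M (den (\<kappa> i)) ` num (\<kappa> i)" if "i \<in> I" for i
    unfolding V[OF that] rho_odd_eq carrier_fact_submodule by (simp_all add: fact_module_def)
  have numM: "num k \<subseteq> carrier M" for k using submoduleE(1)[OF num_submodule] .
  have inj: "inj_on \<kappa> I" and im: "\<kappa> ` I = {c..}" using \<kappa> unfolding bij_betw_def by auto
  have zero_iff: "v = \<zero>\<^bsub>module_dsum I V\<^esub> \<longleftrightarrow> (\<forall>i\<in>I. v i = den (\<kappa> i))" if "v \<in> carrier (module_dsum I V)" for v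
    using that zV unfolding module_dsum_def by (auto simp: PiE_iff extensional_def fun_eq_iff)
  show ?thesis
  proof
    assume A: ?A
    show ?B
    proof (intro ballI impI)
      fix w assume w: "w \<in> carrier M" and ur: "q [^] c \<odot>\<^bsub>M\<^esub> w \<in> ur R M" and nlr: "q [^] c \<odot>\<^bsub>M\<^esub> w \<notin> lr R M"
      let ?x = "q [^] c \<odot>\<^bsub>M\<^esub> w"
      have xM: "?x \<in> carrier M" using w by simp
      obtain f where f: "\<And>k. f k \<in> num k" "?x = (\<Oplus>\<^bsub>M\<^esub>k\<in>{c..<c + n}. f k)"
        using half_div_decompose_finsum[OF xM ur_imp_half_div[OF ur] w refl] by blast
      have fM: "f k \<in> carrier M" for k using f numM by blast
      \<comment> \<open>Only exponents below \<open>c + n\<close> occur in the decomposition, as the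
        remainder is a multiple of \<open>q^{c+n} = 0\<close>.\<close>
      define T where "T = {i \<in> I. \<kappa> i < c + n}"
      have imT: "\<kappa> ` T = {c..<c + n}"
      proof
        show "{c..<c + n} \<subseteq> \<kappa> ` T"
        proof
          fix k assume k: "k \<in> {c..<c + n}"
          then obtain i where "i \<in> I" "k = \<kappa> i" using im by (metis atLeastLessThan_iff atLeast_iff imageE)
          then show "k \<in> \<kappa> ` T" using k unfolding T_def by auto
        qed
        show "\<kappa> ` T \<subseteq> {c..<c + n}" using im unfolding T_def by auto
      qed
      have injT: "inj_on \<kappa> T" using inj unfolding T_def by (rule inj_on_subset) auto
      have fT: "finite T" using imT finite_imageD[OF _ injT] by simp
      have x: "?x = (\<Oplus>\<^bsub>M\<^esub>i\<in>T. f (\<kappa> i))"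
        using f(2) M.finsum_reindex[OF _ injT, of f] fM imT by auto
      define v where "v = (\<lambda>i\<in>I. if i \<in> T then den (\<kappa> i) +>\<^bsub>M\<^esub> f (\<kappa> i) else den (\<kappa> i))"
      have den_coset: "den k = den k +>\<^bsub>M\<^esub> \<zero>\<^bsub>M\<^esub>" for k
        using submoduleE(1)[OF den_submodule] by simp
      have v: "v \<in> carrier (module_dsum I V)"
      proof -
        have "v i \<in> carrier (V i)" if "i \<in> I" for i
        proof (cases "i \<in> T")
          case True then show ?thesis using that f(1) by (simp add: v_def cV)
        next
          case False
          then show ?thesis using that den_coset submodule_zero_closed[OF num_submodule] by (auto simp: v_def cV)
        qed
        moreover have "{i \<in> I. v i \<noteq> \<zero>\<^bsub>V i\<^esub>} \<subseteq> T" using zV by (auto simp: v_def)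
        then have "finite {i \<in> I. v i \<noteq> \<zero>\<^bsub>V i\<^esub>}" using fT finite_subset by blast
        ultimately show ?thesis unfolding module_dsum_def by (auto simp: v_def)
      qed
      have TI: "T \<subseteq> I" unfolding T_def by blast
      have nat: "natural_map M (lr R M) I V v = lr R M +>\<^bsub>M\<^esub> ?x"
        unfolding x
        by (rule natural_map_eq[OF lr_submodule fT TI, where D = "\<lambda>i. den (\<kappa> i)"])
          (use TI zV den_submodule den_subset_lr fM in \<open>auto simp: v_def\<close>)
      have "v \<noteq> \<zero>\<^bsub>module_dsum I V\<^esub>"
      proof
        assume "v = \<zero>\<^bsub>module_dsum I V\<^esub>"
        then have "v i = den (\<kappa> i)" if "i \<in> I" for i using zero_iff[OF v] that by blast
        then have "den (\<kappa> i) +>\<^bsub>M\<^esub> f (\<kappa> i) = den (\<kappa> i)" if "i \<in> T" for i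
          using \<open>\<And>i. i \<in> I \<Longrightarrow> v i = den (\<kappa> i)\<close>[of i] that TI by (simp add: v_def subset_iff)
        then have "f (\<kappa> i) \<in> lr R M" if "i \<in> T" for i 
          using that coset_eq_self_iff[OF den_submodule fM] den_subset_lr by blast
        then have "?x \<in> lr R M" unfolding x by (intro finsum_submodule[OF lr_submodule fT]) auto
        then show False using nlr by blast
      qed
      then show "F (lr R M +>\<^bsub>M\<^esub> ?x) (lr R M +>\<^bsub>M\<^esub> ?x) \<noteq> \<zero>\<^bsub>N\<^esub>" using A v nat unfolding anisotropic_on_def by metis
    qed
  next
    assume B: ?B
    show ?A unfolding anisotropic_on_def
    proof (intro ballI impI)
      fix v assume v: "v \<in> carrier (module_dsum I V)" and nz: "v \<noteq> \<zero>\<^bsub>module_dsum I V\<^esub>"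
      define T where "T = {i \<in> I. v i \<noteq> \<zero>\<^bsub>V i\<^esub>}"
      have fT: "finite T" and TI: "T \<subseteq> I" using v unfolding T_def module_dsum_def by auto
      have "\<exists>y. y \<in> num (\<kappa> i) \<and> v i = den (\<kappa> i) +>\<^bsub>M\<^esub> y" if "i \<in> I" for i
      proof -
        have "v i \<in> carrier (V i)" using v that unfolding module_dsum_def by auto
        then show ?thesis using cV[OF that] by auto
      qed
      then obtain y where y: "\<And>i. i \<in> I \<Longrightarrow> y i \<in> num (\<kappa> i) \<and> v i = den (\<kappa> i) +>\<^bsub>M\<^esub> y i" by metis
      have yM: "y i \<in> carrier M" if "i \<in> I" for i using y[OF that] numM by blast
      let ?x = "\<Oplus>\<^bsub>M\<^esub>i\<in>T. y i"
      have nat: "natural_map M (lr R M) I V v = lr R M +>\<^bsub>M\<^esub> ?x"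
        by (rule natural_map_eq[OF lr_submodule fT TI, where D = "\<lambda>i. den (\<kappa> i)"])
          (use TI zV den_submodule den_subset_lr y yM in \<open>auto simp: T_def\<close>)
      have xM: "?x \<in> carrier M" using yM TI by (intro M.finsum_closed) auto
      have "?x \<in> {x \<in> carrier M. P 1 x}"
        using TI y num_half_div yM by (intro finsum_submodule[OF half_div_submodule fT]) blast
      then have ur: "?x \<in> ur R M" using half_div_imp_ur[OF xM] xM by simp
      \<comment> \<open>Each component has exponent \<open>\<kappa> i \<ge> c\<close>, so
        \<open>q^c\<close> can be taken out of the whole sum.\<close>
      have "?x \<in> (\<odot>\<^bsub>M\<^esub>) (q [^] c) ` carrier M"
      proof (rule finsum_submodule[OF scalar_image_submodule[OF carrier_is_submodule] fT])
        fix i assume i: "i \<in> T"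
        then have "\<kappa> i \<ge> c" using TI im by (metis atLeast_iff image_eqI subsetD)
        moreover obtain z where z: "z \<in> carrier M" "y i = q [^] \<kappa> i \<odot>\<^bsub>M\<^esub> z"
          using y i TI unfolding num_def tors_def by blast
        ultimately have "y i = q [^] c \<odot>\<^bsub>M\<^esub> (q [^] (\<kappa> i - c) \<odot>\<^bsub>M\<^esub> z)" by (simp add: pow_smult)
        then show "y i \<in> (\<odot>\<^bsub>M\<^esub>) (q [^] c) ` carrier M" using z by blast
      qed simp
      then obtain w where w: "w \<in> carrier M" "?x = q [^] c \<odot>\<^bsub>M\<^esub> w" by blast
      have "?x \<notin> lr R M"
      proof
        assume lr: "?x \<in> lr R M"
        have "v i = den (\<kappa> i)" if i: "i \<in> I" for i
        proof (cases "i \<in> T")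
          case True
          have "y i \<in> den (\<kappa> i)"
            using sum_in_lr_imp_den[OF fT True inj_on_subset[OF inj TI] _ lr] y TI by blast
          then show ?thesis using coset_eq_self_iff[OF den_submodule yM[OF i]] y[OF i] by simp
        next
          case False then show ?thesis using zV[OF i] i unfolding T_def by auto
        qed
        then show False using zero_iff[OF v] nz by blast
      qed
      then show "F (natural_map M (lr R M) I V v) (natural_map M (lr R M) I V v) \<noteq> \<zero>\<^bsub>N\<^esub>"
        using B ur w unfolding nat by metis
    qed
  qed
qed


text \<open>Only the additive group enters \<open>natural_map\<close>. So \<open>M/M[m]\<close> may
  be read over \<open>R\<close>, as in \<open>rho_even\<close>, or over \<open>R/R[m]\<close>, as in
  \<open>even_quot\<close>.\<close>

lemma natural_map_cong:
  fixes v :: "'i \<Rightarrow> 'b set"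
  assumes "ring.add Q = ring.add M'" "carrier Q = carrier M'" "ring.zero Q = ring.zero M'"
  shows "natural_map Q L I V v = natural_map M' L I V v"
proof -
  have "finsum Q x T = finsum M' x T" for x :: "'i \<Rightarrow> 'b" and T
    unfolding finsum_def finprod_def using assms by (simp cong: if_cong)
  moreover have "a_r_coset Q = a_r_coset M'"
    unfolding fun_eq_iff a_r_coset_def' using assms by simp
  ultimately show ?thesis unfolding natural_map_def by simp
qed

section \<open>The forms on the even and the higher odd \<open>\<rho>_i\<close> as conditions
  \<open>A(j)\<close>\<close>

context local_form_presentation
begin

lemma chain_module_image: "chain_module R2 (\<phi> q) n M2"
  by (intro chain_module.intro lm.img.local_module_axioms)

text \<open>Without \<open>\<rho>_1\<close> exactly the elements \<open>q w\<close> are tested. For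
  \<open>w = h x\<close>, the factor \<open>q\<close> raises the index of divisibility of
  \<open>x\<close> by two, and bilinearity raises the exponent in front of \<open>B x x\<close> by
  two.\<close>

lemma anisotropic_rho_odd_iff_half_aniso:
  assumes m: "m = PIdl\<^bsub>R2\<^esub> (\<phi> q)"
  defines "I \<equiv> {i::nat. odd i \<and> i \<noteq> 1}"
  shows "anisotropic_on (module_dsum I (rho_odd R2 m M2)) N2 (rho_odd_form R2 m M2 B2 I) \<longleftrightarrow>
    half_aniso R M N B e q (j + 2)"
proof -
  interpret ch: chain_module R2 "\<phi> q" n M2 by (rule chain_module_image)
  \<comment> \<open>\<open>i = 2 k + 1\<close> is odd and different from \<open>1\<close> exactly
    for \<open>k \<ge> 1\<close>.\<close>
  have \<kappa>: "bij_betw (\<lambda>i. i div 2) I {1..}"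
    by (rule bij_betw_byWitness[where f' = "\<lambda>k. 2 * k + 1"]) (auto simp: I_def elim!: oddE)
  have V: "rho_odd R2 m M2 i = rho_odd R2 (PIdl\<^bsub>R2\<^esub> (\<phi> q)) M2 (2 * (i div 2) + 1)" if "i \<in> I" for i
    using that odd_two_times_div_two_succ[of i] unfolding I_def m by simp
  have "anisotropic_on (module_dsum I (rho_odd R2 m M2)) N2 (rho_odd_form R2 m M2 B2 I) \<longleftrightarrow>
    (\<forall>w\<in>carrier M2. \<phi> q \<odot>\<^bsub>M2\<^esub> w \<in> ur R2 M2 \<longrightarrow> \<phi> q \<odot>\<^bsub>M2\<^esub> w \<notin> lr R2 M2 \<longrightarrow>
      odd_form B2 (lr R2 M2 +>\<^bsub>M2\<^esub> (\<phi> q \<odot>\<^bsub>M2\<^esub> w)) (lr R2 M2 +>\<^bsub>M2\<^esub> (\<phi> q \<odot>\<^bsub>M2\<^esub> w)) \<noteq> \<zero>\<^bsub>N2\<^esub>)"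
    using ch.anisotropic_dsum_iff[OF \<kappa> V, of N2 "odd_form B2"]
    unfolding rho_odd_form_def[abs_def] by simp
  also have "\<dots> \<longleftrightarrow> (\<forall>x\<in>carrier M. \<phi> q \<odot>\<^bsub>M2\<^esub> h x \<in> ur R2 M2 \<longrightarrow> \<phi> q \<odot>\<^bsub>M2\<^esub> h x \<notin> lr R2 M2 \<longrightarrow>
      B2 (\<phi> q \<odot>\<^bsub>M2\<^esub> h x) (\<phi> q \<odot>\<^bsub>M2\<^esub> h x) \<noteq> \<zero>\<^bsub>N2\<^esub>)"
    unfolding lm.h_surj[symmetric] ball_simps using fm2.odd_form_cosets[OF lr_subset_ur_image] by auto
  also have "\<dots> \<longleftrightarrow> half_aniso R M N B e q (j + 2)"
    unfolding half_aniso_def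
  proof (intro ball_cong refl)
    fix x assume x: "x \<in> carrier M"
    let ?y = "q \<odot>\<^bsub>M\<^esub> x"
    have y: "\<phi> q \<odot>\<^bsub>M2\<^esub> h x = h ?y" "?y \<in> carrier M" using x by simp_all
    have "B2 (h ?y) (h ?y) = \<zero>\<^bsub>N2\<^esub> \<longleftrightarrow> (e \<otimes> q [^] j) \<odot>\<^bsub>N\<^esub> B ?y ?y = \<zero>\<^bsub>N\<^esub>"
      using y(2) by (simp add: form_eq ln.h_ker)
    also have "(e \<otimes> q [^] j) \<odot>\<^bsub>N\<^esub> B ?y ?y = (e \<otimes> q [^] (j + 2)) \<odot>\<^bsub>N\<^esub> B x x"
      using x by (simp add: fm.N.smult_assoc1[symmetric] m_assoc)
    finally show "(\<phi> q \<odot>\<^bsub>M2\<^esub> h x \<in> ur R2 M2 \<longrightarrow> \<phi> q \<odot>\<^bsub>M2\<^esub> h x \<notin> lr R2 M2 \<longrightarrow>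
        B2 (\<phi> q \<odot>\<^bsub>M2\<^esub> h x) (\<phi> q \<odot>\<^bsub>M2\<^esub> h x) \<noteq> \<zero>\<^bsub>N2\<^esub>) \<longleftrightarrow>
      (half_div R M e q (j + 2 + 1) x \<longrightarrow> (e \<otimes> q [^] (j + 2)) \<odot>\<^bsub>N\<^esub> B x x = \<zero>\<^bsub>N\<^esub> \<longrightarrow>
        half_div R M e q (j + 2) x)"
      unfolding y(1) lm.img_ur_iff[OF y(2)] lm.img_lr_iff[OF y(2)] lm.half_div_shift[OF x]
      by (auto simp: add.commute add.left_commute)
  qed
  finally show ?thesis .
qed

text \<open>All \<open>\<rho>_i\<close> of the quotient by the socle layer are present, so
  \<open>c = 0\<close> and the form is the full even form. The work lies in reconciling two versions
  of the quotient: \<open>?M3\<close> over \<open>R2\<close>, which carries the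
  \<open>\<rho>_i\<close>, and \<open>?Q\<close> over \<open>?E\<close>, which carries the even
  form.\<close>

lemma anisotropic_rho_even_iff_half_aniso:
  assumes m: "m = PIdl\<^bsub>R2\<^esub> (\<phi> q)"
  defines "I \<equiv> {i::nat. even i \<and> 2 \<le> i}"
  shows "anisotropic_on (module_dsum I (rho_even R2 m M2)) (even_quot m N2) (rho_even_form R2 m M2 N2 B2 I) \<longleftrightarrow>
    half_aniso R M N B e q (j + 1)"
proof -
  interpret reg: module R2 "regular_module R2" by (rule lm.img.module_regular)
  have q2: "\<phi> q \<in> carrier R2" by simp
  let ?h = "a_r_coset M2 (tors M2 {\<phi> q}) \<circ> h"
  let ?M3 = "fact_module M2 (tors M2 {\<phi> q})"
  let ?Q = "fact_module_over M2 (tors M2 {\<phi> q})"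
  let ?E = "R2 Quot tors (regular_module R2) {\<phi> q}"
  interpret quot: local_form_presentation R e q n M N B "j + 1" ?E ?Q
     "fact_module_over N2 (tors N2 {\<phi> q})" "quot_form N2 (tors N2 {\<phi> q}) B2"
     "a_r_coset R2 (tors (regular_module R2) {\<phi> q}) \<circ> \<phi>" ?h "a_r_coset N2 (tors N2 {\<phi> q}) \<circ> g"
    by (rule local_form_presentation_quot)
  have "presentation R M (e \<otimes> q [^] j \<otimes> q) R2 ?M3 (id \<circ> \<phi>) ?h"
    by (rule lm.presentation_comp[OF lm.img.fact_module_presentation[OF q2] q_closed])
  moreover have "e \<otimes> q [^] j \<otimes> q = e \<otimes> q [^] (j + 1)" by (simp add: m_assoc)
  ultimately interpret p3: presentation R M "e \<otimes> q [^] (j + 1)" R2 ?M3 \<phi> ?h by simp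
  interpret l3: local_presentation R e q n M "j + 1" R2 ?M3 \<phi> ?h
    by unfold_locales (rule phi_e)
  interpret ch: chain_module R2 "\<phi> q" n ?M3
    by (intro chain_module.intro l3.img.local_module_axioms)
  have carr: "carrier ?Q = carrier ?M3" by (simp add: carrier_fact_module)
  \<comment> \<open>Both versions are presented from \<open>M\<close> with the scalar
    \<open>e q^{j+1}\<close>, so membership is the same divisibility condition on a
    preimage.\<close>
  have lr_eq: "X \<in> lr ?E ?Q \<longleftrightarrow> X \<in> lr R2 ?M3" and ur_eq: "X \<in> ur ?E ?Q \<longleftrightarrow> X \<in> ur R2 ?M3" if X: "X \<in> carrier ?M3" for X
  proof -
    obtain x where "x \<in> carrier M" "X = ?h x" using p3.h_obtain[OF X] by blast
    then show "X \<in> lr ?E ?Q \<longleftrightarrow> X \<in> lr R2 ?M3" "X \<in> ur ?E ?Q \<longleftrightarrow> X \<in> ur R2 ?M3"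
      by (simp_all only: quot.lm.img_lr_iff l3.img_lr_iff quot.lm.img_ur_iff l3.img_ur_iff)
  qed
  have lr_E: "lr ?E ?Q = lr R2 ?M3"
  proof -
    have "lr ?E ?Q \<subseteq> carrier ?Q" using quot.lm.img.submoduleE(1)[OF quot.lm.img.lr_submodule] .
    moreover have "lr R2 ?M3 \<subseteq> carrier ?M3" using l3.img.submoduleE(1)[OF l3.img.lr_submodule] .
    ultimately show ?thesis using lr_eq carr by blast
  qed
  have coset: "a_r_coset ?Q = a_r_coset ?M3"
    by (simp add: fun_eq_iff a_r_coset_def' fact_module_def fact_module_over_def)
  have "ring.add ?Q = ring.add ?M3" "ring.zero ?Q = ring.zero ?M3"
    by (simp_all add: fact_module_def fact_module_over_def)
  note nat = natural_map_cong[OF this(1) carr this(2)]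
  \<comment> \<open>The even index \<open>i = 2 k + 2\<close> stands for
    \<open>\<rho>_{2k+1}\<close> of the quotient, and every \<open>k \<ge> 0\<close> occurs.\<close>
  have \<kappa>: "bij_betw (\<lambda>i. (i - 1) div 2) I {0..}"
    by (rule bij_betw_byWitness[where f' = "\<lambda>k. 2 * k + 2"]) (auto simp: I_def elim!: evenE)
  have V: "rho_even R2 m M2 i = rho_odd R2 (PIdl\<^bsub>R2\<^esub> (\<phi> q)) ?M3 (2 * ((i - 1) div 2) + 1)" if "i \<in> I" for i
  proof -
    have "odd (i - 1)" using that unfolding I_def by auto
    then have "2 * ((i - 1) div 2) + 1 = i - 1" by (rule odd_two_times_div_two_succ)
    then show ?thesis unfolding rho_even_def m lm.img.tors_PIdl[OF q2] by simp
  qed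
  let ?F = "odd_form (quot_form N2 (tors N2 {\<phi> q}) B2)"
  let ?N3 = "fact_module_over N2 (tors N2 {\<phi> q})"
  have tm: "tors M2 m = tors M2 {\<phi> q}" "tors N2 m = tors N2 {\<phi> q}"
    "tors (regular_module R2) m = tors (regular_module R2) {\<phi> q}"
    unfolding m using lm.img.tors_PIdl[OF q2] ln.img.tors_PIdl[OF q2] reg.tors_PIdl[OF q2] by auto
  have "anisotropic_on (module_dsum I (rho_even R2 m M2)) (even_quot m N2) (rho_even_form R2 m M2 N2 B2 I) \<longleftrightarrow>
    anisotropic_on (module_dsum I (rho_even R2 m M2)) ?N3 (\<lambda>v w.
      ?F (natural_map ?M3 (lr R2 ?M3) I (rho_even R2 m M2) v) (natural_map ?M3 (lr R2 ?M3) I (rho_even R2 m M2) w))"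
    unfolding rho_even_form_def[abs_def] even_form_def even_quot_def even_ring_def tm lr_E nat ..
  also have "\<dots> \<longleftrightarrow> (\<forall>w\<in>carrier ?M3. \<phi> q [^]\<^bsub>R2\<^esub> (0::nat) \<odot>\<^bsub>?M3\<^esub> w \<in> ur R2 ?M3 \<longrightarrow>
     \<phi> q [^]\<^bsub>R2\<^esub> (0::nat) \<odot>\<^bsub>?M3\<^esub> w \<notin> lr R2 ?M3 \<longrightarrow>
      ?F (lr R2 ?M3 +>\<^bsub>?M3\<^esub> (\<phi> q [^]\<^bsub>R2\<^esub> (0::nat) \<odot>\<^bsub>?M3\<^esub> w)) (lr R2 ?M3 +>\<^bsub>?M3\<^esub> (\<phi> q [^]\<^bsub>R2\<^esub> (0::nat) \<odot>\<^bsub>?M3\<^esub> w)) \<noteq> \<zero>\<^bsub>?N3\<^esub>)"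
    by (rule ch.anisotropic_dsum_iff[OF \<kappa> V])
  also have "\<dots> \<longleftrightarrow> (\<forall>w\<in>carrier ?M3. w \<in> ur R2 ?M3 \<longrightarrow> w \<notin> lr R2 ?M3 \<longrightarrow>
      ?F (lr R2 ?M3 +>\<^bsub>?M3\<^esub> w) (lr R2 ?M3 +>\<^bsub>?M3\<^esub> w) \<noteq> \<zero>\<^bsub>?N3\<^esub>)"
    by (intro ball_cong refl) simp
  also have "\<dots> \<longleftrightarrow> anisotropic_on (odd_module ?E ?Q) ?N3 ?F"
  proof -
    have "?F (lr R2 ?M3 +>\<^bsub>?M3\<^esub> w) (lr R2 ?M3 +>\<^bsub>?M3\<^esub> w) = quot_form N2 (tors N2 {\<phi> q}) B2 w w" 
      if "w \<in> ur ?E ?Q" for w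
      using quot.fm2.odd_form_cosets[OF quot.lr_subset_ur_image that that] unfolding lr_E coset .
    moreover have "w \<in> carrier ?M3" if "w \<in> ur ?E ?Q" for w using that quot.lm.img.ur_iff carr by blast
    ultimately show ?thesis
      unfolding quot.fm2.anisotropic_odd_iff[OF quot.lr_subset_ur_image] using ur_eq lr_eq by metis
  qed
  also have "\<dots> \<longleftrightarrow> half_aniso R M N B e q (j + 1)"
    by (rule quot.anisotropic_odd_iff_half_aniso)
  finally show ?thesis .
qed

lemma quasi_anisotropic_local_iff:
  assumes "m = PIdl\<^bsub>R2\<^esub> (\<phi> q)"
  shows "quasi_anisotropic_local R2 m M2 N2 B2 \<longleftrightarrow> nondegenerate R2 M2 N2 B2 \<and>
    half_aniso R M N B e q (j + 1) \<and> half_aniso R M N B e q (j + 2)"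
  unfolding quasi_anisotropic_local_def Let_def
    anisotropic_rho_even_iff_half_aniso[OF assms] anisotropic_rho_odd_iff_half_aniso[OF assms] ..

end


section \<open>Artinian principal ideal rings\<close>

lemma (in cring) exists_primeideal:
  assumes J: "ideal J R" and one: "\<one> \<notin> J"
  shows "\<exists>p. primeideal p R \<and> J \<subseteq> p"
proof -
  define A where "A = {I. ideal I R \<and> J \<subseteq> I \<and> \<one> \<notin> I}"
  have "\<exists>m\<in>A. \<forall>I\<in>A. m \<subseteq> I \<longrightarrow> I = m"
  proof (rule subset_Zorn_nonempty)
    show "A \<noteq> {}" using J one unfolding A_def by blast
    fix C assume C: "C \<noteq> {}" "subset.chain A C"
    then have CA: "C \<subseteq> A" by (simp add: subset.chain_def)
    have id: "ideal I R" if "I \<in> C" for I using that CA unfolding A_def by blast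
    have "ideal (\<Union>C) R"
    proof (rule idealI[OF ring_axioms])
      show "subgroup (\<Union>C) (add_monoid R)"
      proof (rule subgroup.intro)
        show "\<Union>C \<subseteq> carrier (add_monoid R)"
          using additive_subgroup.a_subset[OF ideal.axioms(1)[OF id]] by auto
        show "\<one>\<^bsub>add_monoid R\<^esub> \<in> \<Union>C"
          using additive_subgroup.zero_closed[OF ideal.axioms(1)[OF id]] C(1) by auto
        show "inv\<^bsub>add_monoid R\<^esub> x \<in> \<Union>C" if "x \<in> \<Union>C" for x
          using that additive_subgroup.a_inv_closed[OF ideal.axioms(1)[OF id]]
          unfolding a_inv_def[symmetric] by blast
        fix x y assume "x \<in> \<Union>C" "y \<in> \<Union>C"
        then obtain I I' where I: "I \<in> C" "x \<in> I" "I' \<in> C" "y \<in> I'" by blast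
        then have "I \<subseteq> I' \<or> I' \<subseteq> I" using C(2) unfolding subset.chain_def by blast
        then obtain I'' where "I'' \<in> C" "x \<in> I''" "y \<in> I''" using I by blast
        then show "x \<otimes>\<^bsub>add_monoid R\<^esub> y \<in> \<Union>C"
          using additive_subgroup.a_closed[OF ideal.axioms(1)[OF id]] by auto
      qed
      show "x \<otimes> a \<in> \<Union>C" "a \<otimes> x \<in> \<Union>C" if "a \<in> \<Union>C" "x \<in> carrier R" for a x
        using that ideal.I_l_closed[OF id] ideal.I_r_closed[OF id] by blast+
    qed
    moreover have "J \<subseteq> \<Union>C" "\<one> \<notin> \<Union>C" using C(1) CA unfolding A_def by blast+
    ultimately show "\<Union>C \<in> A" unfolding A_def by blast
  qed
  then obtain m where mA: "m \<in> A" and max: "\<And>I. I \<in> A \<Longrightarrow> m \<subseteq> I \<Longrightarrow> I = m" by blast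
  then have m: "ideal m R" "J \<subseteq> m" "\<one> \<notin> m" unfolding A_def by blast+
  have "maximalideal m R"
  proof (rule maximalidealI[OF m(1)])
    show "carrier R \<noteq> m" using m(3) by blast
    fix I assume I: "ideal I R" "m \<subseteq> I" "I \<subseteq> carrier R"
    show "I = m \<or> I = carrier R"
    proof (cases "\<one> \<in> I")
      case True then show ?thesis using ideal.one_imp_carrier[OF I(1)] by blast
    next
      case False then show ?thesis using max[of I] I m(2) unfolding A_def by blast
    qed
  qed
  then show ?thesis using maximalideal_prime m(2) by blast
qed

lemma (in primeideal) nilpotent_mem:
  assumes "a \<in> carrier R" "a [^] (k::nat) \<in> I"
  shows "a \<in> I"
  using assms(2)
proof (induction k)
  case 0
  then show ?case using one_imp_carrier I_notcarr by simp
next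
  case (Suc k)
  then show ?case using I_prime[of "a [^] k" a] assms(1) by auto
qed

locale artinian_pir = cring R for R (structure) +
  assumes artinian: "artinian_ring R" and pir: "principal_ideal_ring R"
begin

lemma ideal_PIdl: "ideal I R \<Longrightarrow> \<exists>a\<in>carrier R. I = PIdl a"
  using pir cgenideal_eq_genideal unfolding principal_ideal_ring_def principalideal_def principalideal_axioms_def
  by metis

lemma power_stabilizes:
  assumes a: "a \<in> carrier R"
  shows "\<exists>m t. t \<in> carrier R \<and> a [^] Suc m = t \<otimes> a [^] (Suc m + Suc m)"
proof -
  define I where "I k = PIdl (a [^] (k::nat))" for k
  have "ideal (I k) R" for k unfolding I_def using a by (intro cgenideal_ideal) simp
  moreover have "I (Suc k) \<subseteq> I k" for k
  proof
    fix x assume "x \<in> I (Suc k)"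
    then obtain b where "b \<in> carrier R" "x = b \<otimes> a [^] Suc k" unfolding I_def cgenideal_def by blast
    then have "x = (b \<otimes> a) \<otimes> a [^] k" "b \<otimes> a \<in> carrier R" using a by (simp_all add: m_ac)
    then show "x \<in> I k" unfolding I_def cgenideal_def by blast
  qed
  ultimately obtain m where m: "\<And>k. k \<ge> m \<Longrightarrow> I k = I m" using artinian unfolding artinian_ring_def by metis
  have "a [^] Suc m \<in> I (Suc m)" unfolding I_def using a by (intro cgenideal_self) simp
  also have "I (Suc m) = I (Suc m + Suc m)" using m[of "Suc m"] m[of "Suc m + Suc m"] by simp
  finally show ?thesis unfolding I_def cgenideal_def by blast
qed

text \<open>With \<open>b = a^{m+1}\<close> and \<open>b = t b^2\<close>, the element
  \<open>b t\<close> is idempotent and acts as the identity on \<open>b\<close>. The exponent is a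
  successor so that \<open>a\<close> divides the idempotent.\<close>

lemma power_idempotent:
  assumes a: "a \<in> carrier R"
  obtains m t where "t \<in> carrier R" "(a [^] Suc m \<otimes> t) \<otimes> (a [^] Suc m \<otimes> t) = a [^] Suc m \<otimes> t"
    "(a [^] Suc m \<otimes> t) \<otimes> a [^] Suc m = a [^] Suc m"
proof -
  obtain m t where t: "t \<in> carrier R" "a [^] Suc m = t \<otimes> a [^] (Suc m + Suc m)" 
    using power_stabilizes[OF a] by blast
  define b where "b = a [^] Suc m"
  have b: "b \<in> carrier R" "b = t \<otimes> (b \<otimes> b)"
    unfolding b_def nat_pow_mult[OF a] by (rule nat_pow_closed[OF a], rule t(2))
  have bb: "(b \<otimes> t) \<otimes> b = b" using b t(1) by (metis m_assoc m_comm)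
  then have "(b \<otimes> t) \<otimes> (b \<otimes> t) = b \<otimes> t" using b(1) t(1) by (metis m_assoc m_closed)
  then show ?thesis using that t(1) bb unfolding b_def by blast
qed

text \<open>A power \<open>q^n\<close> generates the same ideal as an idempotent
  \<open>f \<in> p\<close>, and \<open>e = 1 - f\<close> annihilates \<open>q^n\<close> and lies
  outside \<open>p\<close>. An element \<open>u\<close> outside \<open>p\<close> is invertible on
  \<open>e R\<close> because the complement \<open>g'\<close> of the idempotent made from a power of
  \<open>u\<close> vanishes there.\<close>

lemma exists_prime_factor:
  assumes p: "primeideal p R"
  shows "\<exists>e q n. prime_factor R p e q n"
proof -
  interpret p: primeideal p R by fact
  obtain q where q: "q \<in> carrier R" "p = PIdl q" using ideal_PIdl[OF p.is_ideal] by blast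
  obtain m t where t: "t \<in> carrier R" and f: "(q [^] Suc m \<otimes> t) \<otimes> (q [^] Suc m \<otimes> t) = q [^] Suc m \<otimes> t"
    "(q [^] Suc m \<otimes> t) \<otimes> q [^] Suc m = q [^] Suc m" using power_idempotent[OF q(1)] by blast
  define n f where "n = Suc m" and "f = q [^] Suc m \<otimes> t"
  define e where "e = \<one> \<ominus> f"
  have fc: "f \<in> carrier R" unfolding f_def using q t by simp
  have ec: "e \<in> carrier R" unfolding e_def using fc by simp
  have ff: "f \<otimes> f = f" using f(1) unfolding f_def .
  have fq: "f \<otimes> q [^] n = q [^] n" using f(2) unfolding f_def n_def .
  have qp: "q \<in> p" unfolding q(2) using q(1) by (rule cgenideal_self)
  have qn: "q [^] n \<in> p" unfolding n_def using qp q(1) by (simp add: p.I_l_closed)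
  have fp: "f \<in> p" unfolding f_def using qn t unfolding n_def by (intro p.I_r_closed)
  have one: "\<one> \<notin> p" using p.one_imp_carrier p.I_notcarr by blast
  have sub: "(\<one> \<ominus> a) \<otimes> b = b \<ominus> a \<otimes> b" if "a \<in> carrier R" "b \<in> carrier R" for a b
    using that by (simp add: a_minus_def l_distr l_minus)
  have "e \<notin> p"
  proof
    assume "e \<in> p"
    then have "e \<oplus> f \<in> p" using fp by simp
    moreover have "e \<oplus> f = \<one>" unfolding e_def using fc by (simp add: a_minus_def a_assoc l_neg)
    ultimately show False using one by simp
  qed
  moreover have "e \<otimes> e = e"
  proof -
    have "f \<otimes> e = f \<ominus> f \<otimes> f" unfolding e_def using fc by (simp add: a_minus_def r_distr r_minus)
    then have "f \<otimes> e = \<zero>" using ff fc by simp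
    then show ?thesis using sub[OF fc ec] ec unfolding e_def[symmetric] by (simp add: a_minus_def)
  qed
  moreover have en: "e \<otimes> q [^] n = \<zero>"
    using sub[OF fc, of "q [^] n"] q(1) fq unfolding e_def[symmetric] by simp
  moreover have "\<exists>v\<in>carrier R. u \<otimes> v \<otimes> e = e" if u: "u \<in> carrier R - p" for u
  proof -
    have uc: "u \<in> carrier R" using u by simp
    obtain l s where s: "s \<in> carrier R" and g: "(u [^] Suc l \<otimes> s) \<otimes> (u [^] Suc l \<otimes> s) = u [^] Suc l \<otimes> s"
      "(u [^] Suc l \<otimes> s) \<otimes> u [^] Suc l = u [^] Suc l" using power_idempotent[OF uc] by blast
    define g where "g = u [^] Suc l \<otimes> s"
    have gc: "g \<in> carrier R" unfolding g_def using uc s by simp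
    have gg: "g \<otimes> g = g" using g(1) unfolding g_def .
    define g' where "g' = \<one> \<ominus> g"
    have gc': "g' \<in> carrier R" unfolding g'_def using gc by simp
    have "g' \<otimes> u [^] Suc l = \<zero>" unfolding g'_def using sub[OF gc, of "u [^] Suc l"] uc g(2) 
      unfolding g_def by (simp del: nat_pow_Suc Group.nat_pow_Suc)
    then have "g' \<otimes> u [^] Suc l \<in> p" by simp
    \<comment> \<open>\<open>g'\<close> kills a power of \<open>u\<close>, and no power of
      \<open>u\<close> lies in the prime \<open>p\<close>.\<close>
    then have "g' \<in> p" using p.I_prime[OF gc', of "u [^] Suc l"] p.nilpotent_mem[OF uc, of "Suc l"] uc u by auto
    then obtain c where c: "c \<in> carrier R" "g' = c \<otimes> q" unfolding q(2) cgenideal_def by blast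
    have g'g': "g' \<otimes> g' = g'"
    proof -
      have "g \<otimes> g' = g \<ominus> g \<otimes> g" unfolding g'_def using gc by (simp add: a_minus_def r_distr r_minus)
      then have "g \<otimes> g' = \<zero>" using gg gc by simp
      then show ?thesis using sub[OF gc gc'] gc' unfolding g'_def[symmetric] by (simp add: a_minus_def)
    qed
    have pow: "g' [^] Suc k = g'" for k :: nat by (induction k) (use gc' g'g' in auto)
    \<comment> \<open>Idempotency gives \<open>g' = g'^n\<close>, which raises the single factor
      \<open>q\<close> of \<open>g'\<close> to the power \<open>q^n\<close> killed by
      \<open>e\<close>.\<close>
    have "e \<otimes> g' = e \<otimes> (c \<otimes> q) [^] n" using pow[of m] c(2) unfolding n_def by simp
    also have "\<dots> = c [^] n \<otimes> (e \<otimes> q [^] n)" using c(1) q(1) ec by (simp add: nat_pow_distrib m_ac)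
    also have "\<dots> = \<zero>" using en c(1) by simp
    finally have "e \<otimes> g' = \<zero>" .
    moreover have "e \<otimes> g' = e \<ominus> e \<otimes> g" unfolding g'_def using ec gc by (simp add: a_minus_def r_distr r_minus)
    ultimately have "e = e \<otimes> g" using ec gc by simp
    moreover have "e \<otimes> g = u \<otimes> (u [^] l \<otimes> s) \<otimes> e" unfolding g_def using ec uc s by (simp add: m_ac)
    ultimately show ?thesis using uc s by (intro bexI[of _ "u [^] l \<otimes> s"]) auto
  qed
  ultimately have "prime_factor R p e q n"
    using p q ec by (intro prime_factor.intro is_cring prime_factor_axioms.intro)
  then show ?thesis by blast
qed

text \<open>The colon ideal \<open>(H : x)\<close> contains for each prime an element
  \<open>e\<close> outside that prime. Hence no prime contains it, and it must contain
  \<open>\<one>\<close>.\<close>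

lemma local_global:
  assumes "module R M" and H: "submodule H R M" and x: "x \<in> carrier M"
    and loc: "\<And>p e q n. prime_factor R p e q n \<Longrightarrow> e \<odot>\<^bsub>M\<^esub> x \<in> H"
  shows "x \<in> H"
proof -
  interpret module R M by fact
  let ?J = "{a \<in> carrier R. a \<odot>\<^bsub>M\<^esub> x \<in> H}"
  have J: "ideal ?J R" by (rule colon_is_ideal[OF H x])
  have "\<one> \<in> ?J"
  proof (rule ccontr)
    assume "\<one> \<notin> ?J"
    then obtain p where p: "primeideal p R" "?J \<subseteq> p" using exists_primeideal[OF J] by blast
    then obtain e q n where "prime_factor R p e q n" using exists_prime_factor by blast
    then show False using loc p prime_factor.e_notin prime_factor.e_closed by fastforce
  qed
  then show ?thesis using x by simp
qed

lemma local_global_zero: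
  assumes "module R M" and x: "x \<in> carrier M"
    and loc: "\<And>p e q n. prime_factor R p e q n \<Longrightarrow> e \<odot>\<^bsub>M\<^esub> x = \<zero>\<^bsub>M\<^esub>"
  shows "x = \<zero>\<^bsub>M\<^esub>"
proof -
  interpret module R M by fact
  have "submodule {\<zero>\<^bsub>M\<^esub>} R M" by (rule submoduleI) auto
  from local_global[OF module_axioms this x] loc show ?thesis by simp
qed

text \<open>On each \<open>e R\<close> the elements \<open>r\<close> and \<open>s\<close> are
  \<open>q^k\<close> and \<open>q^l\<close> up to units; let \<open>q^d\<close> be the first power
  that vanishes there. If \<open>k < d\<close>, then \<open>q^{d-k}\<close> annihilates
  \<open>r\<close>, hence \<open>s\<close>, and the minimality of \<open>d\<close> forces
  \<open>l \<ge> k\<close>. All self-injectivity of \<open>R\<close> that is used below rests on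
  this.\<close>

lemma double_annihilator:
  assumes r: "r \<in> carrier R" and s: "s \<in> carrier R"
    and ann: "\<And>a. a \<in> carrier R \<Longrightarrow> a \<otimes> r = \<zero> \<Longrightarrow> a \<otimes> s = \<zero>"
  shows "s \<in> PIdl r"
proof -
  interpret reg: module R "regular_module R" by (rule module_regular)
  have sub: "submodule (PIdl r) R (regular_module R)"
  proof (rule reg.submoduleI)
    interpret i: ideal "PIdl r" R using r by (rule cgenideal_ideal)
    have inv: "\<ominus>\<^bsub>regular_module R\<^esub> a = \<ominus> a" for a
      unfolding a_inv_def m_inv_def by simp
    show "PIdl r \<subseteq> carrier (regular_module R)" using i.a_subset by simp
  qed (use ideal.I_l_closed[OF cgenideal_ideal[OF r]] 
      additive_subgroup.a_inv_closed[OF ideal.axioms(1)[OF cgenideal_ideal[OF r]]]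
      additive_subgroup.a_closed[OF ideal.axioms(1)[OF cgenideal_ideal[OF r]]]
      additive_subgroup.zero_closed[OF ideal.axioms(1)[OF cgenideal_ideal[OF r]]]
      in \<open>auto simp: a_inv_def m_inv_def\<close>)
  show ?thesis
  proof (rule local_global[OF reg.module_axioms sub])
    fix p e q n assume "prime_factor R p e q n"
    then interpret prime_factor R p e q n .
    define d where "d = (LEAST d. e \<otimes> q [^] (d::nat) = \<zero>)"
    have d: "e \<otimes> q [^] d = \<zero>" unfolding d_def using e_pow_n by (rule LeastI)
    have least: "e \<otimes> q [^] k \<noteq> \<zero>" if "k < d" for k :: nat using that not_less_Least unfolding d_def by blast
    have dge: "e \<otimes> q [^] k = \<zero>" if "k \<ge> d" for k :: nat
    proof -
      have "e \<otimes> q [^] k = (e \<otimes> q [^] d) \<otimes> q [^] (k - d)" using that by (simp add: m_assoc nat_pow_mult)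
      then show ?thesis using d by simp
    qed
    obtain k :: nat and u v where u: "u \<in> carrier R" "v \<in> carrier R" "u \<otimes> v \<otimes> e = e"
      and er: "e \<otimes> r = e \<otimes> (q [^] k \<otimes> u)" using factor[OF r] by blast
    obtain l :: nat and u' v' where u': "u' \<in> carrier R" "v' \<in> carrier R" "u' \<otimes> v' \<otimes> e = e"
      and es: "e \<otimes> s = e \<otimes> (q [^] l \<otimes> u')" using factor[OF s] by blast
    have "e \<otimes> s \<in> PIdl r"
    proof (cases "l \<ge> k \<or> k \<ge> d")
      case True
      \<comment> \<open>The alternative \<open>e s = 0\<close> belongs to \<open>k \<ge> d\<close>:
        there \<open>e r = 0\<close>, and the hypothesis applies to \<open>a = e\<close>.\<close>
      then have "\<exists>c\<in>carrier R. e \<otimes> q [^] l = e \<otimes> q [^] k \<otimes> c \<or> e \<otimes> s = \<zero>"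
      proof
        assume "l \<ge> k"
        then have "e \<otimes> q [^] l = e \<otimes> q [^] k \<otimes> q [^] (l - k)" by (simp add: m_assoc nat_pow_mult)
        then show ?thesis by (intro bexI[of _ "q [^] (l - k)"]) auto
      next
        assume "k \<ge> d"
        then have "e \<otimes> r = (e \<otimes> q [^] k) \<otimes> u" using u er by (simp add: m_assoc)
        then have "e \<otimes> r = \<zero>" using dge[OF \<open>k \<ge> d\<close>] u by simp
        then have "e \<otimes> s = \<zero>" by (rule ann[OF e_closed])
        then show ?thesis by blast
      qed
      then obtain c where c: "c \<in> carrier R" "e \<otimes> q [^] l = e \<otimes> q [^] k \<otimes> c \<or> e \<otimes> s = \<zero>" by blast
      show ?thesis
      proof (cases "e \<otimes> s = \<zero>")
        case True
        then show ?thesis using additive_subgroup.zero_closed[OF ideal.axioms(1)[OF cgenideal_ideal[OF r]]] by simp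
      next
        case False
        have "e \<otimes> s = (e \<otimes> q [^] l) \<otimes> u'" using u' es by (simp add: m_assoc)
        also have "e \<otimes> q [^] l = (u \<otimes> v \<otimes> e) \<otimes> q [^] k \<otimes> c" using c(2) False u(3) by simp
        also have "\<dots> \<otimes> u' = (v \<otimes> c \<otimes> u') \<otimes> (e \<otimes> (q [^] k \<otimes> u))" using u(1,2) c(1) u'(1) by (simp add: m_ac)
        also have "\<dots> = (v \<otimes> c \<otimes> u' \<otimes> e) \<otimes> r" unfolding er[symmetric] using u(1,2) c(1) u'(1) r by (simp add: m_ac)
        finally show ?thesis unfolding cgenideal_def using u(2) c(1) u'(1) by blast
      qed
    next
      case False
      \<comment> \<open>The remaining case \<open>l < k < d\<close> is contradictory:
        \<open>e q^{d-k+l}\<close> would vanish with an exponent below \<open>d\<close>.\<close>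
      have "(e \<otimes> q [^] (d - k)) \<otimes> r = q [^] (d - k) \<otimes> (e \<otimes> r)" using r by (simp add: m_ac)
      also have "\<dots> = (e \<otimes> (q [^] (d - k) \<otimes> q [^] k)) \<otimes> u" unfolding er using u(1) by (simp add: m_ac)
      also have "\<dots> = \<zero>" using False u(1) d by (simp add: nat_pow_mult)
      finally have 0: "(e \<otimes> q [^] (d - k)) \<otimes> s = \<zero>" using ann by simp
      have "e \<otimes> q [^] (d - k + l) = (u' \<otimes> v' \<otimes> e) \<otimes> (q [^] (d - k) \<otimes> q [^] l)" using u'(3) by (simp add: nat_pow_mult)
      also have "\<dots> = v' \<otimes> q [^] (d - k) \<otimes> (e \<otimes> (q [^] l \<otimes> u'))" using u'(1,2) by (simp add: m_ac)
      also have "\<dots> = v' \<otimes> ((e \<otimes> q [^] (d - k)) \<otimes> s)" unfolding es[symmetric] using u'(2) s by (simp add: m_ac)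
      finally have "e \<otimes> q [^] (d - k + l) = \<zero>" using 0 u'(2) by simp
      moreover have "d - k + l < d" using False by linarith
      ultimately show ?thesis using least by blast
    qed
    then show "e \<odot>\<^bsub>regular_module R\<^esub> s \<in> PIdl r" by simp
  qed (use s in simp)
qed

section \<open>The socle\<close>

lemma exists_radical_generator:
  "\<exists>s\<in>carrier R. \<forall>a\<in>carrier R. a \<in> PIdl s \<longleftrightarrow> (\<forall>p. primeideal p R \<longrightarrow> a \<in> p)"
proof -
  let ?J = "{a \<in> carrier R. \<forall>p. primeideal p R \<longrightarrow> a \<in> p}"
  have "ideal ?J R"
  proof (rule idealI[OF ring_axioms])
    have sub: "additive_subgroup p R" if "primeideal p R" for p
      using that by (intro ideal.axioms(1) primeideal.axioms(1))
    show "subgroup ?J (add_monoid R)"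
    proof (rule subgroup.intro)
      show "inv\<^bsub>add_monoid R\<^esub> x \<in> ?J" if "x \<in> ?J" for x
        using that additive_subgroup.a_inv_closed[OF sub] unfolding a_inv_def[symmetric] by simp
      show "x \<otimes>\<^bsub>add_monoid R\<^esub> y \<in> ?J" if "x \<in> ?J" "y \<in> ?J" for x y
        using that additive_subgroup.a_closed[OF sub] by simp
      show "\<one>\<^bsub>add_monoid R\<^esub> \<in> ?J" using additive_subgroup.zero_closed[OF sub] by simp
    qed auto
    show "b \<otimes> a \<in> ?J" "a \<otimes> b \<in> ?J" if "a \<in> ?J" "b \<in> carrier R" for a b
      using that by (auto dest: primeideal.axioms(1) intro: ideal.I_l_closed ideal.I_r_closed)
  qed
  from ideal_PIdl[OF this] obtain s where "s \<in> carrier R" "?J = PIdl s" by blast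
  then show ?thesis by (intro bexI[of _ s]) auto
qed

end

locale radical_generator = artinian_pir R for R (structure) and s +
  assumes s_closed [simp]: "s \<in> carrier R"
    and radical: "\<And>a. a \<in> carrier R \<Longrightarrow> a \<in> PIdl s \<longleftrightarrow> (\<forall>p. primeideal p R \<longrightarrow> a \<in> p)"
begin

text \<open>Every prime contains \<open>e\<close> or \<open>q\<close>, because
  \<open>e q^n = 0\<close>, so \<open>e q\<close> lies in the intersection \<open>(s)\<close> of all
  primes; conversely \<open>(s)\<close> is contained in \<open>p = (q)\<close>.\<close>

lemma prime_factor_radical:
  assumes "prime_factor R p e q n"
  shows "\<exists>c\<in>carrier R. e \<otimes> q = c \<otimes> s" "\<exists>c\<in>carrier R. s = c \<otimes> q"
proof -
  interpret prime_factor R p e q n by fact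
  have "e \<otimes> q \<in> p'" if "primeideal p' R" for p'
  proof -
    interpret p': primeideal p' R by fact
    have "e \<in> p' \<or> q [^] n \<in> p'" using p'.I_prime[of e "q [^] n"] e_pow_n by simp
    then show ?thesis using p'.nilpotent_mem[of q n] p'.I_l_closed p'.I_r_closed by auto
  qed
  then show "\<exists>c\<in>carrier R. e \<otimes> q = c \<otimes> s" using radical[of "e \<otimes> q"] unfolding cgenideal_def by auto
  have "s \<in> p" using radical[OF s_closed] cgenideal_self[OF s_closed] prime by blast
  then show "\<exists>c\<in>carrier R. s = c \<otimes> q" unfolding p_eq cgenideal_def by auto
qed

text \<open>\<open>s e\<close> and \<open>e q\<close> are multiples of each other. The exponent
  \<open>1\<close> is written out to match the kernel scalar \<open>e q^j\<close>.\<close>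

lemma kernel_radical:
  assumes "prime_factor R p e q n" "module R M" and x: "x \<in> carrier M"
  shows "(s \<otimes> e) \<odot>\<^bsub>M\<^esub> x = \<zero>\<^bsub>M\<^esub> \<longleftrightarrow> (e \<otimes> q [^] (1::nat)) \<odot>\<^bsub>M\<^esub> x = \<zero>\<^bsub>M\<^esub>"
proof -
  interpret prime_factor R p e q n by fact
  interpret module R M by fact
  obtain c where c: "c \<in> carrier R" "e \<otimes> q = c \<otimes> s" using prime_factor_radical(1)[OF assms(1)] by blast
  obtain d where d: "d \<in> carrier R" "s = d \<otimes> q" using prime_factor_radical(2)[OF assms(1)] by blast
  have "s \<otimes> e = d \<otimes> (e \<otimes> q)" using d by (simp add: m_ac)
  then have 1: "(s \<otimes> e) \<odot>\<^bsub>M\<^esub> x = d \<odot>\<^bsub>M\<^esub> ((e \<otimes> q) \<odot>\<^bsub>M\<^esub> x)" using d x by (simp add: smult_assoc1)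
  have "e \<otimes> q = e \<otimes> (e \<otimes> q)" using e_idem by (simp add: m_assoc[symmetric])
  also have "\<dots> = c \<otimes> (s \<otimes> e)" unfolding c(2) using c(1) by (simp add: m_ac)
  finally have 2: "(e \<otimes> q) \<odot>\<^bsub>M\<^esub> x = c \<odot>\<^bsub>M\<^esub> ((s \<otimes> e) \<odot>\<^bsub>M\<^esub> x)" using c x by (simp add: smult_assoc1)
  show ?thesis using 1 2 c(1) d(1) by auto
qed

text \<open>For a simple \<open>H\<close> the submodule \<open>s H\<close> is \<open>0\<close> or
  \<open>H\<close>, and \<open>s^k H = H\<close> for all \<open>k\<close> is impossible unless
  \<open>H = 0\<close>, since \<open>s\<close> is nilpotent at every prime. Conversely, if
  \<open>s x = 0\<close>, then \<open>e x\<close> is killed by \<open>q\<close>, and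
  \<open>R e x\<close> is zero or simple because a scalar acts on it through zero or a unit; the
  local pieces are then reassembled.\<close>

lemma Soc_eq_tors:
  assumes "module R M"
  shows "Soc R M = tors M {s}"
proof
  interpret module R M by fact
  have tors: "submodule (tors M {s}) R M" by (intro tors_submodule) simp
  have simp_sub: "\<Union>{H. simple_submodule H R M} \<subseteq> carrier M"
    unfolding simple_submodule_def using submoduleE(1) by blast
  show "Soc R M \<subseteq> tors M {s}" unfolding Soc_def
  proof (rule submodule_gen_minimal[OF tors], rule Union_least)
    fix H assume "H \<in> {H. simple_submodule H R M}"
    then have H: "submodule H R M" and min: "\<And>K. submodule K R M \<Longrightarrow> K \<subseteq> H \<Longrightarrow> K = {\<zero>\<^bsub>M\<^esub>} \<or> K = H"
      unfolding simple_submodule_def by auto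
    note HM = submoduleE(1)[OF H]
    let ?K = "(\<odot>\<^bsub>M\<^esub>) s ` H"
    have "?K = {\<zero>\<^bsub>M\<^esub>} \<or> ?K = H"
      using submoduleE(4)[OF H] by (intro min scalar_image_submodule[OF H]) auto
    then show "H \<subseteq> tors M {s}"
    proof
      assume K: "?K = H"
      have pow: "(\<odot>\<^bsub>M\<^esub>) (s [^] k) ` H = H" for k :: nat
      proof (induction k)
        case 0 
        have "(\<odot>\<^bsub>M\<^esub>) (s [^] (0::nat)) ` H = (\<lambda>x. x) ` H" using HM by (intro image_cong) auto
        then show ?case by simp
      next
        case (Suc k)
        have "(\<odot>\<^bsub>M\<^esub>) (s [^] Suc k) ` H = (\<odot>\<^bsub>M\<^esub>) (s [^] k) ` (\<odot>\<^bsub>M\<^esub>) s ` H"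
          unfolding image_image using HM by (intro image_cong) (auto simp: smult_assoc1)
        then show ?case using K Suc by simp
      qed
      have "h = \<zero>\<^bsub>M\<^esub>" if h: "h \<in> H" for h
      proof (rule local_global_zero[OF module_axioms])
        show "h \<in> carrier M" using h HM by blast
        fix p e q n assume pf: "prime_factor R p e q n"
        then interpret prime_factor R p e q n .
        obtain d where d: "d \<in> carrier R" "s = d \<otimes> q" using prime_factor_radical(2)[OF pf] by blast
        have "h \<in> (\<odot>\<^bsub>M\<^esub>) (s [^] n) ` H" using h pow by blast
        then obtain z where z: "z \<in> H" "h = s [^] n \<odot>\<^bsub>M\<^esub> z" by blast
        have "e \<otimes> s [^] n = d [^] n \<otimes> (e \<otimes> q [^] n)" unfolding d(2) using d(1) by (simp add: nat_pow_distrib m_ac)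
        then have "e \<otimes> s [^] n = \<zero>" using e_pow_n d(1) by simp
        moreover have "e \<odot>\<^bsub>M\<^esub> h = (e \<otimes> s [^] n) \<odot>\<^bsub>M\<^esub> z" using z HM by (auto simp: smult_assoc1)
        ultimately show "e \<odot>\<^bsub>M\<^esub> h = \<zero>\<^bsub>M\<^esub>" using z HM by auto
      qed
      then show ?thesis using submodule_zero_closed[OF tors] by blast
    qed (use HM in \<open>auto simp: tors_def\<close>)
  qed
  show "tors M {s} \<subseteq> Soc R M"
  proof
    fix x assume "x \<in> tors M {s}"
    then have x: "x \<in> carrier M" and sx: "s \<odot>\<^bsub>M\<^esub> x = \<zero>\<^bsub>M\<^esub>" unfolding tors_def by auto
    have Soc: "submodule (Soc R M) R M" unfolding Soc_def by (rule submodule_gen_submodule[OF simp_sub])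
    show "x \<in> Soc R M"
    proof (rule local_global[OF module_axioms Soc x])
      fix p e q n assume pf: "prime_factor R p e q n"
      then interpret prime_factor R p e q n .
      obtain c where c: "c \<in> carrier R" "e \<otimes> q = c \<otimes> s" using prime_factor_radical(1)[OF pf] by blast
      have eqx: "(e \<otimes> q) \<odot>\<^bsub>M\<^esub> x = \<zero>\<^bsub>M\<^esub>" unfolding c(2) using c(1) x sx by (simp add: smult_assoc1)
      let ?H = "(\<lambda>a. a \<odot>\<^bsub>M\<^esub> (e \<odot>\<^bsub>M\<^esub> x)) ` carrier R"
      have exH: "e \<odot>\<^bsub>M\<^esub> x \<in> ?H" using x by (intro image_eqI[of _ _ \<one>]) auto
      have H: "submodule ?H R M" using x by (intro cyclic_submodule) simp
      show "e \<odot>\<^bsub>M\<^esub> x \<in> Soc R M"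
      proof (cases "?H = {\<zero>\<^bsub>M\<^esub>}")
        case True
        then have "e \<odot>\<^bsub>M\<^esub> x = \<zero>\<^bsub>M\<^esub>" using exH by blast
        then show ?thesis using submodule_zero_closed[OF Soc] by simp
      next
        case False
        have "K = ?H" if K: "submodule K R M" "K \<subseteq> ?H" "K \<noteq> {\<zero>\<^bsub>M\<^esub>}" for K
        proof -
          obtain y where y: "y \<in> K" "y \<noteq> \<zero>\<^bsub>M\<^esub>" using K(3) submodule_zero_closed[OF K(1)] by blast
          then obtain a where a: "a \<in> carrier R" "y = a \<odot>\<^bsub>M\<^esub> (e \<odot>\<^bsub>M\<^esub> x)" using K(2) by blast
          obtain k :: nat and u v where u: "u \<in> carrier R" "v \<in> carrier R" "u \<otimes> v \<otimes> e = e"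
            and ea: "e \<otimes> a = e \<otimes> (q [^] k \<otimes> u)" using factor[OF a(1)] by blast
          have ya: "y = (e \<otimes> a) \<odot>\<^bsub>M\<^esub> x" using a x by (simp add: smult_assoc1[symmetric] m_comm)
          \<comment> \<open>A factor \<open>q\<close> in \<open>a\<close> would kill
            \<open>y\<close>. So \<open>a\<close> is a unit on \<open>e R\<close>, and
            \<open>K\<close> recovers \<open>e x\<close> from \<open>y\<close>.\<close>
          have "k = 0"
          proof (rule ccontr)
            assume "k \<noteq> 0"
            then obtain k' where "k = Suc k'" using not0_implies_Suc by blast
            then have "e \<otimes> a = (q [^] k' \<otimes> u) \<otimes> (e \<otimes> q)" using ea u(1) by (simp add: m_ac)
            then have "y = \<zero>\<^bsub>M\<^esub>" using ya eqx u(1) x by (simp add: smult_assoc1)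
            then show False using y(2) by blast
          qed
          then have "v \<odot>\<^bsub>M\<^esub> y = (u \<otimes> v \<otimes> e) \<odot>\<^bsub>M\<^esub> x"
            unfolding ya ea using u(1,2) x by (simp add: smult_assoc1[symmetric] m_ac)
          then have "e \<odot>\<^bsub>M\<^esub> x = v \<odot>\<^bsub>M\<^esub> y" using u(3) by simp
          then have "e \<odot>\<^bsub>M\<^esub> x \<in> K" using submoduleE(4)[OF K(1) u(2) y(1)] by simp
          then have "?H \<subseteq> K" using submoduleE(4)[OF K(1)] by blast
          then show ?thesis using K(2) by blast
        qed
        then have "simple_submodule ?H R M" unfolding simple_submodule_def using H False by blast
        then have "?H \<subseteq> \<Union>{H. simple_submodule H R M}" by (intro Union_upper) simp
        also have "\<dots> \<subseteq> Soc R M" unfolding Soc_def by (rule submodule_gen_incl)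
        finally have "?H \<subseteq> Soc R M" .
        then show ?thesis using exH by blast
      qed
    qed
  qed
qed

end


section \<open>Non-degenerate forms\<close>

lemma (in form_module) nondegenerate_iff:
  "nondegenerate R M N B \<longleftrightarrow>
    (\<forall>x\<in>carrier M. (\<forall>y\<in>carrier M. B x y = \<zero>\<^bsub>N\<^esub>) \<longrightarrow> x = \<zero>\<^bsub>M\<^esub>) \<and>
    (\<forall>f\<in>module_hom R M N. \<exists>x\<in>carrier M. \<forall>y\<in>carrier M. f y = B x y)"
proof -
  let ?\<Phi> = "\<lambda>x\<in>carrier M. \<lambda>y\<in>carrier M. B x y"
  have hom: "(\<lambda>y\<in>carrier M. B x y) \<in> module_hom R M N" if "x \<in> carrier M" for x
    using that unfolding module_hom_def by auto
  have 1: "?\<Phi> \<in> module_hom R M (hom_module R M N)"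
    using hom unfolding module_hom_def[of R M "hom_module R M N"]
    by (auto simp: hom_module_def fun_eq_iff restrict_def)
  have 2: "inj_on ?\<Phi> (carrier M) \<longleftrightarrow> (\<forall>x\<in>carrier M. (\<forall>y\<in>carrier M. B x y = \<zero>\<^bsub>N\<^esub>) \<longrightarrow> x = \<zero>\<^bsub>M\<^esub>)"
  proof
    assume inj: "inj_on ?\<Phi> (carrier M)"
    show "\<forall>x\<in>carrier M. (\<forall>y\<in>carrier M. B x y = \<zero>\<^bsub>N\<^esub>) \<longrightarrow> x = \<zero>\<^bsub>M\<^esub>"
    proof (intro ballI impI)
      fix x assume x: "x \<in> carrier M" "\<forall>y\<in>carrier M. B x y = \<zero>\<^bsub>N\<^esub>"
      then have "?\<Phi> x = ?\<Phi> \<zero>\<^bsub>M\<^esub>" by (auto simp: fun_eq_iff restrict_def)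
      then show "x = \<zero>\<^bsub>M\<^esub>" using inj_onD[OF inj _ x(1) M.zero_closed] by blast
    qed
  next
    assume z: "\<forall>x\<in>carrier M. (\<forall>y\<in>carrier M. B x y = \<zero>\<^bsub>N\<^esub>) \<longrightarrow> x = \<zero>\<^bsub>M\<^esub>"
    show "inj_on ?\<Phi> (carrier M)"
    proof (rule inj_onI)
      fix x x' assume x: "x \<in> carrier M" "x' \<in> carrier M" and eq: "?\<Phi> x = ?\<Phi> x'"
      have "B x y = B x' y" if "y \<in> carrier M" for y
        using fun_cong[OF eq, of y] x that by simp
      then have "B (x \<ominus>\<^bsub>M\<^esub> x') y = \<zero>\<^bsub>N\<^esub>" if "y \<in> carrier M" for y using x that by simp
      then have "x \<ominus>\<^bsub>M\<^esub> x' = \<zero>\<^bsub>M\<^esub>" using z x by (meson M.minus_closed)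
      then show "x = x'" using x by simp
    qed
  qed
  have 3: "?\<Phi> ` carrier M = carrier (hom_module R M N) \<longleftrightarrow>
    (\<forall>f\<in>module_hom R M N. \<exists>x\<in>carrier M. \<forall>y\<in>carrier M. f y = B x y)"
  proof -
    have "f = ?\<Phi> x \<longleftrightarrow> (\<forall>y\<in>carrier M. f y = B x y)" if "f \<in> module_hom R M N" "x \<in> carrier M" for f x
    proof -
      have "f \<in> extensional (carrier M)" using that unfolding module_hom_def by (auto simp: PiE_iff)
      then show ?thesis using that(2) by (auto simp: fun_eq_iff restrict_def extensional_def)
    qed
    then have "module_hom R M N \<subseteq> ?\<Phi> ` carrier M \<longleftrightarrow>
      (\<forall>f\<in>module_hom R M N. \<exists>x\<in>carrier M. \<forall>y\<in>carrier M. f y = B x y)" by (auto simp: image_iff) blast+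
    moreover have "?\<Phi> ` carrier M \<subseteq> module_hom R M N" using hom by auto
    ultimately show ?thesis by (auto simp: hom_module_def)
  qed
  show ?thesis unfolding nondegenerate_def module_iso_def bij_betw_def using 1 2 3 by simp
qed

lemma nondegenerate_image:
  assumes fp: "form_presentation R M N B c R2 M2 N2 B2 \<phi> h g" and cc: "c \<otimes>\<^bsub>R\<^esub> c = c"
    and nd: "nondegenerate R M N B"
  shows "nondegenerate R2 M2 N2 B2"
proof -
  note p = form_presentationD[OF fp]
  interpret fm: form_module R M N B by (rule p(1))
  interpret pm: presentation R M c R2 M2 \<phi> h by (rule p(2))
  interpret pn: presentation R N c R2 N2 \<phi> g by (rule p(3))
  interpret fm2: form_module R2 M2 N2 B2 by (rule form_presentation_image[OF fp])
  note nd' = nd[unfolded fm.nondegenerate_iff]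
  have ccN: "c \<odot>\<^bsub>N\<^esub> (c \<odot>\<^bsub>N\<^esub> n) = c \<odot>\<^bsub>N\<^esub> n" if "n \<in> carrier N" for n
    using that by (simp add: fm.N.smult_assoc1[symmetric] cc)
  have inj: "h x = \<zero>\<^bsub>M2\<^esub>" if x: "x \<in> carrier M" and 0: "\<And>y. y \<in> carrier M \<Longrightarrow> B2 (h x) (h y) = \<zero>\<^bsub>N2\<^esub>" for x
  proof -
    have "B (c \<odot>\<^bsub>M\<^esub> x) y = \<zero>\<^bsub>N\<^esub>" if "y \<in> carrier M" for y
      using 0[OF that] x that p(4)[OF x that] pn.h_ker[of "B x y"] by simp
    then have "c \<odot>\<^bsub>M\<^esub> x = \<zero>\<^bsub>M\<^esub>" using nd' x by (meson fm.smult_closed pm.c_closed)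
    then show ?thesis using pm.h_ker[OF x] by simp
  qed
  have surj: "\<exists>x\<in>carrier M. \<forall>y\<in>carrier M. f (h y) = B2 (h x) (h y)" if f: "f \<in> module_hom R2 M2 N2" for f
  proof -
    have fN: "f y \<in> carrier N2" if "y \<in> carrier M2" for y using f that unfolding module_hom_def by auto
    have fa: "f (x \<oplus>\<^bsub>M2\<^esub> y) = f x \<oplus>\<^bsub>N2\<^esub> f y" if "x \<in> carrier M2" "y \<in> carrier M2" for x y
      using f that unfolding module_hom_def by auto
    have fs: "f (a \<odot>\<^bsub>M2\<^esub> y) = a \<odot>\<^bsub>N2\<^esub> f y" if "a \<in> carrier R2" "y \<in> carrier M2" for a y
      using f that unfolding module_hom_def by auto
    define l where "l y = (SOME n. n \<in> carrier N \<and> g n = f (h y))" for y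
    have l: "l y \<in> carrier N" "g (l y) = f (h y)" if y: "y \<in> carrier M" for y
    proof -
      have "\<exists>n. n \<in> carrier N \<and> g n = f (h y)" using pn.h_obtain[of "f (h y)"] fN y by (metis pm.h_closed)
      from someI_ex[OF this] show "l y \<in> carrier N" "g (l y) = f (h y)" unfolding l_def by auto
    qed
    \<comment> \<open>Multiplication by \<open>c\<close> makes the choice of the lift
      \<open>l y\<close> irrelevant, which gives linearity. Since \<open>c\<close> is idempotent,
      \<open>g\<close> maps \<open>c (l y)\<close> and \<open>l y\<close> to the same element, so
      \<open>?f\<close> still lies over \<open>f\<close>.\<close>
    let ?f = "\<lambda>y\<in>carrier M. c \<odot>\<^bsub>N\<^esub> l y"
    have uniq: "c \<odot>\<^bsub>N\<^esub> l y = c \<odot>\<^bsub>N\<^esub> n" if "y \<in> carrier M" "n \<in> carrier N" "g n = f (h y)" for y n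
      using pn.h_eq_iff[of "l y" n] l that by simp
    have "?f \<in> module_hom R M N" unfolding module_hom_def
    proof (intro CollectI conjI ballI)
      show "?f \<in> carrier M \<rightarrow>\<^sub>E carrier N" using l by auto
      fix x y assume xy: "x \<in> carrier M" "y \<in> carrier M"
      have "c \<odot>\<^bsub>N\<^esub> l (x \<oplus>\<^bsub>M\<^esub> y) = c \<odot>\<^bsub>N\<^esub> (l x \<oplus>\<^bsub>N\<^esub> l y)"
        by (rule uniq) (use xy l fa in auto)
      then show "?f (x \<oplus>\<^bsub>M\<^esub> y) = ?f x \<oplus>\<^bsub>N\<^esub> ?f y" using xy l by (simp add: fm.N.smult_r_distr)
    next
      fix a y assume a: "a \<in> carrier R" and y: "y \<in> carrier M"
      have "c \<odot>\<^bsub>N\<^esub> l (a \<odot>\<^bsub>M\<^esub> y) = c \<odot>\<^bsub>N\<^esub> (a \<odot>\<^bsub>N\<^esub> l y)"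
        by (rule uniq) (use a y l fs in auto)
      then show "?f (a \<odot>\<^bsub>M\<^esub> y) = a \<odot>\<^bsub>N\<^esub> ?f y" using a y l by (simp add: fm.N.smult_left_comm)
    qed
    then obtain x where x: "x \<in> carrier M" "\<forall>y\<in>carrier M. ?f y = B x y" using nd' by blast
    have "f (h y) = B2 (h x) (h y)" if y: "y \<in> carrier M" for y
    proof -
      have "B x y = c \<odot>\<^bsub>N\<^esub> l y" using x(2) y by simp
      moreover have "g (c \<odot>\<^bsub>N\<^esub> l y) = g (l y)"
        using pn.h_eq_iff[of "c \<odot>\<^bsub>N\<^esub> l y" "l y"] l(1)[OF y] ccN by simp
      ultimately show ?thesis using p(4)[OF x(1) y] l(2)[OF y] by simp
    qed
    then show ?thesis using x(1) by blast
  qed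
  show ?thesis unfolding fm2.nondegenerate_iff pm.h_surj[symmetric] using inj surj by auto
qed

section \<open>Extension of functionals and biduality of submodules\<close>

locale perfect_form = form_module R M N B + artinian_pir R for R (structure) and M (structure) and N (structure) and B +
  assumes fin_gen: "fin_gen_module R M" and N_iso: "is_module_iso R N (regular_module R)"
    and nondeg: "nondegenerate R M N B"
begin

lemma N_coordinate:
  obtains f where "\<And>a x. a \<in> carrier R \<Longrightarrow> x \<in> carrier N \<Longrightarrow> f (a \<odot>\<^bsub>N\<^esub> x) = a \<otimes> f x"
    and "f \<zero>\<^bsub>N\<^esub> = \<zero>" and "bij_betw f (carrier N) (carrier R)"
proof -
  obtain f where f: "f \<in> module_hom R N (regular_module R)" and bij: "bij_betw f (carrier N) (carrier R)"
    using N_iso unfolding is_module_iso_def module_iso_def by auto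
  have fs: "f (a \<odot>\<^bsub>N\<^esub> x) = a \<otimes> f x" if "a \<in> carrier R" "x \<in> carrier N" for a x
    using f that unfolding module_hom_def by auto
  moreover have "f \<zero>\<^bsub>N\<^esub> = \<zero>" using fs[of \<zero> "\<zero>\<^bsub>N\<^esub>"] bij_betwE[OF bij] by simp
  ultimately show ?thesis using that bij by blast
qed

text \<open>The isomorphism \<open>N \<cong> R\<close> reduces this to the double annihilator
  property: the coordinate of \<open>n\<close> lies in \<open>(r)\<close>.\<close>

lemma N_divisible:
  assumes r: "r \<in> carrier R" and n: "n \<in> carrier N"
    and ann: "\<And>a. a \<in> carrier R \<Longrightarrow> a \<otimes> r = \<zero> \<Longrightarrow> a \<odot>\<^bsub>N\<^esub> n = \<zero>\<^bsub>N\<^esub>"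
  shows "\<exists>c\<in>carrier N. n = r \<odot>\<^bsub>N\<^esub> c"
proof -
  obtain f where fs: "\<And>a x. a \<in> carrier R \<Longrightarrow> x \<in> carrier N \<Longrightarrow> f (a \<odot>\<^bsub>N\<^esub> x) = a \<otimes> f x"
    and f0: "f \<zero>\<^bsub>N\<^esub> = \<zero>" and bij: "bij_betw f (carrier N) (carrier R)" by (rule N_coordinate) blast
  have "f n \<in> PIdl r"
  proof (rule double_annihilator[OF r])
    show "f n \<in> carrier R" using bij_betwE[OF bij] n by blast
    fix a assume "a \<in> carrier R" "a \<otimes> r = \<zero>"
    then show "a \<otimes> f n = \<zero>" using ann[of a] fs[of a n] n f0 by simp
  qed
  then obtain b where b: "b \<in> carrier R" "f n = b \<otimes> r" unfolding cgenideal_def by blast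
  obtain c where c: "c \<in> carrier N" "f c = b" using bij b(1) unfolding bij_betw_def by (metis imageE)
  have "f n = f (r \<odot>\<^bsub>N\<^esub> c)" using fs[OF r c(1)] b c r by (simp add: R.m_comm)
  then have "n = r \<odot>\<^bsub>N\<^esub> c" using inj_onD[OF bij_betw_imp_inj_on[OF bij]] n c(1) r by blast
  then show ?thesis using c(1) by blast
qed

text \<open>If only \<open>0\<close> annihilated \<open>r\<close>, then the double annihilator
  property with \<open>s = \<one>\<close> would give \<open>\<one> \<in> (r)\<close>.\<close>

lemma N_cogenerator:
  assumes r: "r \<in> carrier R" and one: "\<one> \<notin> PIdl r"
  shows "\<exists>c\<in>carrier N. c \<noteq> \<zero>\<^bsub>N\<^esub> \<and> r \<odot>\<^bsub>N\<^esub> c = \<zero>\<^bsub>N\<^esub>"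
proof -
  obtain f where fs: "\<And>a x. a \<in> carrier R \<Longrightarrow> x \<in> carrier N \<Longrightarrow> f (a \<odot>\<^bsub>N\<^esub> x) = a \<otimes> f x"
    and f0: "f \<zero>\<^bsub>N\<^esub> = \<zero>" and bij: "bij_betw f (carrier N) (carrier R)" by (rule N_coordinate) blast
  obtain a where a: "a \<in> carrier R" "a \<otimes> r = \<zero>" "a \<noteq> \<zero>"
    using double_annihilator[OF r one_closed] one by (metis r_one)
  obtain c where c: "c \<in> carrier N" "f c = a" using bij a(1) unfolding bij_betw_def by (metis imageE)
  have "f (r \<odot>\<^bsub>N\<^esub> c) = f \<zero>\<^bsub>N\<^esub>" using fs[OF r c(1)] c a r f0 by (simp add: R.m_comm)
  then have "r \<odot>\<^bsub>N\<^esub> c = \<zero>\<^bsub>N\<^esub>"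
    using inj_onD[OF bij_betw_imp_inj_on[OF bij], of "r \<odot>\<^bsub>N\<^esub> c" "\<zero>\<^bsub>N\<^esub>"] c(1) r by simp
  moreover have "c \<noteq> \<zero>\<^bsub>N\<^esub>" using c(2) a(3) f0 by auto
  ultimately show ?thesis using c(1) by blast
qed

definition linear_on where
  "linear_on H f \<longleftrightarrow> (\<forall>x\<in>H. f x \<in> carrier N) \<and> (\<forall>x\<in>H. \<forall>y\<in>H. f (x \<oplus>\<^bsub>M\<^esub> y) = f x \<oplus>\<^bsub>N\<^esub> f y) \<and>
    (\<forall>a\<in>carrier R. \<forall>x\<in>H. f (a \<odot>\<^bsub>M\<^esub> x) = a \<odot>\<^bsub>N\<^esub> f x)"

text \<open>Two expressions \<open>x + a g\<close> of one element differ by some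
  \<open>b g \<in> H\<close>, where \<open>comp\<close> makes the two values agree.\<close>

lemma linear_on_extend:
  assumes H: "submodule H R M" and f: "linear_on H f" and g: "g \<in> carrier M" and c: "c \<in> carrier N"
    and comp: "\<And>a. a \<in> carrier R \<Longrightarrow> a \<odot>\<^bsub>M\<^esub> g \<in> H \<Longrightarrow> f (a \<odot>\<^bsub>M\<^esub> g) = a \<odot>\<^bsub>N\<^esub> c"
  shows "\<exists>H' f'. submodule H' R M \<and> H \<subseteq> H' \<and> g \<in> H' \<and> linear_on H' f' \<and> (\<forall>x\<in>H. f' x = f x) \<and> f' g = c"
proof -
  note HE = submoduleE[OF H] submodule_zero_closed[OF H]
  have HM: "x \<in> carrier M" if "x \<in> H" for x using that HE(1) by blast
  have fN: "f x \<in> carrier N" if "x \<in> H" for x using f that unfolding linear_on_def by blast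
  have fa: "f (x \<oplus>\<^bsub>M\<^esub> y) = f x \<oplus>\<^bsub>N\<^esub> f y" if "x \<in> H" "y \<in> H" for x y using f that unfolding linear_on_def by blast
  have fs: "f (a \<odot>\<^bsub>M\<^esub> x) = a \<odot>\<^bsub>N\<^esub> f x" if "a \<in> carrier R" "x \<in> H" for a x using f that unfolding linear_on_def by blast
  have f0: "f \<zero>\<^bsub>M\<^esub> = \<zero>\<^bsub>N\<^esub>" using fs[of \<zero> "\<zero>\<^bsub>M\<^esub>"] HE(7) fN[of "\<zero>\<^bsub>M\<^esub>"] by simp
  define H' where "H' = {x \<oplus>\<^bsub>M\<^esub> a \<odot>\<^bsub>M\<^esub> g | x a. x \<in> H \<and> a \<in> carrier R}"
  define f' where "f' y = (THE n. \<exists>x a. x \<in> H \<and> a \<in> carrier R \<and> y = x \<oplus>\<^bsub>M\<^esub> a \<odot>\<^bsub>M\<^esub> g \<and> n = f x \<oplus>\<^bsub>N\<^esub> a \<odot>\<^bsub>N\<^esub> c)" for y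
  have f': "f' (x \<oplus>\<^bsub>M\<^esub> a \<odot>\<^bsub>M\<^esub> g) = f x \<oplus>\<^bsub>N\<^esub> a \<odot>\<^bsub>N\<^esub> c" if x: "x \<in> H" and a: "a \<in> carrier R" for x a
    unfolding f'_def
  proof (rule the_equality)
    show "\<exists>x' a'. x' \<in> H \<and> a' \<in> carrier R \<and> x \<oplus>\<^bsub>M\<^esub> a \<odot>\<^bsub>M\<^esub> g = x' \<oplus>\<^bsub>M\<^esub> a' \<odot>\<^bsub>M\<^esub> g \<and>
      f x \<oplus>\<^bsub>N\<^esub> a \<odot>\<^bsub>N\<^esub> c = f x' \<oplus>\<^bsub>N\<^esub> a' \<odot>\<^bsub>N\<^esub> c" using x a by blast
    fix n assume "\<exists>x' a'. x' \<in> H \<and> a' \<in> carrier R \<and> x \<oplus>\<^bsub>M\<^esub> a \<odot>\<^bsub>M\<^esub> g = x' \<oplus>\<^bsub>M\<^esub> a' \<odot>\<^bsub>M\<^esub> g \<and> n = f x' \<oplus>\<^bsub>N\<^esub> a' \<odot>\<^bsub>N\<^esub> c"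
    then obtain x' a' where x': "x' \<in> H" and a': "a' \<in> carrier R" and eq: "x \<oplus>\<^bsub>M\<^esub> a \<odot>\<^bsub>M\<^esub> g = x' \<oplus>\<^bsub>M\<^esub> a' \<odot>\<^bsub>M\<^esub> g"
      and n: "n = f x' \<oplus>\<^bsub>N\<^esub> a' \<odot>\<^bsub>N\<^esub> c" by blast
    let ?b = "a' \<ominus> a"
    have "x \<oplus>\<^bsub>M\<^esub> a \<odot>\<^bsub>M\<^esub> g = (x' \<oplus>\<^bsub>M\<^esub> ?b \<odot>\<^bsub>M\<^esub> g) \<oplus>\<^bsub>M\<^esub> a \<odot>\<^bsub>M\<^esub> g"
      unfolding eq using HM[OF x'] a a' g
      by (simp add: a_minus_def smult_l_distr[symmetric] M.a_assoc) (simp add: R.a_assoc R.l_neg)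
    then have xx: "x = x' \<oplus>\<^bsub>M\<^esub> ?b \<odot>\<^bsub>M\<^esub> g" using HM[OF x] HM[OF x'] a a' g by simp
    then have "?b \<odot>\<^bsub>M\<^esub> g = x \<ominus>\<^bsub>M\<^esub> x'"
      using HM[OF x'] a a' g by (simp add: a_minus_def M.a_assoc M.a_comm[of x'] M.r_neg)
    then have bH: "?b \<odot>\<^bsub>M\<^esub> g \<in> H" using submodule_minus_closed[OF H x x'] by simp
    have "f x = f x' \<oplus>\<^bsub>N\<^esub> ?b \<odot>\<^bsub>N\<^esub> c" using fa[OF x' bH] comp[OF _ bH] a a' unfolding xx by simp
    then have "f x \<oplus>\<^bsub>N\<^esub> a \<odot>\<^bsub>N\<^esub> c = f x' \<oplus>\<^bsub>N\<^esub> (?b \<odot>\<^bsub>N\<^esub> c \<oplus>\<^bsub>N\<^esub> a \<odot>\<^bsub>N\<^esub> c)" using fN[OF x'] a a' c by (simp add: N.M.a_assoc)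
    also have "?b \<odot>\<^bsub>N\<^esub> c \<oplus>\<^bsub>N\<^esub> a \<odot>\<^bsub>N\<^esub> c = a' \<odot>\<^bsub>N\<^esub> c"
      using a a' c by (simp add: N.smult_l_distr[symmetric]) (simp add: a_minus_def R.a_assoc R.l_neg)
    finally show "n = f x \<oplus>\<^bsub>N\<^esub> a \<odot>\<^bsub>N\<^esub> c" using n by simp
  qed
  have lin: "linear_on H' f'" unfolding linear_on_def
  proof (intro conjI ballI)
    fix y assume "y \<in> H'"
    then obtain x a where x: "x \<in> H" and a: "a \<in> carrier R" and y: "y = x \<oplus>\<^bsub>M\<^esub> a \<odot>\<^bsub>M\<^esub> g" unfolding H'_def by blast
    show "f' y \<in> carrier N" unfolding y f'[OF x a] using fN[OF x] a c by simp
    {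
      fix b assume b: "b \<in> carrier R"
      have "b \<odot>\<^bsub>M\<^esub> y = b \<odot>\<^bsub>M\<^esub> x \<oplus>\<^bsub>M\<^esub> (b \<otimes> a) \<odot>\<^bsub>M\<^esub> g" unfolding y using HM[OF x] a b g by (simp add: smult_r_distr smult_assoc1)
      then have "f' (b \<odot>\<^bsub>M\<^esub> y) = f (b \<odot>\<^bsub>M\<^esub> x) \<oplus>\<^bsub>N\<^esub> (b \<otimes> a) \<odot>\<^bsub>N\<^esub> c" using f'[OF HE(4)[OF b x], of "b \<otimes> a"] a b by simp
      also have "\<dots> = b \<odot>\<^bsub>N\<^esub> f' y" unfolding y f'[OF x a] using fs[OF b x] fN[OF x] a b c by (simp add: N.smult_r_distr N.smult_assoc1)
      finally show "f' (b \<odot>\<^bsub>M\<^esub> y) = b \<odot>\<^bsub>N\<^esub> f' y" .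
    }
    fix y' assume "y' \<in> H'"
    then obtain x' a' where x': "x' \<in> H" and a': "a' \<in> carrier R" and y': "y' = x' \<oplus>\<^bsub>M\<^esub> a' \<odot>\<^bsub>M\<^esub> g" unfolding H'_def by blast
    have "y \<oplus>\<^bsub>M\<^esub> y' = (x \<oplus>\<^bsub>M\<^esub> x') \<oplus>\<^bsub>M\<^esub> (a \<oplus> a') \<odot>\<^bsub>M\<^esub> g"
      unfolding y y' using HM[OF x] HM[OF x'] a a' g by (simp add: smult_l_distr M.a_ac)
    then have "f' (y \<oplus>\<^bsub>M\<^esub> y') = f (x \<oplus>\<^bsub>M\<^esub> x') \<oplus>\<^bsub>N\<^esub> (a \<oplus> a') \<odot>\<^bsub>N\<^esub> c" using f'[OF HE(5)[OF x x'], of "a \<oplus> a'"] a a' by simp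
    also have "\<dots> = f' y \<oplus>\<^bsub>N\<^esub> f' y'"
      unfolding y y' f'[OF x a] f'[OF x' a'] fa[OF x x'] using fN[OF x] fN[OF x'] a a' c by (simp add: N.smult_l_distr N.M.a_ac)
    finally show "f' (y \<oplus>\<^bsub>M\<^esub> y') = f' y \<oplus>\<^bsub>N\<^esub> f' y'" .
  qed
  have ext: "\<forall>x\<in>H. f' x = f x" using f'[of _ \<zero>] HM fN g c by simp
  have gc: "f' g = c" using f'[OF HE(7), of \<one>] f0 g c by simp
  have sub: "submodule H' R M"
  unfolding submodule_iff
  proof (intro conjI ballI)
    show "H' \<subseteq> carrier M" unfolding H'_def using HM g by auto
    show "\<zero>\<^bsub>M\<^esub> \<in> H'" unfolding H'_def using HE(7) g by (auto intro!: exI[of _ "\<zero>\<^bsub>M\<^esub>"] exI[of _ \<zero>])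
    fix y assume "y \<in> H'"
    then obtain x a where x: "x \<in> H" and a: "a \<in> carrier R" and y: "y = x \<oplus>\<^bsub>M\<^esub> a \<odot>\<^bsub>M\<^esub> g" unfolding H'_def by blast
    show "b \<odot>\<^bsub>M\<^esub> y \<in> H'" if b: "b \<in> carrier R" for b
    proof -
      have "b \<odot>\<^bsub>M\<^esub> y = b \<odot>\<^bsub>M\<^esub> x \<oplus>\<^bsub>M\<^esub> (b \<otimes> a) \<odot>\<^bsub>M\<^esub> g" unfolding y using HM[OF x] a b g by (simp add: smult_r_distr smult_assoc1)
      then show ?thesis unfolding H'_def using HE(4)[OF b x] a b by blast
    qed
    fix y' assume "y' \<in> H'"
    then obtain x' a' where x': "x' \<in> H" and a': "a' \<in> carrier R" and y': "y' = x' \<oplus>\<^bsub>M\<^esub> a' \<odot>\<^bsub>M\<^esub> g" unfolding H'_def by blast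
    have "y \<oplus>\<^bsub>M\<^esub> y' = (x \<oplus>\<^bsub>M\<^esub> x') \<oplus>\<^bsub>M\<^esub> (a \<oplus> a') \<odot>\<^bsub>M\<^esub> g"
      unfolding y y' using HM[OF x] HM[OF x'] a a' g by (simp add: smult_l_distr M.a_ac)
    then show "y \<oplus>\<^bsub>M\<^esub> y' \<in> H'" unfolding H'_def using HE(5)[OF x x'] a a' by blast
  qed
  have "H \<subseteq> H'"
  proof
    fix x assume "x \<in> H"
    then have "x = x \<oplus>\<^bsub>M\<^esub> \<zero> \<odot>\<^bsub>M\<^esub> g" using HM g by simp
    then show "x \<in> H'" unfolding H'_def using \<open>x \<in> H\<close> by blast
  qed
  moreover have "g \<in> H'"
  proof -
    have "g = \<zero>\<^bsub>M\<^esub> \<oplus>\<^bsub>M\<^esub> \<one> \<odot>\<^bsub>M\<^esub> g" using g by simp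
    then show ?thesis unfolding H'_def using HE(7) by blast
  qed
  ultimately show ?thesis using sub lin ext gc by blast
qed

lemma colon_ideal:
  assumes H: "submodule H R M" and g: "g \<in> carrier M"
  obtains r where "r \<in> carrier R" "{a \<in> carrier R. a \<odot>\<^bsub>M\<^esub> g \<in> H} = PIdl r"
  using that ideal_PIdl[OF colon_is_ideal[OF H g]] by blast

text \<open>Baer's argument with a principal colon ideal \<open>(H : g) = (r)\<close>: a value
  \<open>c\<close> at \<open>g\<close> has to satisfy \<open>f (r g) = r c\<close> only, and it
  exists because whatever kills \<open>r\<close> kills \<open>f (r g)\<close>.\<close>

lemma linear_on_extend_element:
  assumes H: "submodule H R M" and f: "linear_on H f" and g: "g \<in> carrier M"
  shows "\<exists>H' f'. submodule H' R M \<and> H \<subseteq> H' \<and> g \<in> H' \<and> linear_on H' f' \<and> (\<forall>x\<in>H. f' x = f x)"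
proof -
  obtain r where r: "r \<in> carrier R" "{a \<in> carrier R. a \<odot>\<^bsub>M\<^esub> g \<in> H} = PIdl r" using colon_ideal[OF H g] .
  have rg: "r \<odot>\<^bsub>M\<^esub> g \<in> H" using R.cgenideal_self[OF r(1)] r(2) by blast
  have fs: "f (a \<odot>\<^bsub>M\<^esub> x) = a \<odot>\<^bsub>N\<^esub> f x" if "a \<in> carrier R" "x \<in> H" for a x using f that unfolding linear_on_def by blast
  have fN: "f (r \<odot>\<^bsub>M\<^esub> g) \<in> carrier N" using f rg unfolding linear_on_def by blast
  have "\<exists>c\<in>carrier N. f (r \<odot>\<^bsub>M\<^esub> g) = r \<odot>\<^bsub>N\<^esub> c"
  proof (rule N_divisible[OF r(1) fN])
    fix a assume a: "a \<in> carrier R" "a \<otimes> r = \<zero>"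
    have "a \<odot>\<^bsub>M\<^esub> (r \<odot>\<^bsub>M\<^esub> g) = \<zero>\<^bsub>M\<^esub>" using a r(1) g by (simp add: smult_assoc1[symmetric])
    then have "a \<odot>\<^bsub>N\<^esub> f (r \<odot>\<^bsub>M\<^esub> g) = f \<zero>\<^bsub>M\<^esub>" using fs[OF a(1) rg] by simp
    also have "\<dots> = \<zero> \<odot>\<^bsub>N\<^esub> f (r \<odot>\<^bsub>M\<^esub> g)" using fs[OF R.zero_closed rg] a(2) g r(1) by simp
    finally show "a \<odot>\<^bsub>N\<^esub> f (r \<odot>\<^bsub>M\<^esub> g) = \<zero>\<^bsub>N\<^esub>" using fN by simp
  qed
  then obtain c where c: "c \<in> carrier N" "f (r \<odot>\<^bsub>M\<^esub> g) = r \<odot>\<^bsub>N\<^esub> c" by blast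
  have "f (a \<odot>\<^bsub>M\<^esub> g) = a \<odot>\<^bsub>N\<^esub> c" if a: "a \<in> carrier R" "a \<odot>\<^bsub>M\<^esub> g \<in> H" for a
  proof -
    have "a \<in> PIdl r" using a r(2) by blast
    then obtain b where b: "b \<in> carrier R" "a = b \<otimes> r" unfolding cgenideal_def by blast
    then show ?thesis using fs[OF b(1) rg] c r(1) g by (simp add: smult_assoc1 N.smult_assoc1)
  qed
  from linear_on_extend[OF H f g c(1) this] show ?thesis by blast
qed

lemma linear_on_extend_finite:
  assumes "finite S" "S \<subseteq> carrier M" "submodule H R M" "linear_on H f"
  shows "\<exists>H' f'. submodule H' R M \<and> H \<union> S \<subseteq> H' \<and> linear_on H' f' \<and> (\<forall>x\<in>H. f' x = f x)"
  using assms
proof (induction S arbitrary: H f)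
  case empty then show ?case by blast
next
  case (insert g S)
  obtain H1 f1 where 1: "submodule H1 R M" "H \<subseteq> H1" "g \<in> H1" "linear_on H1 f1" "\<forall>x\<in>H. f1 x = f x"
    using linear_on_extend_element[of H f g] insert.prems by blast
  obtain H2 f2 where "submodule H2 R M" "H1 \<union> S \<subseteq> H2" "linear_on H2 f2" "\<forall>x\<in>H1. f2 x = f1 x"
    using insert.IH[of H1 f1] insert.prems 1 by blast
  then show ?case using 1 by (intro exI[of _ H2] exI[of _ f2]) auto
qed

text \<open>Finite generation lets the extension reach all of \<open>M\<close> in finitely many
  steps; surjectivity in the definition of non-degeneracy then provides \<open>y\<close>.\<close>

lemma linear_on_represented:
  assumes "submodule H R M" "linear_on H f"
  shows "\<exists>y\<in>carrier M. \<forall>x\<in>H. f x = B y x"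
proof -
  obtain S where S: "finite S" "S \<subseteq> carrier M" "submodule_gen R M S = carrier M"
    using fin_gen unfolding fin_gen_module_def by blast
  obtain H' f' where H': "submodule H' R M" "H \<union> S \<subseteq> H'" "linear_on H' f'" "\<forall>x\<in>H. f' x = f x"
    using linear_on_extend_finite[OF S(1,2) assms] by blast
  have "carrier M \<subseteq> H'" using submodule_gen_minimal[OF H'(1), of S] H'(2) S(3) by blast
  then have eq: "H' = carrier M" using submoduleE(1)[OF H'(1)] by blast
  have "restrict f' (carrier M) \<in> module_hom R M N"
    using H'(3) unfolding eq linear_on_def module_hom_def by auto
  then obtain y where "y \<in> carrier M" "\<forall>x\<in>carrier M. restrict f' (carrier M) x = B y x"
    using nondeg unfolding nondegenerate_iff by blast
  moreover have "H \<subseteq> carrier M" using submoduleE(1)[OF assms(1)] .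
  ultimately show ?thesis using H'(4) by (intro bexI[of _ y] ballI) (metis restrict_apply' subsetD)
qed

text \<open>As \<open>(X : x) = (r)\<close> is proper, \<open>N\<close> has some
  \<open>c \<noteq> 0\<close> with \<open>r c = 0\<close>. The functional that is zero on
  \<open>X\<close> and has the value \<open>c\<close> at \<open>x\<close> is consistent, and it is
  represented by an element of \<open>M\<close>.\<close>

lemma separation:
  assumes X: "submodule X R M" and x: "x \<in> carrier M" "x \<notin> X"
  shows "\<exists>y\<in>perp M N B X. B y x \<noteq> \<zero>\<^bsub>N\<^esub>"
proof -
  obtain r where r: "r \<in> carrier R" "{a \<in> carrier R. a \<odot>\<^bsub>M\<^esub> x \<in> X} = PIdl r" using colon_ideal[OF X x(1)] .
  have "\<one> \<notin> PIdl r"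
  proof
    assume "\<one> \<in> PIdl r"
    then have "\<one> \<odot>\<^bsub>M\<^esub> x \<in> X" using r(2) by blast
    then show False using x by simp
  qed
  then obtain c where c: "c \<in> carrier N" "c \<noteq> \<zero>\<^bsub>N\<^esub>" "r \<odot>\<^bsub>N\<^esub> c = \<zero>\<^bsub>N\<^esub>"
    using N_cogenerator[OF r(1)] by blast
  have lin: "linear_on X (\<lambda>_. \<zero>\<^bsub>N\<^esub>)" unfolding linear_on_def by simp
  have comp: "\<zero>\<^bsub>N\<^esub> = a \<odot>\<^bsub>N\<^esub> c" if a: "a \<in> carrier R" "a \<odot>\<^bsub>M\<^esub> x \<in> X" for a
  proof -
    have "a \<in> PIdl r" using a r(2) by blast
    then obtain b where "b \<in> carrier R" "a = b \<otimes> r" unfolding cgenideal_def by blast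
    then show ?thesis using c r(1) by (simp add: N.smult_assoc1)
  qed
  obtain H' f' where H': "submodule H' R M" "X \<subseteq> H'" "x \<in> H'" "linear_on H' f'" "\<forall>z\<in>X. f' z = \<zero>\<^bsub>N\<^esub>" "f' x = c"
    using linear_on_extend[OF X lin x(1) c(1) comp] by blast
  obtain y where y: "y \<in> carrier M" "\<forall>z\<in>H'. f' z = B y z" using linear_on_represented[OF H'(1,4)] by blast
  have "B y z = \<zero>\<^bsub>N\<^esub>" if "z \<in> X" for z using that y(2) H'(2,5) by (metis subsetD)
  moreover have "B y x = c" using y(2) H'(3,6) by metis
  ultimately show ?thesis using y(1) c(2) unfolding perp_def by (intro bexI[of _ y]) auto
qed

lemma double_perp:
  assumes X: "submodule X R M" and x: "x \<in> carrier M" and "\<And>y. y \<in> perp M N B X \<Longrightarrow> B x y = \<zero>\<^bsub>N\<^esub>"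
  shows "x \<in> X"
proof (rule ccontr)
  assume "x \<notin> X"
  then obtain y where "y \<in> perp M N B X" "B y x \<noteq> \<zero>\<^bsub>N\<^esub>" using separation[OF X x] by blast
  then show False using assms(3)[of y] B_sym[of x y] x unfolding perp_def by auto
qed

end


section \<open>Local anisotropy conditions\<close>

locale local_form = form_module R M N B + local_factor R e q n for R (structure) and M (structure) and N (structure) and B e q n
begin

sublocale local_module R e q n M by unfold_locales

lemma e_pow_B:
  assumes "x \<in> carrier M"
  shows "(e \<otimes> q [^] (j + 2::nat)) \<odot>\<^bsub>N\<^esub> B x x = (e \<otimes> q [^] j) \<odot>\<^bsub>N\<^esub> B (q \<odot>\<^bsub>M\<^esub> x) (q \<odot>\<^bsub>M\<^esub> x)"
  using assms by (simp add: N.smult_assoc1[symmetric] m_assoc)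

text \<open>\<open>A(j)\<close> is applied to \<open>q x\<close>, where the index and the exponent
  are both lower by two.\<close>

lemma half_aniso_step:
  assumes "half_aniso R M N B e q j"
  shows "half_aniso R M N B e q (j + 2)"
  unfolding half_aniso_def
proof (intro ballI impI)
  fix x assume x: "x \<in> carrier M" and P: "P (j + 2 + 1) x"
    and B0: "(e \<otimes> q [^] (j + 2)) \<odot>\<^bsub>N\<^esub> B x x = \<zero>\<^bsub>N\<^esub>"
  have "P (j + 1) (q \<odot>\<^bsub>M\<^esub> x)" using half_div_shift[OF x, of "j + 1"] P by (simp add: add.commute add.left_commute)
  then have "P j (q \<odot>\<^bsub>M\<^esub> x)" using assms B0 e_pow_B[OF x] x unfolding half_aniso_def by simp
  then show "P (j + 2) x" using half_div_shift[OF x] by simp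
qed

lemma half_aniso_all:
  assumes "half_aniso R M N B e q 1" "half_aniso R M N B e q 2" "j \<ge> 1"
  shows "half_aniso R M N B e q j"
  using assms(3)
proof (induction j rule: less_induct)
  case (less j)
  consider "j = 1" | "j = 2" | "j \<ge> 3" using less.prems by linarith
  then show ?case
  proof cases
    case 3
    then have "half_aniso R M N B e q (j - 2)" by (intro less.IH) auto
    then have "half_aniso R M N B e q (j - 2 + 2)" by (rule half_aniso_step)
    moreover have "j - 2 + 2 = j" using 3 by simp
    ultimately show ?thesis by (simp only:)
  qed (use assms in auto)
qed

text \<open>Every element satisfies \<open>P n\<close>; anisotropy lowers the index step by step.\<close>

lemma half_aniso_full:
  assumes "half_aniso R M N B e q 1" "half_aniso R M N B e q 2" "j \<ge> 1"
    and x: "x \<in> carrier M" and B0: "(e \<otimes> q [^] j) \<odot>\<^bsub>N\<^esub> B x x = \<zero>\<^bsub>N\<^esub>"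
  shows "P j x"
proof -
  have down: "P (j + k) x \<Longrightarrow> P j x" for k
  proof (induction k)
    case (Suc k)
    have "(e \<otimes> q [^] (j + k)) \<odot>\<^bsub>N\<^esub> B x x = q [^] k \<odot>\<^bsub>N\<^esub> ((e \<otimes> q [^] j) \<odot>\<^bsub>N\<^esub> B x x)"
      using x by (simp add: N.smult_assoc1[symmetric] nat_pow_mult[symmetric] m_ac)
    then have "(e \<otimes> q [^] (j + k)) \<odot>\<^bsub>N\<^esub> B x x = \<zero>\<^bsub>N\<^esub>" using B0 by simp
    then have "P (j + k) x"
      using half_aniso_all[OF assms(1,2), of "j + k"] assms(3) Suc.prems x unfolding half_aniso_def by simp
    then show ?case by (rule Suc.IH)
  qed simp
  show ?thesis using down[of n] half_div_large[OF x, of "j + n"] by simp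
qed

end

section \<open>Orthogonal quotients\<close>

text \<open>For \<open>L \<subseteq> L^\<bottom>\<close> this is the preimage in \<open>M\<close> of
  \<open>lr (L^\<bottom>/L)\<close>: the condition \<open>r (r z) \<in> L\<close> says that the
  class of \<open>r z\<close> is a generator there. In this way (iii) compares two submodules of
  \<open>M\<close>.\<close>

definition residual where
  "residual R M N B L = submodule_gen R M {r \<odot>\<^bsub>M\<^esub> z | r z.
     r \<in> carrier R \<and> z \<in> perp M N B L \<and> r \<odot>\<^bsub>M\<^esub> (r \<odot>\<^bsub>M\<^esub> z) \<in> L}"

lemma (in module) submodule_restrict_iff:
  assumes "submodule U R M"
  shows "submodule H R (M\<lparr>carrier := U\<rparr>) \<longleftrightarrow> submodule H R M \<and> H \<subseteq> U"
proof -
  interpret U: module R "M\<lparr>carrier := U\<rparr>" by (rule submodule.submodule_is_module[OF assms module_axioms])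
  show ?thesis unfolding U.submodule_iff submodule_iff using submoduleE(1)[OF assms] by auto
qed

lemma (in module) submodule_gen_restrict:
  assumes U: "submodule U R M" and S: "S \<subseteq> U"
  shows "submodule_gen R (M\<lparr>carrier := U\<rparr>) S = submodule_gen R M S"
proof
  interpret U: module R "M\<lparr>carrier := U\<rparr>" by (rule submodule.submodule_is_module[OF U module_axioms])
  have SM: "S \<subseteq> carrier M" using S submoduleE(1)[OF U] by blast
  show "submodule_gen R (M\<lparr>carrier := U\<rparr>) S \<subseteq> submodule_gen R M S"
    by (rule submodule_gen_minimal)
      (simp_all add: submodule_restrict_iff[OF U] submodule_gen_submodule[OF SM] submodule_gen_incl submodule_gen_minimal[OF U S])
  have "submodule (submodule_gen R (M\<lparr>carrier := U\<rparr>) S) R (M\<lparr>carrier := U\<rparr>)"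
    using S by (intro U.submodule_gen_submodule) simp
  then show "submodule_gen R M S \<subseteq> submodule_gen R (M\<lparr>carrier := U\<rparr>) S"
    unfolding submodule_restrict_iff[OF U] by (intro submodule_gen_minimal submodule_gen_incl) auto
qed

context form_module
begin

lemma perp_subset: "perp M N B L \<subseteq> carrier M"
  unfolding perp_def by blast

lemma residual_gens_subset:
  assumes L: "submodule L R M"
  shows "{r \<odot>\<^bsub>M\<^esub> z | r z. r \<in> carrier R \<and> z \<in> perp M N B L \<and> r \<odot>\<^bsub>M\<^esub> (r \<odot>\<^bsub>M\<^esub> z) \<in> L} \<subseteq> perp M N B L"
  using submoduleE(4)[OF perp_submodule[OF submoduleE(1)[OF L]]] by auto

lemma residual_submodule: "submodule L R M \<Longrightarrow> submodule (residual R M N B L) R M"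
  unfolding residual_def using residual_gens_subset perp_subset by (intro submodule_gen_submodule) blast

lemma residual_memI:
  "r \<in> carrier R \<Longrightarrow> z \<in> perp M N B L \<Longrightarrow> r \<odot>\<^bsub>M\<^esub> (r \<odot>\<^bsub>M\<^esub> z) \<in> L \<Longrightarrow> r \<odot>\<^bsub>M\<^esub> z \<in> residual R M N B L"
  unfolding residual_def by (rule subsetD[OF submodule_gen_incl]) blast

lemma residual_minimal:
  assumes "submodule H R M"
    and "\<And>r z. r \<in> carrier R \<Longrightarrow> z \<in> perp M N B L \<Longrightarrow> r \<odot>\<^bsub>M\<^esub> (r \<odot>\<^bsub>M\<^esub> z) \<in> L \<Longrightarrow> r \<odot>\<^bsub>M\<^esub> z \<in> H"
  shows "residual R M N B L \<subseteq> H"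
  unfolding residual_def using assms by (intro submodule_gen_minimal) auto

lemma subset_residual:
  assumes L: "submodule L R M" "L \<subseteq> perp M N B L"
  shows "L \<subseteq> residual R M N B L"
proof
  fix x assume x: "x \<in> L"
  then have "x \<in> carrier M" using submoduleE(1)[OF L(1)] by blast
  then show "x \<in> residual R M N B L" using residual_memI[of \<one> x L] x L(2) by auto
qed

lemma lr_perp_quotient:
  assumes L: "submodule L R M" "L \<subseteq> perp M N B L"
  shows "lr R (fact_module (M\<lparr>carrier := perp M N B L\<rparr>) L) = a_r_coset M L ` residual R M N B L"
proof -
  let ?U = "perp M N B L"
  have U: "submodule ?U R M" using submoduleE(1)[OF L(1)] by (rule perp_submodule)
  interpret U: module R "M\<lparr>carrier := ?U\<rparr>" by (rule submodule.submodule_is_module[OF U module_axioms])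
  have LU: "submodule L R (M\<lparr>carrier := ?U\<rparr>)" unfolding submodule_restrict_iff[OF U] using L by blast
  interpret s: semilinear_surj R "M\<lparr>carrier := ?U\<rparr>" R "fact_module (M\<lparr>carrier := ?U\<rparr>) L" id "a_r_coset (M\<lparr>carrier := ?U\<rparr>) L"
    by (rule U.fact_module_surj[OF LU])
  have "L +>\<^bsub>M\<^esub> (r \<odot>\<^bsub>M\<^esub> (r \<odot>\<^bsub>M\<^esub> z)) = L \<longleftrightarrow> r \<odot>\<^bsub>M\<^esub> (r \<odot>\<^bsub>M\<^esub> z) \<in> L" if "r \<in> carrier R" "z \<in> ?U" for r z
    using that perp_subset by (intro coset_eq_self_iff[OF L(1)]) auto
  then have "{r \<odot>\<^bsub>M\<^esub> z | r z. r \<in> carrier R \<and> z \<in> ?U \<and> L +>\<^bsub>M\<^esub> (r \<odot>\<^bsub>M\<^esub> (r \<odot>\<^bsub>M\<^esub> z)) = L} =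
    {r \<odot>\<^bsub>M\<^esub> z | r z. r \<in> carrier R \<and> z \<in> ?U \<and> r \<odot>\<^bsub>M\<^esub> (r \<odot>\<^bsub>M\<^esub> z) \<in> L}" by blast
  then show ?thesis
    using s.lr_image submodule_gen_restrict[OF U residual_gens_subset[OF L(1)]]
    by (simp add: residual_def fact_module_def)
qed

text \<open>\<open>residual R M N B L\<close> and \<open>lr R M\<close> both contain
  \<open>L\<close>, so they coincide as soon as their images modulo \<open>L\<close> do. The
  inclusion \<open>L \<subseteq> L^\<bottom>\<close> comes from the orthogonality of
  \<open>lr\<close> and \<open>ur\<close>.\<close>

lemma lr_perp_quotient_eq_iff:
  assumes L: "submodule L R M" "L \<subseteq> lr R M" and lr: "lr R M \<subseteq> ur R M"
  shows "lr R (fact_module (M\<lparr>carrier := perp M N B L\<rparr>) L) = carrier (fact_module (M\<lparr>carrier := lr R M\<rparr>) L)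
    \<longleftrightarrow> residual R M N B L = lr R M"
proof -
  have "L \<subseteq> perp M N B L"
    using L(2) lr ur_perp_lr submoduleE(1)[OF L(1)] unfolding perp_def by blast
  note LR = subset_residual[OF L(1) this] and eq = lr_perp_quotient[OF L(1) this]
  have sat: "A \<subseteq> C" if A: "submodule A R M" and C: "submodule C R M" "L \<subseteq> C" and im: "a_r_coset M L ` A = a_r_coset M L ` C" for A C
  proof
    fix x assume x: "x \<in> A"
    then obtain y where y: "y \<in> C" "L +>\<^bsub>M\<^esub> x = L +>\<^bsub>M\<^esub> y" using im by blast
    have "x \<in> carrier M" "y \<in> carrier M" using x y submoduleE(1) A C by blast+
    then show "x \<in> C" using y coset_eq_iff[OF L(1)] C submodule_add_cancel by blast
  qed
  show ?thesis unfolding eq carrier_fact_submodule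
    using sat[OF residual_submodule[OF L(1)] lr_submodule L(2)] sat[OF lr_submodule residual_submodule[OF L(1)] LR] by blast
qed

end

section \<open>Statement (iii) and the conditions \<open>A(1)\<close>, \<open>A(2)\<close>\<close>

lemma (in prime_factor) local_factor: "local_factor R e q n"
  by (rule local_factor_axioms)

context perfect_form
begin

lemma local_formI: "prime_factor R p e q n \<Longrightarrow> local_form R M N B e q n"
  by (intro local_form.intro form_module_axioms prime_factor.local_factor)

lemma lr_local:
  assumes x: "x \<in> carrier M" and "\<And>p e q n. prime_factor R p e q n \<Longrightarrow> half_div R M e q 0 x"
  shows "x \<in> lr R M"
proof (rule local_global[OF module_axioms lr_submodule x])
  fix p e q n assume pf: "prime_factor R p e q n"
  interpret local_form R M N B e q n by (rule local_formI[OF pf])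
  show "e \<odot>\<^bsub>M\<^esub> x \<in> lr R M" by (rule half_div_imp_lr[OF x assms(2)[OF pf]])
qed

text \<open>For fixed \<open>r\<close> the condition is membership of \<open>r x\<close> in the
  submodule \<open>r r M\<close>, which can be checked prime by prime, with a different witness at
  each.\<close>

lemma ur_local:
  assumes x: "x \<in> carrier M" and P: "\<And>p e q n. prime_factor R p e q n \<Longrightarrow> half_div R M e q 1 x"
  shows "x \<in> ur R M"
  unfolding ur_iff
proof (intro conjI ballI x)
  fix r assume r: "r \<in> carrier R"
  have sub: "submodule ((\<odot>\<^bsub>M\<^esub>) (r \<otimes> r) ` carrier M) R M"
    using r by (intro scalar_image_submodule carrier_is_submodule) simp
  have "r \<odot>\<^bsub>M\<^esub> x \<in> (\<odot>\<^bsub>M\<^esub>) (r \<otimes> r) ` carrier M"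
  proof (rule local_global[OF module_axioms sub])
    fix p e q n assume pf: "prime_factor R p e q n"
    interpret local_form R M N B e q n by (rule local_formI[OF pf])
    obtain z where "z \<in> carrier M" "(e \<otimes> r) \<odot>\<^bsub>M\<^esub> x = (e \<otimes> (r \<otimes> r)) \<odot>\<^bsub>M\<^esub> z"
      using half_div_imp_ur_eq[OF x P[OF pf] r] by blast
    moreover have "e \<otimes> (r \<otimes> r) = (r \<otimes> r) \<otimes> e" using r by (simp add: m_ac)
    ultimately have "e \<odot>\<^bsub>M\<^esub> (r \<odot>\<^bsub>M\<^esub> x) = (r \<otimes> r) \<odot>\<^bsub>M\<^esub> (e \<odot>\<^bsub>M\<^esub> z)"
      using r x by (simp add: smult_assoc1)
    then show "e \<odot>\<^bsub>M\<^esub> (r \<odot>\<^bsub>M\<^esub> x) \<in> (\<odot>\<^bsub>M\<^esub>) (r \<otimes> r) ` carrier M" using \<open>z \<in> carrier M\<close> by auto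
  qed (use r x in simp)
  then show "\<exists>z\<in>carrier M. r \<odot>\<^bsub>M\<^esub> x = r \<odot>\<^bsub>M\<^esub> (r \<odot>\<^bsub>M\<^esub> z)" using r by (auto simp: smult_assoc1)
qed

lemma lr_subset_ur: "lr R M \<subseteq> ur R M"
proof
  fix x assume x: "x \<in> lr R M"
  show "x \<in> ur R M"
  proof (rule ur_local)
    show "x \<in> carrier M" using x submoduleE(1)[OF lr_submodule] by blast
    fix p e q n assume pf: "prime_factor R p e q n"
    interpret local_form R M N B e q n by (rule local_formI[OF pf])
    show "half_div R M e q 1 x" using half_div_mono[OF lr_imp_half_div[OF x]] by simp
  qed
qed

text \<open>Let \<open>U = L^\<bottom>\<close> and let \<open>C\<close> consist of all
  \<open>x\<close> with \<open>r x \<in> L\<close>. By biduality \<open>(r U)^\<bottom>\<close> is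
  contained in \<open>C\<close>, and therefore \<open>C^\<bottom>\<close> in \<open>r U\<close>. An
  element orthogonal to \<open>C + r U\<close> is thus some \<open>r z\<close> with
  \<open>z \<in> U\<close> and \<open>r (r z) \<in> L\<close>, and \<open>orth\<close> makes it
  orthogonal to \<open>y\<close>. So \<open>y\<close> lies in \<open>C + r U\<close>, and
  multiplying by \<open>r\<close> gives the claim.\<close>

lemma divisible_mod_perp:
  assumes L: "submodule L R M" and r: "r \<in> carrier R" and y: "y \<in> carrier M"
    and orth: "\<And>z. z \<in> perp M N B L \<Longrightarrow> r \<odot>\<^bsub>M\<^esub> (r \<odot>\<^bsub>M\<^esub> z) \<in> L \<Longrightarrow> B y (r \<odot>\<^bsub>M\<^esub> z) = \<zero>\<^bsub>N\<^esub>"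
  shows "\<exists>b\<in>perp M N B L. r \<odot>\<^bsub>M\<^esub> y \<ominus>\<^bsub>M\<^esub> r \<odot>\<^bsub>M\<^esub> (r \<odot>\<^bsub>M\<^esub> b) \<in> L"
proof -
  let ?U = "perp M N B L" and ?C = "{x \<in> carrier M. r \<odot>\<^bsub>M\<^esub> x \<in> L}"
  let ?rU = "(\<odot>\<^bsub>M\<^esub>) r ` ?U"
  note LE = submoduleE[OF L] submodule_zero_closed[OF L]
  have U: "submodule ?U R M" using LE(1) by (rule perp_submodule)
  have UM: "z \<in> carrier M" if "z \<in> ?U" for z using that perp_subset by blast
  have rU: "submodule ?rU R M" by (rule scalar_image_submodule[OF U r])
  have C: "submodule ?C R M"
    unfolding submodule_iff using LE r by (auto simp: smult_r_distr smult_left_comm[of r])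
  \<comment> \<open>\<open>B (r t) z = B t (r z) = 0\<close> for all
    \<open>z \<in> L^\<bottom>\<close>, so \<open>r t\<close> lies in
    \<open>L^\<bottom>^\<bottom> = L\<close>.\<close>
  have dual: "r \<odot>\<^bsub>M\<^esub> t \<in> L" if t: "t \<in> carrier M" and tz: "\<And>z. z \<in> ?U \<Longrightarrow> B t (r \<odot>\<^bsub>M\<^esub> z) = \<zero>\<^bsub>N\<^esub>" for t
  proof (rule double_perp[OF L])
    show "r \<odot>\<^bsub>M\<^esub> t \<in> carrier M" using r t by simp
    show "B (r \<odot>\<^bsub>M\<^esub> t) z = \<zero>\<^bsub>N\<^esub>" if "z \<in> ?U" for z using tz[OF that] r t UM[OF that] by simp
  qed
  have "y \<in> ?C <+>\<^bsub>M\<^esub> ?rU"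
  proof (rule double_perp[OF set_add_submodule[OF C rU] y])
    fix t assume t: "t \<in> perp M N B (?C <+>\<^bsub>M\<^esub> ?rU)"
    then have tM: "t \<in> carrier M" and tX: "\<And>x. x \<in> ?C <+>\<^bsub>M\<^esub> ?rU \<Longrightarrow> B t x = \<zero>\<^bsub>N\<^esub>" unfolding perp_def by auto
    have tC: "B t x = \<zero>\<^bsub>N\<^esub>" if "x \<in> ?C" for x
      using tX[OF set_addI[OF that submodule_zero_closed[OF rU]]] that by simp
    have tU: "B t (r \<odot>\<^bsub>M\<^esub> z) = \<zero>\<^bsub>N\<^esub>" if z: "z \<in> ?U" for z
    proof -
      have "\<zero>\<^bsub>M\<^esub> \<oplus>\<^bsub>M\<^esub> r \<odot>\<^bsub>M\<^esub> z \<in> ?C <+>\<^bsub>M\<^esub> ?rU" using z by (intro set_addI submodule_zero_closed[OF C]) blast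
      then show ?thesis using tX UM[OF z] r by simp
    qed
    \<comment> \<open>Whatever is orthogonal to \<open>r U\<close> lies in \<open>C\<close>, to
      which \<open>t\<close> is orthogonal; biduality for \<open>r U\<close> applies.\<close>
    have "t \<in> ?rU"
    proof (rule double_perp[OF rU tM])
      fix w assume "w \<in> perp M N B ?rU"
      then have wM: "w \<in> carrier M" and "\<And>z. z \<in> ?U \<Longrightarrow> B w (r \<odot>\<^bsub>M\<^esub> z) = \<zero>\<^bsub>N\<^esub>" unfolding perp_def by auto
      then show "B t w = \<zero>\<^bsub>N\<^esub>" using dual tC by blast
    qed
    then obtain z where z: "z \<in> ?U" "t = r \<odot>\<^bsub>M\<^esub> z" by blast
    have "r \<odot>\<^bsub>M\<^esub> (r \<odot>\<^bsub>M\<^esub> z) \<in> L" using dual[OF tM tU] z(2) by simp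
    then show "B y t = \<zero>\<^bsub>N\<^esub>" using orth[OF z(1)] z(2) by simp
  qed
  then obtain a b where a: "a \<in> carrier M" "r \<odot>\<^bsub>M\<^esub> a \<in> L" and b: "b \<in> ?U" and y: "y = a \<oplus>\<^bsub>M\<^esub> r \<odot>\<^bsub>M\<^esub> b"
    unfolding set_add_def' by blast
  have eq: "r \<odot>\<^bsub>M\<^esub> y \<ominus>\<^bsub>M\<^esub> r \<odot>\<^bsub>M\<^esub> (r \<odot>\<^bsub>M\<^esub> b) = r \<odot>\<^bsub>M\<^esub> a"
    unfolding y using a(1) UM[OF b] r by (simp add: smult_r_distr a_minus_def M.a_assoc M.r_neg)
  show ?thesis by (rule bexI[OF _ b]) (subst eq, rule a(2))
qed

abbreviation locally_half_aniso where
  "locally_half_aniso j \<equiv> \<forall>p e q n. prime_factor R p e q n \<longrightarrow> half_aniso R M N B e q j"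

text \<open>\<open>B (r z) (r z) = B z (r (r z)) = 0\<close>, so \<open>r z\<close> is isotropic.
  Since \<open>A(0)\<close> is not at hand, a factor \<open>q\<close> of \<open>r\<close> on
  \<open>e R\<close> is removed: \<open>A\<close> in its strong form at \<open>j = 2\<close> applies
  to the quotient, and \<open>P 2\<close> there is \<open>P 0\<close> for \<open>r z\<close>. If
  \<open>r\<close> is a unit on \<open>e R\<close>, then \<open>e r z\<close> is a multiple of
  \<open>r (r z) \<in> L\<close>, and \<open>L \<subseteq> lr(M)\<close> suffices.\<close>

lemma residual_subset_lr:
  assumes C: "locally_half_aniso 1" "locally_half_aniso 2" and L: "submodule L R M" "L \<subseteq> lr R M"
  shows "residual R M N B L \<subseteq> lr R M"
proof (rule residual_minimal[OF lr_submodule])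
  fix r z assume r: "r \<in> carrier R" and z: "z \<in> perp M N B L" and rrz: "r \<odot>\<^bsub>M\<^esub> (r \<odot>\<^bsub>M\<^esub> z) \<in> L"
  have zM: "z \<in> carrier M" using z perp_subset by blast
  have "B (r \<odot>\<^bsub>M\<^esub> z) (r \<odot>\<^bsub>M\<^esub> z) = B z (r \<odot>\<^bsub>M\<^esub> (r \<odot>\<^bsub>M\<^esub> z))" using r zM by simp
  also have "\<dots> = \<zero>\<^bsub>N\<^esub>" using z rrz unfolding perp_def by blast
  finally have B0: "B (r \<odot>\<^bsub>M\<^esub> z) (r \<odot>\<^bsub>M\<^esub> z) = \<zero>\<^bsub>N\<^esub>" .
  show "r \<odot>\<^bsub>M\<^esub> z \<in> lr R M"
  proof (rule lr_local)
    show "r \<odot>\<^bsub>M\<^esub> z \<in> carrier M" using r zM by simp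
    fix p e q n assume pf: "prime_factor R p e q n"
    interpret local_form R M N B e q n by (rule local_formI[OF pf])
    obtain k :: nat and u v where u: "u \<in> carrier R" "v \<in> carrier R" "u \<otimes> v \<otimes> e = e"
      and er: "e \<otimes> r = e \<otimes> (q [^] k \<otimes> u)" using factor[OF r] by blast
    show "P 0 (r \<odot>\<^bsub>M\<^esub> z)"
    proof (cases k)
      case 0
      have "e \<otimes> v \<otimes> r = v \<otimes> (e \<otimes> r)" using u r by (simp add: m_ac)
      also have "\<dots> = u \<otimes> v \<otimes> e" unfolding er 0 using u(1,2) by (simp add: m_ac)
      finally have "e \<otimes> v \<otimes> r = e" using u(3) by simp
      then have "e \<odot>\<^bsub>M\<^esub> (v \<odot>\<^bsub>M\<^esub> (r \<odot>\<^bsub>M\<^esub> (r \<odot>\<^bsub>M\<^esub> z))) = e \<odot>\<^bsub>M\<^esub> (r \<odot>\<^bsub>M\<^esub> z)"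
        using u r zM by (metis e_closed m_closed smult_assoc1 smult_closed)
      moreover have "P 0 (v \<odot>\<^bsub>M\<^esub> (r \<odot>\<^bsub>M\<^esub> (r \<odot>\<^bsub>M\<^esub> z)))"
        using lr_imp_half_div submoduleE(4)[OF lr_submodule u(2)] rrz L(2) by blast
      ultimately show ?thesis 
        using half_div_e_cong[of "v \<odot>\<^bsub>M\<^esub> (r \<odot>\<^bsub>M\<^esub> (r \<odot>\<^bsub>M\<^esub> z))" "r \<odot>\<^bsub>M\<^esub> z"] u(2) r zM by simp
    next
      case (Suc k')
      let ?x = "(q [^] k' \<otimes> u) \<odot>\<^bsub>M\<^esub> z"
      have xM: "?x \<in> carrier M" using u(1) zM by simp
      have ex: "e \<odot>\<^bsub>M\<^esub> (q \<odot>\<^bsub>M\<^esub> ?x) = e \<odot>\<^bsub>M\<^esub> (r \<odot>\<^bsub>M\<^esub> z)"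
      proof -
        have "e \<odot>\<^bsub>M\<^esub> (q \<odot>\<^bsub>M\<^esub> ?x) = (e \<otimes> (q [^] k \<otimes> u)) \<odot>\<^bsub>M\<^esub> z"
          unfolding Suc using u(1) zM by (simp add: smult_assoc1[symmetric] m_ac)
        then show ?thesis unfolding er[symmetric] using r zM by (simp add: smult_assoc1)
      qed
      have ee: "e \<odot>\<^bsub>N\<^esub> B w w = B (e \<odot>\<^bsub>M\<^esub> w) (e \<odot>\<^bsub>M\<^esub> w)" if "w \<in> carrier M" for w
        using that e_idem by (simp add: N.smult_assoc1[symmetric])
      have "(e \<otimes> q [^] (2::nat)) \<odot>\<^bsub>N\<^esub> B ?x ?x = e \<odot>\<^bsub>N\<^esub> B (q \<odot>\<^bsub>M\<^esub> ?x) (q \<odot>\<^bsub>M\<^esub> ?x)"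
        using e_pow_B[OF xM, of 0] by (simp only: add_0 nat_pow_0 r_one e_closed)
      also have "\<dots> = e \<odot>\<^bsub>N\<^esub> B (r \<odot>\<^bsub>M\<^esub> z) (r \<odot>\<^bsub>M\<^esub> z)"
        using ee[of "q \<odot>\<^bsub>M\<^esub> ?x"] ee[of "r \<odot>\<^bsub>M\<^esub> z"] xM r zM unfolding ex by simp
      finally have "(e \<otimes> q [^] (2::nat)) \<odot>\<^bsub>N\<^esub> B ?x ?x = \<zero>\<^bsub>N\<^esub>" unfolding B0 by (simp only: N.smult_r_null e_closed)
      then have "P 2 ?x" using half_aniso_full[of 2 ?x] C pf xM by auto
      then have "P 0 (q \<odot>\<^bsub>M\<^esub> ?x)" using half_div_shift[OF xM, of 0] by (simp add: numeral_2_eq_2)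
      then show ?thesis using half_div_e_cong[OF _ _ ex] xM r zM by simp
    qed
  qed
qed

text \<open>For \<open>y\<close> orthogonal to \<open>residual L\<close> choose \<open>b\<^sub>i \<in> L\<^sup>\<bottom>\<close> with \<open>q\<^sup>i y - q\<^sup>2\<^sup>i b\<^sub>i \<in> L\<close>. Then
  \<open>q\<^sup>i\<^sup>+\<^sup>1 \<langle>y, b\<^sub>i\<rangle>\<close> does not depend on \<open>i\<close>, so that \<open>e q \<langle>y, y\<rangle> = 0\<close>.\<close>

lemma lr_subset_residual:
  assumes C: "locally_half_aniso 1" "locally_half_aniso 2" and L: "submodule L R M" "L \<subseteq> lr R M"
  shows "lr R M \<subseteq> residual R M N B L"
proof
  fix x assume x: "x \<in> lr R M"
  have Lp: "L \<subseteq> perp M N B L"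
    using L(2) lr_subset_ur ur_perp_lr submoduleE(1)[OF L(1)] unfolding perp_def by blast
  have xM: "x \<in> carrier M" using x submoduleE(1)[OF lr_submodule] by blast
  show "x \<in> residual R M N B L"
  proof (rule double_perp[OF residual_submodule[OF L(1)] xM])
    fix y assume "y \<in> perp M N B (residual R M N B L)"
    then have yM: "y \<in> carrier M" and orth: "\<And>w. w \<in> residual R M N B L \<Longrightarrow> B y w = \<zero>\<^bsub>N\<^esub>" unfolding perp_def by auto
    \<comment> \<open>\<open>ur\<close> is orthogonal to \<open>lr\<close>, so by biduality it is
      enough to place every \<open>y\<close> orthogonal to the residual in
      \<open>ur\<close>.\<close>
    have "y \<in> ur R M"
    proof (rule ur_local[OF yM])
      fix p e q n assume pf: "prime_factor R p e q n"
      interpret local_form R M N B e q n by (rule local_formI[OF pf])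
      \<comment> \<open>Any \<open>q^i z\<close> with \<open>z \<in> L^\<bottom>\<close> and
        \<open>q^{2i} z \<in> L\<close> lies in the residual and is thus orthogonal to
        \<open>y\<close>, as \<open>divisible_mod_perp\<close> demands.\<close>
      have ex: "\<exists>b. b \<in> perp M N B L \<and> q [^] i \<odot>\<^bsub>M\<^esub> y \<ominus>\<^bsub>M\<^esub> q [^] i \<odot>\<^bsub>M\<^esub> (q [^] i \<odot>\<^bsub>M\<^esub> b) \<in> L" for i :: nat
        using divisible_mod_perp[OF L(1) _ yM, of "q [^] i"] orth residual_memI[of "q [^] i" _ L] by auto
      have "\<forall>i::nat. \<exists>b. b \<in> perp M N B L \<and> q [^] i \<odot>\<^bsub>M\<^esub> y \<ominus>\<^bsub>M\<^esub> q [^] i \<odot>\<^bsub>M\<^esub> (q [^] i \<odot>\<^bsub>M\<^esub> b) \<in> L"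
        using ex by blast
      from choice[OF this] obtain b where b: "\<And>i::nat. b i \<in> perp M N B L"
        and bL: "\<And>i::nat. q [^] i \<odot>\<^bsub>M\<^esub> y \<ominus>\<^bsub>M\<^esub> q [^] i \<odot>\<^bsub>M\<^esub> (q [^] i \<odot>\<^bsub>M\<^esub> b i) \<in> L" by blast
      have bM: "b i \<in> carrier M" for i using b perp_subset by blast
      have key: "q [^] i \<odot>\<^bsub>N\<^esub> B y w = q [^] (i + i) \<odot>\<^bsub>N\<^esub> B (b i) w" if w: "w \<in> perp M N B L" for i w
      proof -
        have wM: "w \<in> carrier M" using w perp_subset by blast
        have "B w (q [^] i \<odot>\<^bsub>M\<^esub> y \<ominus>\<^bsub>M\<^esub> q [^] i \<odot>\<^bsub>M\<^esub> (q [^] i \<odot>\<^bsub>M\<^esub> b i)) = \<zero>\<^bsub>N\<^esub>"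
          using w bL unfolding perp_def by blast
        then have "q [^] i \<odot>\<^bsub>N\<^esub> B w y = q [^] i \<odot>\<^bsub>N\<^esub> (q [^] i \<odot>\<^bsub>N\<^esub> B w (b i))"
          using wM yM bM by simp
        then show ?thesis using wM yM bM B_sym[of w] by (simp add: N.smult_assoc1[symmetric] nat_pow_mult)
      qed
      \<comment> \<open>The congruence of index \<open>i + 1\<close> is paired with
        \<open>b i\<close>, the one of index \<open>i\<close> with \<open>b (Suc i)\<close>; the
        symmetry of \<open>B\<close> links the two.\<close>
      have step: "q [^] (i + 1) \<odot>\<^bsub>N\<^esub> B y (b i) = q [^] (Suc i + 1) \<odot>\<^bsub>N\<^esub> B y (b (Suc i))" for i
      proof -
        have "q [^] (i + 1) \<odot>\<^bsub>N\<^esub> B y (b i) = q [^] (i + 1 + (i + 1)) \<odot>\<^bsub>N\<^esub> B (b (Suc i)) (b i)"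
          using key[OF b, of "i + 1"] by simp
        also have "\<dots> = q [^] (2::nat) \<odot>\<^bsub>N\<^esub> (q [^] (i + i) \<odot>\<^bsub>N\<^esub> B (b i) (b (Suc i)))"
        proof -
          have "i + 1 + (i + 1) = 2 + (i + i)" by simp
          then show ?thesis using bM B_sym[of "b i" "b (Suc i)"] by (simp only: N.smult_assoc1[symmetric] nat_pow_mult nat_pow_closed q_closed B_simps(1))
        qed
        also have "\<dots> = q [^] (2::nat) \<odot>\<^bsub>N\<^esub> (q [^] i \<odot>\<^bsub>N\<^esub> B y (b (Suc i)))" using key[OF b, of i "Suc i"] by simp
        also have "\<dots> = q [^] (Suc i + 1) \<odot>\<^bsub>N\<^esub> B y (b (Suc i))"
        proof -
          have "Suc i + 1 = 2 + i" by simp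
          then show ?thesis using bM yM by (simp only: N.smult_assoc1[symmetric] nat_pow_mult nat_pow_closed q_closed B_simps(1))
        qed
        finally show ?thesis .
      qed
      have tel: "q [^] (0 + 1::nat) \<odot>\<^bsub>N\<^esub> B y (b 0) = q [^] (i + 1) \<odot>\<^bsub>N\<^esub> B y (b i)" for i
        by (induction i) (use step in simp_all)
      have yL: "y \<in> perp M N B L" using yM orth subset_residual[OF L(1) Lp] unfolding perp_def by blast
      \<comment> \<open>Index \<open>0\<close>, paired with \<open>y\<close> itself, which is
        orthogonal to \<open>L\<close> because \<open>L\<close> is contained in the
        residual.\<close>
      have "B y y = B y (b 0)" using key[OF yL, of 0] yM bM B_sym[of y "b 0"] by simp
      \<comment> \<open>Passing from index \<open>0\<close> to index \<open>n\<close> gains the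
        power \<open>q^{n+1}\<close>, which \<open>e\<close> kills.\<close>
      then have "(e \<otimes> q [^] (1::nat)) \<odot>\<^bsub>N\<^esub> B y y = e \<odot>\<^bsub>N\<^esub> (q [^] (n + 1) \<odot>\<^bsub>N\<^esub> B y (b n))"
        using tel[of n] yM bM by (simp add: N.smult_assoc1)
      also have "\<dots> = (e \<otimes> q [^] (n + 1)) \<odot>\<^bsub>N\<^esub> B y (b n)" using yM bM by (simp only: N.smult_assoc1 e_closed nat_pow_closed q_closed B_simps(1))
      also have "\<dots> = \<zero>\<^bsub>N\<^esub>" using e_pow_ge[of "n + 1"] yM bM by simp
      finally show "P 1 y" using half_aniso_full[of 1 y] C pf yM by auto
    qed
    then have "B y x = \<zero>\<^bsub>N\<^esub>" using ur_perp_lr x by blast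
    then show "B x y = \<zero>\<^bsub>N\<^esub>" using B_sym[OF xM yM] by simp
  qed
qed

text \<open>The test submodule is \<open>L = R w\<close> with \<open>w = e q^j x\<close>:
  divisibility of \<open>x\<close> puts \<open>w\<close> in \<open>lr(M)\<close>, and isotropy puts
  \<open>z = e x\<close> in \<open>L^\<bottom>\<close>. For \<open>j = 2\<close> the element
  \<open>q z\<close> is a generator of the residual, since \<open>q (q z) = w\<close>. For
  \<open>j = 1\<close> it is shown instead that \<open>z\<close> is orthogonal to the residual,
  which is \<open>lr(M)\<close>, and hence lies in \<open>ur(M)\<close>.\<close>

lemma half_aniso_of_residual:
  assumes res: "\<And>L. submodule L R M \<Longrightarrow> L \<subseteq> lr R M \<Longrightarrow> residual R M N B L = lr R M"
    and pf: "prime_factor R p e q n"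
  shows "half_aniso R M N B e q 1" "half_aniso R M N B e q 2"
proof -
  interpret local_form R M N B e q n by (rule local_formI[OF pf])
  {
    fix x j assume x: "x \<in> carrier M" and j: "j = 1 \<or> j = (2::nat)" and P: "P (j + 1) x"
      and B0: "(e \<otimes> q [^] j) \<odot>\<^bsub>N\<^esub> B x x = \<zero>\<^bsub>N\<^esub>"
    define w where "w = (e \<otimes> q [^] j) \<odot>\<^bsub>M\<^esub> x"
    define L where "L = (\<lambda>a. a \<odot>\<^bsub>M\<^esub> w) ` carrier R"
    let ?z = "e \<odot>\<^bsub>M\<^esub> x"
    have wM: "w \<in> carrier M" unfolding w_def using x by simp
    have L: "submodule L R M" unfolding L_def by (rule cyclic_submodule[OF wM])
    have wL: "w \<in> L" unfolding L_def using wM by (intro image_eqI[of _ _ \<one>]) auto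
    \<comment> \<open>Here \<open>j \<ge> 1\<close> enters, through \<open>j + 1 \<le> 2 j\<close>;
      \<open>P (2 j) x\<close> says that \<open>q^j x\<close> satisfies \<open>P 0\<close>.\<close>
    have "P (0 + 2 * j) x" using half_div_mono[OF P, of "0 + 2 * j"] j by auto
    moreover have "P (0 + 2 * k) y = P 0 (q [^] k \<odot>\<^bsub>M\<^esub> y)" if "y \<in> carrier M" for k y
      using that
    proof (induction k arbitrary: y)
      case (Suc k)
      have "P (0 + 2 * Suc k) y = P (0 + 2 * k) (q \<odot>\<^bsub>M\<^esub> y)" using half_div_shift[OF Suc.prems, of "2 * k"] by simp
      also have "\<dots> = P 0 (q [^] Suc k \<odot>\<^bsub>M\<^esub> y)" using Suc.IH[of "q \<odot>\<^bsub>M\<^esub> y"] Suc.prems by (simp add: smult_assoc1)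
      finally show ?case .
    qed simp
    ultimately have "e \<odot>\<^bsub>M\<^esub> (q [^] j \<odot>\<^bsub>M\<^esub> x) \<in> lr R M" using x by (intro half_div_imp_lr) auto
    then have "w \<in> lr R M" unfolding w_def using x by (simp add: smult_assoc1)
    then have "L \<subseteq> lr R M" unfolding L_def using submoduleE(4)[OF lr_submodule] by blast
    note res = res[OF L this]
    have zL: "?z \<in> perp M N B L"
    proof -
      have "B ?z w = (e \<otimes> e \<otimes> q [^] j) \<odot>\<^bsub>N\<^esub> B x x" unfolding w_def using x by (simp add: N.smult_assoc1[symmetric] m_ac)
      then have "B ?z w = \<zero>\<^bsub>N\<^esub>" using B0 e_idem by simp
      then show ?thesis unfolding perp_def L_def using x wM by auto
    qed
    have "P j x"
    proof (cases "j = 2")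
      case True
      have "q \<odot>\<^bsub>M\<^esub> (q \<odot>\<^bsub>M\<^esub> ?z) = w" unfolding w_def True using x by (simp add: smult_assoc1[symmetric] m_ac numeral_2_eq_2)
      then have "q \<odot>\<^bsub>M\<^esub> ?z \<in> lr R M" using residual_memI[OF q_closed zL] wL res by simp
      then have "P 0 (q \<odot>\<^bsub>M\<^esub> ?z)" by (rule lr_imp_half_div)
      then have "P 2 ?z" using half_div_shift[of ?z 0] x by (simp add: numeral_2_eq_2)
      then show ?thesis using half_div_e[OF x] True by simp
    next
      case False
      then have j: "j = 1" using j by simp
      have zM: "?z \<in> carrier M" using x by simp
      \<comment> \<open>If \<open>r\<close> is a unit on \<open>e R\<close>, then
        \<open>B z (r y)\<close> is a multiple of \<open>B z (r (r y))\<close>, which vanishes as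
        \<open>z\<close> is orthogonal to \<open>L\<close>. Otherwise a factor \<open>q\<close> of
        \<open>r\<close> turns \<open>z\<close> into \<open>w\<close>, and \<open>y\<close> is
        orthogonal to \<open>w\<close>.\<close>
      have "residual R M N B L \<subseteq> perp M N B {?z}"
      proof (rule residual_minimal)
        show "submodule (perp M N B {?z}) R M" using zM by (intro perp_submodule) simp
        fix r y assume r: "r \<in> carrier R" and y: "y \<in> perp M N B L" and rry: "r \<odot>\<^bsub>M\<^esub> (r \<odot>\<^bsub>M\<^esub> y) \<in> L"
        have yM: "y \<in> carrier M" using y perp_subset by blast
        obtain k :: nat and u v where u: "u \<in> carrier R" "v \<in> carrier R" "u \<otimes> v \<otimes> e = e"
          and er: "e \<otimes> r = e \<otimes> (q [^] k \<otimes> u)" using factor[OF r] by blast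
        have "B ?z (r \<odot>\<^bsub>M\<^esub> y) = \<zero>\<^bsub>N\<^esub>"
        proof (cases k)
          case 0
          have "e \<otimes> v \<otimes> r = v \<otimes> (e \<otimes> r)" using u r by (simp add: m_ac)
          also have "\<dots> = u \<otimes> v \<otimes> e" unfolding er 0 using u(1,2) by (simp add: m_ac)
          finally have evr: "v \<otimes> r \<otimes> e = e" using u r by (simp add: m_ac)
          have "B ?z (r \<odot>\<^bsub>M\<^esub> y) = B ((v \<otimes> r \<otimes> e) \<odot>\<^bsub>M\<^esub> x) (r \<odot>\<^bsub>M\<^esub> y)" using evr by simp
          also have "\<dots> = v \<odot>\<^bsub>N\<^esub> B ?z (r \<odot>\<^bsub>M\<^esub> (r \<odot>\<^bsub>M\<^esub> y))"
            using u(2) r x yM by (simp add: N.smult_assoc1[symmetric] m_ac)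
          also have "B ?z (r \<odot>\<^bsub>M\<^esub> (r \<odot>\<^bsub>M\<^esub> y)) = \<zero>\<^bsub>N\<^esub>" using zL rry unfolding perp_def by blast
          finally show ?thesis using u(2) by simp
        next
          case (Suc k')
          have "B ?z (r \<odot>\<^bsub>M\<^esub> y) = (e \<otimes> r) \<odot>\<^bsub>N\<^esub> B x y" using r x yM by (simp add: N.smult_assoc1[symmetric] m_ac)
          also have "\<dots> = (q [^] k' \<otimes> u) \<odot>\<^bsub>N\<^esub> B w y"
            unfolding er Suc w_def j using u(1) x yM by (simp add: N.smult_assoc1[symmetric] m_ac)
          also have "B w y = \<zero>\<^bsub>N\<^esub>" using y wL B_sym[OF wM yM] unfolding perp_def by simp
          finally show ?thesis using u(1) by simp
        qed
        then show "r \<odot>\<^bsub>M\<^esub> y \<in> perp M N B {?z}" using B_sym[OF zM, of "r \<odot>\<^bsub>M\<^esub> y"] r yM unfolding perp_def by simp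
      qed
      then have lrz: "B ?z y = \<zero>\<^bsub>N\<^esub>" if "y \<in> lr R M" for y
        using that B_sym[OF zM, of y] unfolding res perp_def by auto
      \<comment> \<open>The case \<open>L = 0\<close> of \<open>divisible_mod_perp\<close>: whatever
        is orthogonal to \<open>lr(M)\<close> lies in \<open>ur(M)\<close>.\<close>
      have "?z \<in> ur R M" unfolding ur_iff
      proof (intro conjI ballI zM)
        fix r assume r: "r \<in> carrier R"
        have "submodule {\<zero>\<^bsub>M\<^esub>} R M" unfolding submodule_iff by simp
        moreover have "B ?z (r \<odot>\<^bsub>M\<^esub> y) = \<zero>\<^bsub>N\<^esub>" if "y \<in> perp M N B {\<zero>\<^bsub>M\<^esub>}" "r \<odot>\<^bsub>M\<^esub> (r \<odot>\<^bsub>M\<^esub> y) \<in> {\<zero>\<^bsub>M\<^esub>}" for y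
          using lrz lr_memI[OF r] that perp_subset by blast
        ultimately obtain b where b: "b \<in> perp M N B {\<zero>\<^bsub>M\<^esub>}" 
          "r \<odot>\<^bsub>M\<^esub> ?z \<ominus>\<^bsub>M\<^esub> r \<odot>\<^bsub>M\<^esub> (r \<odot>\<^bsub>M\<^esub> b) \<in> {\<zero>\<^bsub>M\<^esub>}" using divisible_mod_perp[OF _ r zM] by meson
        moreover have "b \<in> carrier M" using b(1) perp_subset by blast
        ultimately show "\<exists>b\<in>carrier M. r \<odot>\<^bsub>M\<^esub> ?z = r \<odot>\<^bsub>M\<^esub> (r \<odot>\<^bsub>M\<^esub> b)" using r zM by auto
      qed
      then show ?thesis using ur_imp_half_div half_div_e[OF x] j by blast
    qed
  }
  then show "half_aniso R M N B e q 1" "half_aniso R M N B e q 2" unfolding half_aniso_def by blast+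
qed

lemma lr_perp_quotient_iff:
  "(\<forall>L. submodule L R M \<and> L \<subseteq> lr R M \<longrightarrow>
      lr R (fact_module (M\<lparr>carrier := perp M N B L\<rparr>) L) = carrier (fact_module (M\<lparr>carrier := lr R M\<rparr>) L)) \<longleftrightarrow>
    locally_half_aniso 1 \<and> locally_half_aniso 2"
proof -
  have "(\<forall>L. submodule L R M \<and> L \<subseteq> lr R M \<longrightarrow>
      lr R (fact_module (M\<lparr>carrier := perp M N B L\<rparr>) L) = carrier (fact_module (M\<lparr>carrier := lr R M\<rparr>) L)) \<longleftrightarrow>
    (\<forall>L. submodule L R M \<and> L \<subseteq> lr R M \<longrightarrow> residual R M N B L = lr R M)"
    using lr_perp_quotient_eq_iff[OF _ _ lr_subset_ur] by blast
  also have "\<dots> \<longleftrightarrow> locally_half_aniso 1 \<and> locally_half_aniso 2"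
  proof
    assume "\<forall>L. submodule L R M \<and> L \<subseteq> lr R M \<longrightarrow> residual R M N B L = lr R M"
    then have res: "\<And>L. submodule L R M \<Longrightarrow> L \<subseteq> lr R M \<Longrightarrow> residual R M N B L = lr R M" by blast
    show "locally_half_aniso 1 \<and> locally_half_aniso 2"
      by (intro conjI allI impI half_aniso_of_residual[OF res])
  next
    assume "locally_half_aniso 1 \<and> locally_half_aniso 2"
    then show "\<forall>L. submodule L R M \<and> L \<subseteq> lr R M \<longrightarrow> residual R M N B L = lr R M"
      using residual_subset_lr lr_subset_residual by (intro allI impI equalityI) blast+
  qed
  finally show ?thesis .
qed

end


section \<open>The equivalence\<close>

context perfect_form
begin

text \<open>The localization is presented by \<open>e = e q^0\<close>, so \<open>j = 0\<close> in
  the conditions on the \<open>\<rho>_i\<close>. As this scalar is idempotent, non-degeneracy passes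
  to every localization, and only the two anisotropy conditions remain.\<close>

lemma quasi_anisotropic_iff:
  "quasi_anisotropic R M N B \<longleftrightarrow> locally_half_aniso 1 \<and> locally_half_aniso 2"
proof -
  have iff: "quasi_anisotropic_local (loc_ring R p) (loc_ideal R p) (loc_module R p M) (loc_module R p N) (loc_form R p N B)
    \<longleftrightarrow> half_aniso R M N B e q 1 \<and> half_aniso R M N B e q 2" if pf: "prime_factor R p e q n" for p e q n
  proof -
    interpret pf: prime_factor R p e q n by (rule pf)
    let ?\<phi> = "\<lambda>r. loc_frac R p (regular_module R) r \<one>"
    note fp = loc_form_presentation[OF pf]
    have "local_form_presentation R e q n M N B 0 (loc_ring R p) (loc_module R p M) (loc_module R p N)
      (loc_form R p N B) ?\<phi> (\<lambda>x. loc_frac R p M x \<one>) (\<lambda>x. loc_frac R p N x \<one>)"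
      using fp pf.loc_map_e
      by (intro local_form_presentation.intro pf.local_factor local_form_presentation_axioms.intro) simp_all
    from local_form_presentation.quasi_anisotropic_local_iff[OF this pf.loc_ideal_PIdl]
    show ?thesis using nondegenerate_image[OF fp pf.e_idem nondeg] by (simp add: numeral_2_eq_2)
  qed
  have "quasi_anisotropic R M N B \<longleftrightarrow> (\<forall>p e q n. prime_factor R p e q n \<longrightarrow>
    quasi_anisotropic_local (loc_ring R p) (loc_ideal R p) (loc_module R p M) (loc_module R p N) (loc_form R p N B))"
    unfolding quasi_anisotropic_def by (meson exists_prime_factor prime_factor.prime)
  then show ?thesis using iff by blast
qed

text \<open>Primes of \<open>R/Soc R\<close> correspond to the primes of \<open>R\<close> that
  contain \<open>Soc R\<close>, the annihilator of \<open>s\<close>. At these the localized quotient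
  form has kernel scalar \<open>e q\<close>, and its odd and even forms express \<open>A(1)\<close>
  and \<open>A(2)\<close>. At the other primes \<open>e q = 0\<close>, and both conditions hold
  automatically.\<close>

lemma anisotropic_socle_quotient_iff:
  "anisotropic (R Quot Soc R (regular_module R)) (fact_module_over M (Soc R M))
     (fact_module_over N (Soc R N)) (quot_form N (Soc R N) B) \<longleftrightarrow>
   locally_half_aniso 1 \<and> locally_half_aniso 2"
proof -
  obtain s where s: "s \<in> carrier R" "\<And>a. a \<in> carrier R \<Longrightarrow> a \<in> PIdl s \<longleftrightarrow> (\<forall>p. primeideal p R \<longrightarrow> a \<in> p)"
    using exists_radical_generator by blast
  then interpret radical_generator R s by unfold_locales
  let ?J = "tors (regular_module R) {s}"
  let ?R = "R Quot ?J" and ?M = "fact_module_over M (tors M {s})" and ?N = "fact_module_over N (tors N {s})"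
  let ?B = "quot_form N (tors N {s}) B"
  let ?\<phi> = "a_r_coset R ?J" and ?h = "a_r_coset M (tors M {s})" and ?g = "a_r_coset N (tors N {s})"
  note fp = quot_form_presentation[OF s_closed]
  note socs = Soc_eq_tors[OF module_axioms] Soc_eq_tors[OF N.module_axioms] Soc_eq_tors[OF module_regular]
  interpret pm: presentation R M s ?R ?M ?\<phi> ?h using form_presentationD(2)[OF fp] .
  interpret J: ideal ?J R by (rule tors_ideal[OF s_closed])
  interpret fm2: form_module ?R ?M ?N ?B by (rule form_presentation_image[OF fp])
  let ?aniso = "\<lambda>p. anisotropic_on (odd_module (loc_ring ?R p) (loc_module ?R p ?M))
       (loc_module ?R p ?N) (odd_form (loc_form ?R p ?N ?B)) \<and>
     anisotropic_on (even_module (loc_ring ?R p) (loc_ideal ?R p) (loc_module ?R p ?M))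
       (even_quot (loc_ideal ?R p) (loc_module ?R p ?N))
       (even_form (loc_ideal ?R p) (loc_module ?R p ?N) (loc_form ?R p ?N ?B))"
  have iff: "?aniso p' \<longleftrightarrow> half_aniso R M N B e q 1 \<and> half_aniso R M N B e q 2"
    if pf: "prime_factor R p e q n" and p': "primeideal p' ?R" and p: "p = {a \<in> carrier R. ?\<phi> a \<in> p'}" for p e q n p'
  proof -
    interpret pf: prime_factor R p e q n by (rule pf)
    have pf': "prime_factor ?R p' (?\<phi> e) (?\<phi> q) n"
      by (rule pf.prime_factor_image[OF pm.ring_surj_axioms p' p])
    interpret pf': prime_factor ?R p' "?\<phi> e" "?\<phi> q" n by (rule pf')
    let ?\<phi>' = "\<lambda>r. loc_frac ?R p' (regular_module ?R) r \<one>\<^bsub>?R\<^esub>"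
    have "form_presentation R M N B (s \<otimes> e) (loc_ring ?R p') (loc_module ?R p' ?M) (loc_module ?R p' ?N)
      (loc_form ?R p' ?N ?B) (?\<phi>' \<circ> ?\<phi>) ((\<lambda>x. loc_frac ?R p' ?M x \<one>\<^bsub>?R\<^esub>) \<circ> ?h) ((\<lambda>x. loc_frac ?R p' ?N x \<one>\<^bsub>?R\<^esub>) \<circ> ?g)"
      by (rule form_presentation_comp[OF fp fm2.loc_form_presentation[OF pf'] pf.e_closed])
    \<comment> \<open>The composite has kernel scalar \<open>s e\<close>; exchanging it for
      \<open>e q^1\<close>, which annihilates the same elements, gives the standard shape with
      \<open>j = 1\<close>.\<close>
    then have "form_presentation R M N B (e \<otimes> q [^] (1::nat)) (loc_ring ?R p') (loc_module ?R p' ?M) (loc_module ?R p' ?N)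
      (loc_form ?R p' ?N ?B) (?\<phi>' \<circ> ?\<phi>) ((\<lambda>x. loc_frac ?R p' ?M x \<one>\<^bsub>?R\<^esub>) \<circ> ?h) ((\<lambda>x. loc_frac ?R p' ?N x \<one>\<^bsub>?R\<^esub>) \<circ> ?g)"
      by (rule form_presentation_change)
        (use kernel_radical[OF pf module_axioms] kernel_radical[OF pf N.module_axioms] pf.e_closed pf.q_closed in auto)
    then interpret l: local_form_presentation R e q n M N B 1 "loc_ring ?R p'" "loc_module ?R p' ?M" "loc_module ?R p' ?N"
      "loc_form ?R p' ?N ?B" "?\<phi>' \<circ> ?\<phi>" "(\<lambda>x. loc_frac ?R p' ?M x \<one>\<^bsub>?R\<^esub>) \<circ> ?h" "(\<lambda>x. loc_frac ?R p' ?N x \<one>\<^bsub>?R\<^esub>) \<circ> ?g"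
      using pf'.loc_map_e
      by (intro local_form_presentation.intro pf.local_factor local_form_presentation_axioms.intro) simp_all
    have m: "loc_ideal ?R p' = PIdl\<^bsub>loc_ring ?R p'\<^esub> ((?\<phi>' \<circ> ?\<phi>) q)" using pf'.loc_ideal_PIdl by simp
    show ?thesis
      unfolding l.anisotropic_odd_iff_half_aniso l.anisotropic_even_iff_half_aniso[OF m] by (simp add: numeral_2_eq_2)
  qed
  \<comment> \<open>Some \<open>a\<close> outside \<open>p\<close> satisfies \<open>s a = 0\<close>
    and is a unit on \<open>e R\<close>, so \<open>s\<close>, and with it \<open>e q\<close>,
    vanishes there. Then \<open>1\<close> is an admissible nilpotency bound, and every element
    satisfies \<open>P j\<close> for \<open>j \<ge> 1\<close>.\<close>
  have trivial: "half_aniso R M N B e q 1 \<and> half_aniso R M N B e q 2"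
    if pf: "prime_factor R p e q n" and J: "\<not> ?J \<subseteq> p" for p e q n
  proof -
    interpret pf: prime_factor R p e q n by (rule pf)
    obtain a where a: "a \<in> carrier R" "s \<otimes> a = \<zero>" "a \<notin> p" using J unfolding tors_def by auto
    obtain v where v: "v \<in> carrier R" "a \<otimes> v \<otimes> e = e" using pf.unit[of a] a by blast
    obtain c where c: "c \<in> carrier R" "e \<otimes> q = c \<otimes> s" using prime_factor_radical(1)[OF pf] by blast
    have "e \<otimes> q = (a \<otimes> v \<otimes> e) \<otimes> q" using v(2) by simp
    also have "\<dots> = (e \<otimes> q) \<otimes> (a \<otimes> v)" using a(1) v(1) by (simp add: m_ac)
    also have "\<dots> = c \<otimes> (s \<otimes> a) \<otimes> v" unfolding c(2) using a(1) v(1) c(1) by (simp add: m_ac)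
    also have "\<dots> = \<zero>" using a(2) v(1) c(1) by simp
    finally have eq: "e \<otimes> q [^] (1::nat) = \<zero>" by simp
    interpret l: local_module R e q 1 M
      by unfold_locales (use eq pf.e_idem pf.factor in auto)
    show ?thesis unfolding half_aniso_def using l.half_div_large by auto
  qed
  have "anisotropic ?R ?M ?N ?B \<longleftrightarrow> locally_half_aniso 1 \<and> locally_half_aniso 2"
  proof
    assume A: "anisotropic ?R ?M ?N ?B"
    have "half_aniso R M N B e q 1 \<and> half_aniso R M N B e q 2" if pf: "prime_factor R p e q n" for p e q n
    proof (cases "?J \<subseteq> p")
      case True
      interpret pf: prime_factor R p e q n by (rule pf)
      interpret p: primeideal p R by (rule pf.prime)
      \<comment> \<open>\<open>p\<close> contains the kernel \<open>?J\<close> of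
        \<open>?\<phi>\<close>, so it is the full preimage of its image.\<close>
      have mem: "a \<in> p" if a: "a \<in> carrier R" "?\<phi> a \<in> ?\<phi> ` p" for a
      proof -
        obtain b where b: "b \<in> p" "?\<phi> a = ?\<phi> b" using a(2) by blast
        have "a \<in> ?J +> b" using b(2) J.a_rcos_self[OF a(1)] by simp
        then obtain c where "c \<in> ?J" "a = c \<oplus> b" unfolding a_r_coset_def' by blast
        then show ?thesis using True b(1) by auto
      qed
      have p': "primeideal (?\<phi> ` p) ?R"
      proof (rule primeidealI)
        show "cring ?R" by (rule pm.cring_codomain)
        have "?\<phi> ` p = PIdl\<^bsub>?R\<^esub> (?\<phi> q)" unfolding pf.p_eq by (rule pm.phi_PIdl[OF pf.q_closed])
        then show "ideal (?\<phi> ` p) ?R" using cring.cgenideal_ideal[OF pm.cring_codomain, of "?\<phi> q"] pf.q_closed by simp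
        show "carrier ?R \<noteq> ?\<phi> ` p"
        proof
          assume "carrier ?R = ?\<phi> ` p"
          then have "?\<phi> \<one> \<in> ?\<phi> ` p" using pm.phi_closed[OF one_closed] by blast
          then have "\<one> \<in> p" by (rule mem[OF one_closed])
          then have "p = carrier R" by (rule p.one_imp_carrier)
          then show False using p.I_notcarr by simp
        qed
        fix x y assume x: "x \<in> carrier ?R" and y: "y \<in> carrier ?R" and xy: "x \<otimes>\<^bsub>?R\<^esub> y \<in> ?\<phi> ` p"
        obtain a where a: "a \<in> carrier R" "x = ?\<phi> a" using x by (rule pm.phi_obtain)
        obtain b where b: "b \<in> carrier R" "y = ?\<phi> b" using y by (rule pm.phi_obtain)
        have "?\<phi> (a \<otimes> b) \<in> ?\<phi> ` p" using xy a b by simp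
        then have "a \<otimes> b \<in> p" using a(1) b(1) by (intro mem m_closed)
        then have "a \<in> p \<or> b \<in> p" by (rule p.I_prime[OF a(1) b(1)])
        then show "x \<in> ?\<phi> ` p \<or> y \<in> ?\<phi> ` p" unfolding a(2) b(2) by blast
      qed
      have "p = {a \<in> carrier R. ?\<phi> a \<in> ?\<phi> ` p}" using mem p.a_subset by blast
      from iff[OF pf p' this] show ?thesis using A p' unfolding anisotropic_def by blast
    qed (use trivial[OF pf] in blast)
    then show "locally_half_aniso 1 \<and> locally_half_aniso 2" by blast
  next
    assume C: "locally_half_aniso 1 \<and> locally_half_aniso 2"
    show "anisotropic ?R ?M ?N ?B" unfolding anisotropic_def
    proof (intro allI impI)
      fix p' assume p': "primeideal p' ?R"
      interpret p': primeideal p' ?R by (rule p')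
      let ?p = "{a \<in> carrier R. ?\<phi> a \<in> p'}"
      have "primeideal ?p R"
      proof (rule primeidealI)
        show "ideal ?p R"
        proof (rule idealI[OF ring_axioms])
          have "\<ominus> a \<in> ?p" if a: "a \<in> ?p" for a
          proof -
            have "?\<phi> (\<ominus> \<one> \<otimes> a) \<in> p'" using a p'.I_l_closed by simp
            then show ?thesis using a by (simp add: l_minus)
          qed
          then show "subgroup ?p (add_monoid R)"
            by (intro subgroup.intro) (auto simp: a_inv_def[symmetric])
          show "x \<otimes> a \<in> ?p" "a \<otimes> x \<in> ?p" if "a \<in> ?p" "x \<in> carrier R" for a x
            using that p'.I_l_closed p'.I_r_closed by auto
        qed
        show "carrier R \<noteq> ?p"
        proof
          assume "carrier R = ?p"
          then have "\<one> \<in> ?p" using one_closed by metis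
          then have "\<one>\<^bsub>?R\<^esub> \<in> p'" by simp
          then have "p' = carrier ?R" by (rule p'.one_imp_carrier)
          then show False using p'.I_notcarr by simp
        qed
        show "a \<in> ?p \<or> b \<in> ?p" if "a \<in> carrier R" "b \<in> carrier R" "a \<otimes> b \<in> ?p" for a b
          using that p'.I_prime[of "?\<phi> a" "?\<phi> b"] by simp
      qed (rule is_cring)
      then obtain e q n where "prime_factor R ?p e q n" using exists_prime_factor by blast
      from iff[OF this p' refl] show "?aniso p'" using C \<open>prime_factor R ?p e q n\<close> by blast
    qed
  qed
  then show ?thesis unfolding socs .
qed

end

theorem theorem9p4:
  fixes R :: "('a, 'r) ring_scheme"
    and M :: "('a, 'b, 'm) module_scheme"
    and N :: "('a, 'c, 'n) module_scheme"
    and B :: "'b \<Rightarrow> 'b \<Rightarrow> 'c"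
  assumes "cring R" and "artinian_ring R" and "principal_ideal_ring R"
    and "module R M" and "fin_gen_module R M"
    and "module R N" and "is_module_iso R N (regular_module R)"
    and "symmetric_bilinear_form R M N B"
    and "nondegenerate R M N B"
  shows "(quasi_anisotropic R M N B \<longleftrightarrow>
           anisotropic (R Quot Soc R (regular_module R))
             (fact_module_over M (Soc R M))
             (fact_module_over N (Soc R N))
             (quot_form N (Soc R N) B)) \<and>
         (quasi_anisotropic R M N B \<longleftrightarrow>
           (\<forall>L. submodule L R M \<and> L \<subseteq> lr R M \<longrightarrow>
              lr R (fact_module (M\<lparr>carrier := perp M N B L\<rparr>) L)
                = carrier (fact_module (M\<lparr>carrier := lr R M\<rparr>) L)))"
proof -
  interpret perfect_form R M N B
    using assms
    by (intro perfect_form.intro form_module.intro form_module_axioms.intro artinian_pir.intro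
        artinian_pir_axioms.intro perfect_form_axioms.intro)
  show ?thesis
    unfolding quasi_anisotropic_iff anisotropic_socle_quotient_iff lr_perp_quotient_iff by blast
qed

end
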